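(* Let $\hbar>0$ and let $F$ be a complex-valued function on $\mathbb{R}^4_+=\{(x,y,b,r)\in\mathbb{R}^4 : r>0\}$. Then there exists $f\in L^2(\mathbb{R})$ such that $F=\mathcal{W}f$ on $\mathbb{R}^4_+$, where $\mathcal{W}f$ is the metamorphism of $f$, $$[\mathcal{W}f](x,y,b,r)=\sqrt[4]{2r^2}\int_{\mathbb{R}} f(u)\,\exp\left(-\pi\hbar\left((r^2-\mathrm{i}b)(u-y)^2+2\mathrm{i}(u-y)x\right)\right)\,du ,$$ if and only if $F$ satisfies both of the following conditions: (1) $F$ is annihilated by the three operators $\mathcal{C}_1,\mathcal{C}_2,\mathcal{S}_1$, that is, $\mathcal{C}_1F=0$, $\mathcal{C}_2F=0$ and $\mathcal{S}_1F=0$ on $\mathbb{R}^4_+$, where $$\mathcal{C}_1=\frac1r\left((r^2-\mathrm{i}b)\,\partial_x+\mathrm{i}\,\partial_y+2\pi\hbar x\, I\right),\qquad \mathcal{C}_2=2r^2\,\partial_b+\mathrm{i}r\,\partial_r-\tfrac12\mathrm{i}\,I,\qquad \mathcal{S}_1=r^2\left(4\pi\mathrm{i}\hbar\,\partial_b-\partial^2_{xx}\right);$$ (2) for some $(b_0,r_0)\in\mathbb{R}^2_+=\{(b,r)\in\mathbb{R}^2: r>0\}$ the function $F(\cdot,\cdot,b_0,r_0)$ is square-integrable in the sense that $$\int_{\mathbb{R}^2}|F(x,y,b_0,r_0)|^2\,\frac{\hbar\,dx\,dy}{\sqrt{2r_0}}<\infty .$$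
   Context: $\hbar>0$ is a fixed real parameter, $\mathrm{i}$ is the imaginary unit and $I$ is the identity operator. $L^2(\mathbb{R})$ is the space of complex-valued square-integrable functions on $\mathbb{R}$ with Lebesgue measure. For every $f\in L^2(\mathbb{R})$ and $(x,y,b,r)$ with $r>0$ the integral defining the metamorphism converges absolutely. The differential operators act on $F$ in the classical sense: "$F$ is annihilated by $\mathcal{C}_1,\mathcal{C}_2,\mathcal{S}_1$" means that $F$ is twice continuously differentiable on $\mathbb{R}^4_+$ and the three equations hold at every point. *)

theory Defs
  imports "HOL-Analysis.Analysis"
begin

text \<open>A function on the half-space is represented by a total function on \<open>\<real>\<^sup>4\<close>, whose values
  off \<open>R4plus\<close> are irrelevant.  Points are written \<open>(x, y, b, r)\<close>.\<close>

definition R4plus :: "(real \<times> real \<times> real \<times> real) set" where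
  "R4plus = {(x, y, b, r). r > 0}"

text \<open>Representatives of elements of \<open>L\<^sup>2(\<real>)\<close>.\<close>

definition L2_real :: "(real \<Rightarrow> complex) set" where
  "L2_real = {f \<in> borel_measurable lebesgue. integrable lebesgue (\<lambda>u. (cmod (f u))\<^sup>2)}"

definition metamorphism ::
    "real \<Rightarrow> (real \<Rightarrow> complex) \<Rightarrow> real \<times> real \<times> real \<times> real \<Rightarrow> complex" where
  "metamorphism hbar f = (\<lambda>(x, y, b, r).
     complex_of_real (root 4 (2 * r\<^sup>2)) *
     (LINT u|lebesgue. f u *
        exp (- complex_of_real (pi * hbar) *
          ((complex_of_real (r\<^sup>2) - \<i> * complex_of_real b) * complex_of_real ((u - y)\<^sup>2)
            + 2 * \<i> * complex_of_real (u - y) * complex_of_real x))))"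

text \<open>Twice continuous (real Frechet) differentiability on an open set.\<close>

definition twice_continuously_differentiable_on ::
    "('a::real_normed_vector \<Rightarrow> 'b::real_normed_vector) \<Rightarrow> 'a set \<Rightarrow> bool" where
  "twice_continuously_differentiable_on F S \<longleftrightarrow>
     (\<exists>(F' :: 'a \<Rightarrow> 'a \<Rightarrow>\<^sub>L 'b) (F'' :: 'a \<Rightarrow> 'a \<Rightarrow>\<^sub>L 'a \<Rightarrow>\<^sub>L 'b).
        (\<forall>p\<in>S. (F has_derivative blinfun_apply (F' p)) (at p)) \<and>
        (\<forall>p\<in>S. (F' has_derivative blinfun_apply (F'' p)) (at p)) \<and>
        continuous_on S F'')"

text \<open>The partial derivatives are total operators; they carry their classical meaning at points
  where the derivative exists.\<close>

type_synonym fun4 = "real \<times> real \<times> real \<times> real \<Rightarrow> complex"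

definition partial_x :: "fun4 \<Rightarrow> fun4" where
  "partial_x F = (\<lambda>(x, y, b, r). vector_derivative (\<lambda>t. F (t, y, b, r)) (at x))"

definition partial_y :: "fun4 \<Rightarrow> fun4" where
  "partial_y F = (\<lambda>(x, y, b, r). vector_derivative (\<lambda>t. F (x, t, b, r)) (at y))"

definition partial_b :: "fun4 \<Rightarrow> fun4" where
  "partial_b F = (\<lambda>(x, y, b, r). vector_derivative (\<lambda>t. F (x, y, t, r)) (at b))"

definition partial_r :: "fun4 \<Rightarrow> fun4" where
  "partial_r F = (\<lambda>(x, y, b, r). vector_derivative (\<lambda>t. F (x, y, b, t)) (at r))"

definition op_C1 :: "real \<Rightarrow> fun4 \<Rightarrow> fun4" where
  "op_C1 hbar F = (\<lambda>(x, y, b, r).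
     complex_of_real (1 / r) *
       ((complex_of_real (r\<^sup>2) - \<i> * complex_of_real b) * partial_x F (x, y, b, r)
         + \<i> * partial_y F (x, y, b, r)
         + complex_of_real (2 * pi * hbar * x) * F (x, y, b, r)))"

definition op_C2 :: "fun4 \<Rightarrow> fun4" where
  "op_C2 F = (\<lambda>(x, y, b, r).
     complex_of_real (2 * r\<^sup>2) * partial_b F (x, y, b, r)
       + \<i> * complex_of_real r * partial_r F (x, y, b, r)
       - (1 / 2) * \<i> * F (x, y, b, r))"

definition op_S1 :: "real \<Rightarrow> fun4 \<Rightarrow> fun4" where
  "op_S1 hbar F = (\<lambda>(x, y, b, r).
     complex_of_real (r\<^sup>2) *
       (4 * complex_of_real pi * \<i> * complex_of_real hbar * partial_b F (x, y, b, r)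
         - partial_x (partial_x F) (x, y, b, r)))"

text \<open>The regularity requirement is part of the definition: the operators act classically.\<close>

definition annihilated_by_C1_C2_S1 :: "real \<Rightarrow> fun4 \<Rightarrow> bool" where
  "annihilated_by_C1_C2_S1 hbar F \<longleftrightarrow>
     twice_continuously_differentiable_on F R4plus \<and>
     (\<forall>p\<in>R4plus. op_C1 hbar F p = 0 \<and> op_C2 F p = 0 \<and> op_S1 hbar F p = 0)"

end

theory Submission
  imports Defs "HOL-Complex_Analysis.Complex_Analysis" "HOL-Probability.Probability"
begin

text \<open>  Write \<open>c = \<pi> \<hbar>\<close>, \<open>s = r\<^sup>2\<close> and \<open>a = s - \<i> b\<close>.  For fixed \<open>(b, r)\<close> the metamorphism is, up to
  the factor \<open>(2 r\<^sup>2)\<close> to the power \<open>1/4\<close>, the integral transform with the Gaussian kernel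
  \<open>k\<^sub>z(u) = exp (- c (a (u - y)\<^sup>2 + 2 \<i> (u - y) x))\<close>, \<open>z = (x, y)\<close>, a version of the Bargmann transform.

  A metamorphism solves the equations because the kernel does.  Differentiation under the integral
  is justified once and for all for the integrals
  \<open>\<integral> f(u) u\<^sup>n exp (- A u\<^sup>2 + B u) du\<close> as functions of two complex variables \<open>A\<close>, \<open>B\<close> with \<open>Re A > 0\<close>
  (\<open>gaussian_moment_has_derivative\<close>): their derivatives are integrals of the same kind, so they are smooth.

  Square integrability of a slice, and the reconstruction of \<open>f\<close> from a slice, both rest on the
  explicit reproducing kernel \<open>K(z, w) = \<integral> k\<^sub>z(u) cnj (k\<^sub>w(u)) du\<close>.  Its modulus is a Gaussian in \<open>w - z\<close>,
  so its mass does not depend on \<open>z\<close>, and Schur's test bounds the adjoint transform from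
  \<open>L\<^sup>2(\<real>\<^sup>2)\<close> to \<open>L\<^sup>2(\<real>)\<close> (\<open>adj_sq_int\<close>); by duality the transform itself is bounded (\<open>fwd_sq_int\<close>).

  Conversely, let \<open>G\<close> be a square-integrable slice of a solution.  The equation \<open>\<C>\<^sub>1 F = 0\<close> is a
  Cauchy-Riemann equation: for fixed \<open>z\<close> the product \<open>K(z, w) G(w)\<close> equals, up to a positive constant, a radial Gaussian
  times an entire function of \<open>\<eta> = a (y' - y) - \<i> (x' - x)\<close>, where \<open>w = (x', y')\<close>
  (\<open>gauged_holomorphic\<close>).  Averaging over rotations of \<open>\<eta>\<close> and the mean value property give
  \<open>\<integral> K(z, w) G(w) dw = const G(z)\<close> (\<open>reproducing\<close>).  Hence the adjoint transforms of the truncations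
  of \<open>G\<close> to balls are transformed back to functions tending to \<open>G\<close>; they form a Cauchy sequence in
  \<open>L\<^sup>2(\<real>)\<close> by Schur's test, and completeness supplies \<open>f\<close> with transform \<open>G\<close> (\<open>fwd_onto\<close>).

  It remains to see that a solution \<open>D\<close> vanishes if one slice \<open>D(\<cdot>, \<cdot>, b\<^sub>0, r\<^sub>0)\<close> does
  (\<open>solution_unique\<close>).  The equation \<open>\<C>\<^sub>2 D = 0\<close> says that \<open>D / \<surd>r\<close> is holomorphic in
  \<open>w = b + \<i> r\<^sup>2\<close>, and \<open>\<S>\<^sub>1 D = 0\<close> turns a \<open>w\<close>-derivative into two \<open>x\<close>-derivatives.  So
  if the \<open>n\<close>-th \<open>w\<close>-derivative at \<open>w\<^sub>0\<close> vanishes for all \<open>x\<close>, the next one does as well, and \<open>D\<close> vanishes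
  on the whole upper half-plane by the identity theorem.  Applied to the difference of the given solution and the
  metamorphism of \<open>f\<close>, this proves the theorem.\<close>

section \<open>Solutions of the differential equations in coordinates\<close>

text \<open>Frechet differentiability together with names for the four partial derivatives, so that
  derivatives can be manipulated as scalar functions instead of bounded linear maps.\<close>

definition grad4 :: "fun4 \<Rightarrow> fun4 \<Rightarrow> fun4 \<Rightarrow> fun4 \<Rightarrow> fun4 \<Rightarrow> bool" where
  "grad4 F Fx Fy Fb Fr \<longleftrightarrow> (\<forall>p\<in>R4plus. (F has_derivative
     (\<lambda>h. fst h *\<^sub>R Fx p + fst (snd h) *\<^sub>R Fy p + fst (snd (snd h)) *\<^sub>R Fb p + snd (snd (snd h)) *\<^sub>R Fr p)) (at p))"

text \<open>The recursion makes closure properties provable by induction on the order: it suffices to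
  exhibit partial derivatives that belong to the same closed class.\<close>

primrec Ck :: "nat \<Rightarrow> fun4 \<Rightarrow> bool" where
  "Ck 0 F = continuous_on R4plus F"
| "Ck (Suc k) F = (\<exists>Fx Fy Fb Fr. grad4 F Fx Fy Fb Fr \<and> Ck k Fx \<and> Ck k Fy \<and> Ck k Fb \<and> Ck k Fr)"

lemma open_R4plus: "open R4plus"
proof -
  have "R4plus = {p. snd (snd (snd p)) > 0}" by (auto simp: R4plus_def)
  moreover have "open {p :: real \<times> real \<times> real \<times> real. 0 < snd (snd (snd p))}"
    by (intro open_Collect_less continuous_intros)
  ultimately show ?thesis by simp
qed

lemma in_R4plus [simp]: "(x, y, b, r) \<in> R4plus \<longleftrightarrow> r > 0"
  by (simp add: R4plus_def)

lemma grad4_continuous: "grad4 F Fx Fy Fb Fr \<Longrightarrow> continuous_on R4plus F"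
  unfolding grad4_def
  by (meson continuous_at_imp_continuous_on has_derivative_continuous)

lemma Ck_continuous: "Ck k F \<Longrightarrow> continuous_on R4plus F"
  by (cases k) (auto intro: grad4_continuous)

lemma grad4_cong:
  assumes "grad4 F Fx Fy Fb Fr" "\<And>p. p \<in> R4plus \<Longrightarrow> F p = G p"
  shows "grad4 G Fx Fy Fb Fr"
  using assms unfolding grad4_def
  by (meson has_derivative_transform_within_open open_R4plus)

lemma grad4_cong':
  assumes "grad4 F Fx Fy Fb Fr" "\<And>p. p \<in> R4plus \<Longrightarrow> Fx p = Gx p"
   "\<And>p. p \<in> R4plus \<Longrightarrow> Fy p = Gy p" "\<And>p. p \<in> R4plus \<Longrightarrow> Fb p = Gb p" "\<And>p. p \<in> R4plus \<Longrightarrow> Fr p = Gr p"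
  shows "grad4 F Gx Gy Gb Gr"
  using assms unfolding grad4_def by auto

lemma Ck_2: "Ck 2 F \<longleftrightarrow> (\<exists>Fx Fy Fb Fr. grad4 F Fx Fy Fb Fr \<and> Ck 1 Fx \<and> Ck 1 Fy \<and> Ck 1 Fb \<and> Ck 1 Fr)"
  using Ck.simps(2)[of 1 F] by (simp only: Suc_1)

lemma Ck_SucI:
  "grad4 F Fx Fy Fb Fr \<Longrightarrow> Ck k Fx \<Longrightarrow> Ck k Fy \<Longrightarrow> Ck k Fb \<Longrightarrow> Ck k Fr \<Longrightarrow> Ck (Suc k) F"
  unfolding Ck.simps by blast

lemma grad4_partial:
  assumes "grad4 F Fx Fy Fb Fr" "r > 0"
  shows "((\<lambda>t. F (t, y, b, r)) has_vector_derivative Fx (x, y, b, r)) (at x)"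
    "((\<lambda>t. F (x, t, b, r)) has_vector_derivative Fy (x, y, b, r)) (at y)"
    "((\<lambda>t. F (x, y, t, r)) has_vector_derivative Fb (x, y, b, r)) (at b)"
    "((\<lambda>t. F (x, y, b, t)) has_vector_derivative Fr (x, y, b, r)) (at r)"
proof -
  have D: "(F has_derivative
     (\<lambda>h. fst h *\<^sub>R Fx (x,y,b,r) + fst (snd h) *\<^sub>R Fy (x,y,b,r) + fst (snd (snd h)) *\<^sub>R Fb (x,y,b,r) + snd (snd (snd h)) *\<^sub>R Fr (x,y,b,r))) (at (x,y,b,r))"
    using assms by (auto simp: grad4_def)
  have line: "((\<lambda>t. F (g t)) has_vector_derivative (fst h *\<^sub>R Fx (x,y,b,r) + fst (snd h) *\<^sub>R Fy (x,y,b,r) + fst (snd (snd h)) *\<^sub>R Fb (x,y,b,r) + snd (snd (snd h)) *\<^sub>R Fr (x,y,b,r))) (at t)"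
    if "g t = (x,y,b,r)" "(g has_derivative (\<lambda>k. k *\<^sub>R h)) (at t)" for g t h
    using has_derivative_compose[OF that(2) D[folded that(1)]] that(1)
    by (simp add: has_vector_derivative_def scaleR_add_right)
  have "((\<lambda>t. (t, y, b, r)) has_derivative (\<lambda>k. k *\<^sub>R (1,0,0,0))) (at x)"
    "((\<lambda>t. (x, t, b, r)) has_derivative (\<lambda>k. k *\<^sub>R (0,1,0,0))) (at y)"
    "((\<lambda>t. (x, y, t, r)) has_derivative (\<lambda>k. k *\<^sub>R (0,0,1,0))) (at b)"
    "((\<lambda>t. (x, y, b, t)) has_derivative (\<lambda>k. k *\<^sub>R (0,0,0,1))) (at r)"
    by (auto intro!: derivative_eq_intros simp: fun_eq_iff zero_prod_def)
  note ln = this[THEN line[rotated]]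
  show "((\<lambda>t. F (t, y, b, r)) has_vector_derivative Fx (x, y, b, r)) (at x)"
    "((\<lambda>t. F (x, t, b, r)) has_vector_derivative Fy (x, y, b, r)) (at y)"
    "((\<lambda>t. F (x, y, t, r)) has_vector_derivative Fb (x, y, b, r)) (at b)"
    "((\<lambda>t. F (x, y, b, t)) has_vector_derivative Fr (x, y, b, r)) (at r)"
    using ln(1)[OF refl] ln(2)[OF refl] ln(3)[OF refl] ln(4)[OF refl]
    by (simp_all only: fst_conv snd_conv scaleR_one scaleR_zero_left add_0_left add_0_right)
qed

lemma partial_eq:
  assumes "grad4 F Fx Fy Fb Fr" "r > 0"
  shows "partial_x F (x, y, b, r) = Fx (x, y, b, r)" "partial_y F (x, y, b, r) = Fy (x, y, b, r)"
    "partial_b F (x, y, b, r) = Fb (x, y, b, r)" "partial_r F (x, y, b, r) = Fr (x, y, b, r)"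
  using grad4_partial[OF assms]
  by (simp_all add: partial_x_def partial_y_def partial_b_def partial_r_def vector_derivative_at)

lemma partial_xx_eq:
  assumes "grad4 F Fx Fy Fb Fr" "grad4 Fx Fxx Fxy Fxb Fxr" "r > 0"
  shows "partial_x (partial_x F) (x, y, b, r) = Fxx (x, y, b, r)"
proof -
  have "partial_x (partial_x F) (x, y, b, r) = vector_derivative (\<lambda>t. Fx (t, y, b, r)) (at x)"
    using assms by (subst partial_x_def) (simp add: partial_eq(1)[OF assms(1)])
  then show ?thesis
    using grad4_partial(1)[OF assms(2,3)] by (simp add: vector_derivative_at)
qed

lemma linear_real4:
  fixes L :: "real \<times> real \<times> real \<times> real \<Rightarrow> 'a::real_vector"
  assumes "linear L"
  shows "L h = fst h *\<^sub>R L (1,0,0,0) + fst (snd h) *\<^sub>R L (0,1,0,0) + fst (snd (snd h)) *\<^sub>R L (0,0,1,0) + snd (snd (snd h)) *\<^sub>R L (0,0,0,1)"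
proof -
  have "h = fst h *\<^sub>R (1,0,0,0) + fst (snd h) *\<^sub>R (0,1,0,0) + fst (snd (snd h)) *\<^sub>R (0,0,1,0) + snd (snd (snd h)) *\<^sub>R (0,0,0,1)"
    by (cases h) simp
  then have "L h = L (fst h *\<^sub>R (1,0,0,0) + fst (snd h) *\<^sub>R (0,1,0,0) + fst (snd (snd h)) *\<^sub>R (0,0,1,0) + snd (snd (snd h)) *\<^sub>R (0,0,0,1))"
    by simp
  then show ?thesis
    by (simp only: linear_add[OF assms] linear_scale[OF assms])
qed

lemma Ck2_if_twice:
  assumes "twice_continuously_differentiable_on F R4plus"
  shows "Ck 2 F"
proof -
  obtain F' :: "_ \<Rightarrow> (real \<times> real \<times> real \<times> real) \<Rightarrow>\<^sub>L complex" and F''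
    where F': "\<And>p. p \<in> R4plus \<Longrightarrow> (F has_derivative blinfun_apply (F' p)) (at p)"
      and F'': "\<And>p. p \<in> R4plus \<Longrightarrow> (F' has_derivative blinfun_apply (F'' p)) (at p)"
      and co: "continuous_on R4plus F''"
    using assms unfolding twice_continuously_differentiable_on_def by blast
  have g: "grad4 (\<lambda>p. F' p v) (\<lambda>p. F'' p (1,0,0,0) v) (\<lambda>p. F'' p (0,1,0,0) v) (\<lambda>p. F'' p (0,0,1,0) v) (\<lambda>p. F'' p (0,0,0,1) v)" for v
    unfolding grad4_def
  proof
    fix p :: "real \<times> real \<times> real \<times> real" assume p: "p \<in> R4plus"
    have lin: "linear (\<lambda>h. F'' p h v)"
      by (simp add: linear_iff blinfun.add_left blinfun.add_right blinfun.scaleR_left blinfun.scaleR_right)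
    have "((\<lambda>p. F' p v) has_derivative (\<lambda>h. F'' p h v)) (at p)"
      using F''[OF p] by (auto intro!: derivative_eq_intros)
    then show "((\<lambda>p. F' p v) has_derivative (\<lambda>h. fst h *\<^sub>R F'' p (1,0,0,0) v + fst (snd h) *\<^sub>R F'' p (0,1,0,0) v +
       fst (snd (snd h)) *\<^sub>R F'' p (0,0,1,0) v + snd (snd (snd h)) *\<^sub>R F'' p (0,0,0,1) v)) (at p)"
      by (rule has_derivative_eq_rhs) (rule ext, rule linear_real4[OF lin])
  qed
  have gF: "grad4 F (\<lambda>p. F' p (1,0,0,0)) (\<lambda>p. F' p (0,1,0,0)) (\<lambda>p. F' p (0,0,1,0)) (\<lambda>p. F' p (0,0,0,1))"
    unfolding grad4_def
  proof
    fix p :: "real \<times> real \<times> real \<times> real" assume p: "p \<in> R4plus"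
    have lin: "linear (F' p)"
      by (simp add: linear_iff blinfun.add_right blinfun.scaleR_right)
    show "(F has_derivative (\<lambda>h. fst h *\<^sub>R F' p (1,0,0,0) + fst (snd h) *\<^sub>R F' p (0,1,0,0) +
       fst (snd (snd h)) *\<^sub>R F' p (0,0,1,0) + snd (snd (snd h)) *\<^sub>R F' p (0,0,0,1))) (at p)"
      by (rule has_derivative_eq_rhs[OF F'[OF p]]) (rule ext, rule linear_real4[OF lin])
  qed
  have "continuous_on R4plus (\<lambda>p. F'' p w v)" for w v
    by (rule blinfun.continuous_on[OF blinfun.continuous_on[OF co continuous_on_const] continuous_on_const])
  then have "Ck 1 (\<lambda>p. F' p v)" for v
    unfolding One_nat_def by (intro Ck_SucI[OF g]) simp_all
  then show ?thesis
    unfolding Suc_1[symmetric] by (intro Ck_SucI[OF gF])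
qed

text \<open>The gradient is rebuilt as \<open>\<Sum>i<4. J i (G i p)\<close>, where the bounded linear map \<open>J i\<close> sends a complex number
  \<open>z\<close> to the linear form \<open>h \<mapsto> h\<^sub>i z\<close>; differentiating this sum again only uses linearity of \<open>J i\<close>.\<close>

lemma twice_if_Ck2:
  assumes "Ck 2 F"
  shows "twice_continuously_differentiable_on F R4plus"
proof -
  define e where "e = (\<lambda>i::nat. if i = 0 then fst_blinfun else if i = 1 then fst_blinfun o\<^sub>L snd_blinfun
     else if i = 2 then fst_blinfun o\<^sub>L (snd_blinfun o\<^sub>L snd_blinfun)
     else snd_blinfun o\<^sub>L (snd_blinfun o\<^sub>L snd_blinfun) :: (real \<times> real \<times> real \<times> real) \<Rightarrow>\<^sub>L real)"
  define J where "J = (\<lambda>i (z::complex). blinfun_scaleR_left z o\<^sub>L e i)"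
  have J: "bounded_linear (J i)" for i
    unfolding J_def
    by (rule bounded_linear_compose[OF bounded_bilinear.bounded_linear_left[OF bounded_bilinear_blinfun_compose] bounded_linear_blinfun_scaleR_left])
  have Japp: "blinfun_apply (J i z) h = blinfun_apply (e i) h *\<^sub>R z" for i z h
    by (simp add: J_def)
  have eapp: "blinfun_apply (e 0) h = fst h" "blinfun_apply (e (Suc 0)) h = fst (snd h)"
     "blinfun_apply (e 2) h = fst (snd (snd h))" "blinfun_apply (e 3) h = snd (snd (snd h))" for h
    by (simp_all add: e_def fst_blinfun.rep_eq snd_blinfun.rep_eq)
  from assms obtain G where gF: "grad4 F (G 0) (G 1) (G 2) (G (3::nat))" and G: "\<And>i. i < 4 \<Longrightarrow> Ck 1 (G i)"
  proof -
    assume *: "\<And>G. grad4 F (G 0) (G 1) (G 2) (G (3::nat)) \<Longrightarrow> (\<And>i. i < 4 \<Longrightarrow> Ck 1 (G i)) \<Longrightarrow> thesis"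
    from assms obtain a b c d where "grad4 F a b c d" "Ck 1 a" "Ck 1 b" "Ck 1 c" "Ck 1 d"
      unfolding Ck_2 by blast
    then show thesis
      by (intro *[of "\<lambda>i. if i = 0 then a else if i = 1 then b else if i = 2 then c else d"]) auto
  qed
  have "\<exists>H. grad4 (G i) (H 0) (H 1) (H 2) (H (3::nat)) \<and> (\<forall>j<4. Ck 0 (H j))" if "i < 4" for i
  proof -
    from G[OF that] obtain a b c d where "grad4 (G i) a b c d" "Ck 0 a" "Ck 0 b" "Ck 0 c" "Ck 0 d"
      by auto
    then show ?thesis
      by (intro exI[of _ "\<lambda>i. if i = 0 then a else if i = 1 then b else if i = 2 then c else d"]) auto
  qed
  then obtain H where gG: "\<And>i. i < 4 \<Longrightarrow> grad4 (G i) (H i 0) (H i 1) (H i 2) (H i (3::nat))"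
    and H: "\<And>i j. i < 4 \<Longrightarrow> j < 4 \<Longrightarrow> continuous_on R4plus (H i j)"
    by (metis Ck.simps(1))
  define F' where "F' = (\<lambda>p. \<Sum>i<4. J i (G i p))"
  define G' where "G' = (\<lambda>i p. \<Sum>j<4. J j (H i j p))"
  define F'' where "F'' = (\<lambda>p. \<Sum>i<4. Blinfun (J i) o\<^sub>L G' i p)"
  have s4: "(\<Sum>i<4. f i) = f 0 + f 1 + f 2 + f (3::nat)" for f :: "nat \<Rightarrow> 'x::comm_monoid_add"
    by (simp add: eval_nat_numeral add.assoc)
  have D1: "(F has_derivative blinfun_apply (F' p)) (at p)" if "p \<in> R4plus" for p
  proof (rule has_derivative_eq_rhs)
    show "(F has_derivative (\<lambda>h. fst h *\<^sub>R G 0 p + fst (snd h) *\<^sub>R G 1 p + fst (snd (snd h)) *\<^sub>R G 2 p +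
       snd (snd (snd h)) *\<^sub>R G 3 p)) (at p)"
      using gF that unfolding grad4_def by blast
  qed (simp add: F'_def fun_eq_iff s4 blinfun.add_left Japp eapp)
  have DG: "(G i has_derivative blinfun_apply (G' i p)) (at p)" if "p \<in> R4plus" "i < 4" for p i
  proof (rule has_derivative_eq_rhs)
    show "(G i has_derivative (\<lambda>h. fst h *\<^sub>R H i 0 p + fst (snd h) *\<^sub>R H i 1 p + fst (snd (snd h)) *\<^sub>R H i 2 p +
       snd (snd (snd h)) *\<^sub>R H i 3 p)) (at p)"
      using gG[OF that(2)] that unfolding grad4_def by blast
  qed (simp add: G'_def fun_eq_iff s4 blinfun.add_left Japp eapp)
  have D2: "(F' has_derivative blinfun_apply (F'' p)) (at p)" if "p \<in> R4plus" for p
  proof -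
    have "(F' has_derivative (\<lambda>h. \<Sum>i<4. J i (G' i p h))) (at p)"
      unfolding F'_def
      by (rule has_derivative_sum) (auto intro: bounded_linear.has_derivative[OF J] DG that)
    moreover have "(\<lambda>h. \<Sum>i<4. J i (G' i p h)) = blinfun_apply (F'' p)"
      by (rule ext) (simp add: F''_def blinfun.sum_left bounded_linear_Blinfun_apply[OF J])
    ultimately show ?thesis by simp
  qed
  have "continuous_on R4plus F''"
    unfolding F''_def G'_def
    by (intro continuous_on_sum bounded_bilinear.continuous_on[OF bounded_bilinear_blinfun_compose]
          continuous_on_const bounded_linear.continuous_on[OF J] H) auto
  with D1 D2 show ?thesis
    unfolding twice_continuously_differentiable_on_def by blast
qed

text \<open>The three equations after division by the factors \<open>1/r\<close>, \<open>r\<close> and \<open>r\<^sup>2\<close>, which do not vanish on the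
  half-space; \<open>c\<close> stands for \<open>\<pi> \<hbar>\<close>.\<close>

definition pde :: "real \<Rightarrow> fun4 \<Rightarrow> fun4 \<Rightarrow> fun4 \<Rightarrow> fun4 \<Rightarrow> fun4 \<Rightarrow> fun4 \<Rightarrow> bool" where
  "pde c F Fx Fy Fb Fr Fxx \<longleftrightarrow> (\<forall>x y b r. r > 0 \<longrightarrow>
      (of_real (r\<^sup>2) - \<i> * of_real b) * Fx (x,y,b,r) + \<i> * Fy (x,y,b,r) + of_real (2 * c * x) * F (x,y,b,r) = 0 \<and>
      2 * of_real r * Fb (x,y,b,r) + \<i> * Fr (x,y,b,r) = (\<i> / (2 * of_real r)) * F (x,y,b,r) \<and>
      Fxx (x,y,b,r) = 4 * \<i> * of_real c * Fb (x,y,b,r))"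

lemma operators_vanish_iff:
  assumes "grad4 F Fx Fy Fb Fr" "grad4 Fx Fxx Fxy Fxb Fxr"
  shows "(\<forall>p\<in>R4plus. op_C1 hbar F p = 0 \<and> op_C2 F p = 0 \<and> op_S1 hbar F p = 0) \<longleftrightarrow> pde (pi * hbar) F Fx Fy Fb Fr Fxx"
proof -
  have eqs: "(op_C1 hbar F (x,y,b,r) = 0 \<and> op_C2 F (x,y,b,r) = 0 \<and> op_S1 hbar F (x,y,b,r) = 0) \<longleftrightarrow>
       ((of_real (r\<^sup>2) - \<i> * of_real b) * Fx (x,y,b,r) + \<i> * Fy (x,y,b,r) + of_real (2 * (pi * hbar) * x) * F (x,y,b,r) = 0 \<and>
        2 * of_real r * Fb (x,y,b,r) + \<i> * Fr (x,y,b,r) = (\<i> / (2 * of_real r)) * F (x,y,b,r) \<and>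
        Fxx (x,y,b,r) = 4 * \<i> * of_real (pi * hbar) * Fb (x,y,b,r))"
    if "r > 0" for x y b r
  proof -
    have r: "complex_of_real r \<noteq> 0" using that by simp
    have "op_C1 hbar F (x,y,b,r) = 0 \<longleftrightarrow> (of_real (r\<^sup>2) - \<i> * of_real b) * Fx (x,y,b,r) + \<i> * Fy (x,y,b,r) + of_real (2 * (pi * hbar) * x) * F (x,y,b,r) = 0"
      using r by (simp add: op_C1_def partial_eq[OF assms(1) that] mult.assoc)
    moreover have "op_C2 F (x,y,b,r) = 0 \<longleftrightarrow> 2 * of_real r * Fb (x,y,b,r) + \<i> * Fr (x,y,b,r) = (\<i> / (2 * of_real r)) * F (x,y,b,r)"
    proof -
      have "op_C2 F (x,y,b,r) = of_real r * (2 * of_real r * Fb (x,y,b,r) + \<i> * Fr (x,y,b,r) - (\<i> / (2 * of_real r)) * F (x,y,b,r))"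
        using r by (simp add: op_C2_def partial_eq[OF assms(1) that] field_simps power2_eq_square)
      then show ?thesis using r by simp
    qed
    moreover have "op_S1 hbar F (x,y,b,r) = 0 \<longleftrightarrow> Fxx (x,y,b,r) = 4 * \<i> * of_real (pi * hbar) * Fb (x,y,b,r)"
      using r by (auto simp: op_S1_def partial_eq[OF assms(1) that] partial_xx_eq[OF assms that] algebra_simps)
    ultimately show ?thesis by simp
  qed
  then have "(\<forall>p\<in>R4plus. op_C1 hbar F p = 0 \<and> op_C2 F p = 0 \<and> op_S1 hbar F p = 0) \<longleftrightarrow>
     (\<forall>x y b r. r > 0 \<longrightarrow> op_C1 hbar F (x,y,b,r) = 0 \<and> op_C2 F (x,y,b,r) = 0 \<and> op_S1 hbar F (x,y,b,r) = 0)"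
    by (auto simp: R4plus_def)
  then show ?thesis unfolding pde_def
    using eqs by simp
qed

definition pde_solution :: "real \<Rightarrow> fun4 \<Rightarrow> fun4 \<Rightarrow> fun4 \<Rightarrow> fun4 \<Rightarrow> fun4 \<Rightarrow> fun4 \<Rightarrow> bool" where
  "pde_solution c F Fx Fy Fb Fr Fxx \<longleftrightarrow> grad4 F Fx Fy Fb Fr \<and> (\<exists>Fxy Fxb Fxr. grad4 Fx Fxx Fxy Fxb Fxr) \<and>
     Ck 1 Fx \<and> Ck 1 Fy \<and> Ck 1 Fb \<and> Ck 1 Fr \<and> continuous_on R4plus Fxx \<and> pde c F Fx Fy Fb Fr Fxx"

lemma annihilated_iff:
  "annihilated_by_C1_C2_S1 hbar F \<longleftrightarrow> (\<exists>Fx Fy Fb Fr Fxx. pde_solution (pi * hbar) F Fx Fy Fb Fr Fxx)"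
proof
  assume L: "annihilated_by_C1_C2_S1 hbar F"
  then have "Ck 2 F" by (auto simp: annihilated_by_C1_C2_S1_def intro: Ck2_if_twice)
  then obtain Fx Fy Fb Fr where 1: "grad4 F Fx Fy Fb Fr" and c: "Ck 1 Fx" "Ck 1 Fy" "Ck 1 Fb" "Ck 1 Fr"
    unfolding Ck_2 by blast
  then obtain Fxx Fxy Fxb Fxr where 2: "grad4 Fx Fxx Fxy Fxb Fxr" "continuous_on R4plus Fxx"
    by auto
  show "\<exists>Fx Fy Fb Fr Fxx. pde_solution (pi * hbar) F Fx Fy Fb Fr Fxx"
    unfolding pde_solution_def
    using 1 2 c L operators_vanish_iff[OF 1 2(1)] unfolding annihilated_by_C1_C2_S1_def by blast
next
  assume "\<exists>Fx Fy Fb Fr Fxx. pde_solution (pi * hbar) F Fx Fy Fb Fr Fxx"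
  then obtain Fx Fy Fb Fr Fxx Fxy Fxb Fxr where g: "grad4 F Fx Fy Fb Fr" "grad4 Fx Fxx Fxy Fxb Fxr"
    "pde (pi * hbar) F Fx Fy Fb Fr Fxx" "Ck 1 Fx" "Ck 1 Fy" "Ck 1 Fb" "Ck 1 Fr"
    unfolding pde_solution_def by blast
  then have "Ck 2 F" unfolding Ck_2 by blast
  with g operators_vanish_iff[OF g(1,2)] show "annihilated_by_C1_C2_S1 hbar F"
    by (simp add: annihilated_by_C1_C2_S1_def twice_if_Ck2)
qed

lemma annihilated_cong:
  assumes "annihilated_by_C1_C2_S1 hbar F" "\<And>p. p \<in> R4plus \<Longrightarrow> F p = G p"
  shows "annihilated_by_C1_C2_S1 hbar G"
proof -
  obtain Fx Fy Fb Fr Fxx where F: "pde_solution (pi * hbar) F Fx Fy Fb Fr Fxx"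
    using assms(1) unfolding annihilated_iff by blast
  have "pde (pi * hbar) G Fx Fy Fb Fr Fxx" using F assms(2)
    unfolding pde_solution_def pde_def by simp
  then have "pde_solution (pi * hbar) G Fx Fy Fb Fr Fxx"
    using F grad4_cong[of F Fx Fy Fb Fr G] assms(2) unfolding pde_solution_def by simp
  then show ?thesis unfolding annihilated_iff by blast
qed

lemma grad4_diff:
  assumes "grad4 F Fx Fy Fb Fr" "grad4 G Gx Gy Gb Gr"
  shows "grad4 (\<lambda>p. F p - G p) (\<lambda>p. Fx p - Gx p) (\<lambda>p. Fy p - Gy p) (\<lambda>p. Fb p - Gb p) (\<lambda>p. Fr p - Gr p)"
  unfolding grad4_def
proof (rule ballI, goal_cases)
  case (1 p)
  with assms show ?case
    unfolding grad4_def
    by (auto intro!: derivative_eq_intros simp: algebra_simps)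
qed

lemma Ck_diff: "Ck k F \<Longrightarrow> Ck k G \<Longrightarrow> Ck k (\<lambda>p. F p - G p)"
proof (induction k arbitrary: F G)
  case 0 then show ?case by (auto intro: continuous_intros)
next
  case (Suc k)
  from Suc.prems obtain Fx Fy Fb Fr Gx Gy Gb Gr where
     "grad4 F Fx Fy Fb Fr" "Ck k Fx" "Ck k Fy" "Ck k Fb" "Ck k Fr"
     "grad4 G Gx Gy Gb Gr" "Ck k Gx" "Ck k Gy" "Ck k Gb" "Ck k Gr" by auto
  then show ?case by (intro Ck_SucI[OF grad4_diff] Suc.IH)
qed

lemma annihilated_diff:
  assumes "annihilated_by_C1_C2_S1 hbar F" "annihilated_by_C1_C2_S1 hbar G"
  shows "annihilated_by_C1_C2_S1 hbar (\<lambda>p. F p - G p)"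
proof -
  obtain Fx Fy Fb Fr Fxx where F: "pde_solution (pi * hbar) F Fx Fy Fb Fr Fxx"
    using assms(1) unfolding annihilated_iff by blast
  obtain Gx Gy Gb Gr Gxx where G: "pde_solution (pi * hbar) G Gx Gy Gb Gr Gxx"
    using assms(2) unfolding annihilated_iff by blast
  have eqs: "pde (pi * hbar) (\<lambda>p. F p - G p) (\<lambda>p. Fx p - Gx p) (\<lambda>p. Fy p - Gy p) (\<lambda>p. Fb p - Gb p)
       (\<lambda>p. Fr p - Gr p) (\<lambda>p. Fxx p - Gxx p)"
    unfolding pde_def
  proof (intro allI impI, goal_cases)
    case (1 x y b r)
    then have "r > 0" .
    have f: "pde (pi * hbar) F Fx Fy Fb Fr Fxx" and g: "pde (pi * hbar) G Gx Gy Gb Gr Gxx"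
      using F G by (auto simp: pde_solution_def)
    have 1: "a1 * (u - u') + a2 * (v - v') + a3 * (w - w') = 0"
      if "a1 * u + a2 * v + a3 * w = 0" "a1 * u' + a2 * v' + a3 * w' = 0"
      for a1 a2 a3 u u' v v' w w' :: complex
      using that by (simp add: right_diff_distrib) (metis add_diff_add diff_self)
    have 2: "a1 * (u - u') + a2 * (v - v') = a3 * (w - w')"
      if "a1 * u + a2 * v = a3 * w" "a1 * u' + a2 * v' = a3 * w'"
      for a1 a2 a3 u u' v v' w w' :: complex
      using that by (simp add: right_diff_distrib) (metis add_diff_add)
    have 3: "u - u' = a1 * (v - v')" if "u = a1 * v" "u' = a1 * v'" for a1 u u' v v' :: complex
      using that by (simp add: right_diff_distrib)
    show ?case
      using f g \<open>r > 0\<close> unfolding pde_def by (intro conjI 1 2 3) blast+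
  qed
  moreover obtain Fxy Fxb Fxr where F1: "grad4 F Fx Fy Fb Fr" "grad4 Fx Fxx Fxy Fxb Fxr" "Ck 1 Fx" "Ck 1 Fy" "Ck 1 Fb" "Ck 1 Fr"
    "continuous_on R4plus Fxx"
    using F unfolding pde_solution_def by blast
  moreover obtain Gxy Gxb Gxr where G1: "grad4 G Gx Gy Gb Gr" "grad4 Gx Gxx Gxy Gxb Gxr" "Ck 1 Gx" "Ck 1 Gy" "Ck 1 Gb" "Ck 1 Gr"
    "continuous_on R4plus Gxx"
    using G unfolding pde_solution_def by blast
  ultimately have "\<exists>Hy Hb Hr. grad4 (\<lambda>p. Fx p - Gx p) (\<lambda>p. Fxx p - Gxx p) Hy Hb Hr"
    by (intro exI) (rule grad4_diff)
  with eqs have "pde_solution (pi * hbar) (\<lambda>p. F p - G p) (\<lambda>p. Fx p - Gx p) (\<lambda>p. Fy p - Gy p) (\<lambda>p. Fb p - Gb p)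
       (\<lambda>p. Fr p - Gr p) (\<lambda>p. Fxx p - Gxx p)"
    unfolding pde_solution_def
    by (intro conjI grad4_diff[OF F1(1) G1(1)] Ck_diff F1 G1 continuous_on_diff)
  then show ?thesis unfolding annihilated_iff by blast
qed

section \<open>Gaussian integrals\<close>

lemma gaussian_has_integral_std:
  fixes t :: real
  shows "has_bochner_integral lborel (\<lambda>x. exp (complex_of_real (- x\<^sup>2 / 2) + \<i> * of_real (t * x)))
    (of_real (sqrt (2 * pi)) * exp (of_real (- t\<^sup>2 / 2)))"
proof -
  have *: "std_normal_density x *\<^sub>R iexp (t * x) = (1 / sqrt (2 * pi)) *\<^sub>R exp (complex_of_real (- x\<^sup>2 / 2) + \<i> * of_real (t * x))" for x
    by (simp add: std_normal_density_def exp_of_real[symmetric] scaleR_conv_of_real exp_add[symmetric] algebra_simps)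
  have "integrable lborel (\<lambda>x. std_normal_density x *\<^sub>R iexp (t * x))"
    by (rule Bochner_Integration.integrable_bound[OF integrable_normal_density[of 1 0]]) auto
  then have 1: "integrable lborel (\<lambda>x. exp (complex_of_real (- x\<^sup>2 / 2) + \<i> * of_real (t * x)))"
    using integrable_scaleR_right[of "sqrt (2 * pi)" lborel "\<lambda>x. std_normal_density x *\<^sub>R iexp (t * x)"]
    unfolding * by simp
  have "exp (of_real (- t\<^sup>2 / 2)) = char std_normal_distribution t"
    by (simp add: char_std_normal_distribution exp_of_real[symmetric])
  also have "\<dots> = (CLINT x|lborel. std_normal_density x *\<^sub>R iexp (t * x))"
    unfolding char_def by (subst integral_density) (auto intro!: AE_I2)
  also have "\<dots> = (1 / sqrt (2 * pi)) *\<^sub>R (CLINT x|lborel. exp (complex_of_real (- x\<^sup>2 / 2) + \<i> * of_real (t * x)))"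
    unfolding * by (rule integral_scaleR_right)
  finally have "(CLINT x|lborel. exp (complex_of_real (- x\<^sup>2 / 2) + \<i> * of_real (t * x))) = of_real (sqrt (2 * pi)) * exp (of_real (- t\<^sup>2 / 2))"
    by (simp add: scaleR_conv_of_real field_simps)
  with 1 show ?thesis by (simp add: has_bochner_integral_iff)
qed

text \<open>Completing the square in the real part of \<open>\<beta>\<close> and rescaling reduce this to the characteristic function
  of the standard normal distribution.\<close>

lemma gaussian_has_integral:
  fixes e :: real and \<beta> :: complex
  assumes "e > 0"
  shows "has_bochner_integral lborel (\<lambda>u. exp (- of_real (e * u\<^sup>2) + \<beta> * of_real u))
    (of_real (sqrt (pi / e)) * exp (\<beta>\<^sup>2 / of_real (4 * e)))"
proof -
  define k where "k = 1 / sqrt (2 * e)"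
  have k: "k > 0" "k\<^sup>2 = 1 / (2 * e)" using assms by (auto simp: k_def power_divide)
  define t where "t = Im \<beta> * k"
  define m where "m = Re \<beta> / (2 * e)"
  have ex: "- of_real (e * (m + k * x)\<^sup>2) + \<beta> * of_real (m + k * x) =
      (complex_of_real (- x\<^sup>2 / 2) + \<i> * of_real (t * x)) + of_real (Re \<beta> * m / 2) + \<i> * of_real (Im \<beta> * m)" for x
  proof (rule complex_eqI)
    have "e * (m + k * x)\<^sup>2 = e * m\<^sup>2 + 2 * e * m * k * x + e * k\<^sup>2 * x\<^sup>2"
      by (simp add: power2_eq_square algebra_simps)
    also have "\<dots> = Re \<beta> * m / 2 + Re \<beta> * k * x + x\<^sup>2 / 2"
      unfolding k(2) m_def using assms by (simp add: power2_eq_square)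
    finally show "Re (- of_real (e * (m + k * x)\<^sup>2) + \<beta> * of_real (m + k * x)) =
      Re ((complex_of_real (- x\<^sup>2 / 2) + \<i> * of_real (t * x)) + of_real (Re \<beta> * m / 2) + \<i> * of_real (Im \<beta> * m))"
      by (simp add: algebra_simps)
  qed (simp add: t_def algebra_simps)
  have "has_bochner_integral lborel (\<lambda>x. exp (complex_of_real (- x\<^sup>2 / 2) + \<i> * of_real (t * x)) * (exp (of_real (Re \<beta> * m / 2)) * exp (\<i> * of_real (Im \<beta> * m))))
     (of_real (sqrt (2 * pi)) * exp (of_real (- t\<^sup>2 / 2)) * (exp (of_real (Re \<beta> * m / 2)) * exp (\<i> * of_real (Im \<beta> * m))))"
    by (intro has_bochner_integral_mult_left gaussian_has_integral_std)
  then have "has_bochner_integral lborel (\<lambda>x. exp (- of_real (e * (m + k * x)\<^sup>2) + \<beta> * of_real (m + k * x)))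
     (of_real (sqrt (2 * pi)) * exp (of_real (- t\<^sup>2 / 2)) * (exp (of_real (Re \<beta> * m / 2)) * exp (\<i> * of_real (Im \<beta> * m))))"
    unfolding ex by (simp add: exp_add mult_ac)
  also have "(of_real (sqrt (2 * pi)) * exp (of_real (- t\<^sup>2 / 2)) * (exp (of_real (Re \<beta> * m / 2)) * exp (\<i> * of_real (Im \<beta> * m))))
     = (of_real (sqrt (pi / e)) * exp (\<beta>\<^sup>2 / of_real (4 * e))) /\<^sub>R \<bar>k\<bar>"
  proof -
    have t2: "t\<^sup>2 = (Im \<beta>)\<^sup>2 / (2 * e)"
      by (simp add: t_def power_mult_distrib k(2))
    have "complex_of_real (- t\<^sup>2 / 2) + (of_real (Re \<beta> * m / 2) + \<i> * of_real (Im \<beta> * m)) = \<beta>\<^sup>2 / of_real (4 * e)"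
    proof (rule complex_eqI)
      show "Re (complex_of_real (- t\<^sup>2 / 2) + (of_real (Re \<beta> * m / 2) + \<i> * of_real (Im \<beta> * m))) = Re (\<beta>\<^sup>2 / of_real (4 * e))"
        using assms unfolding Re_divide_of_real t2 m_def by (simp add: power2_eq_square field_simps)
      show "Im (complex_of_real (- t\<^sup>2 / 2) + (of_real (Re \<beta> * m / 2) + \<i> * of_real (Im \<beta> * m))) = Im (\<beta>\<^sup>2 / of_real (4 * e))"
        using assms unfolding Im_divide_of_real m_def by (simp add: power2_eq_square field_simps)
    qed
    moreover have "sqrt (2 * pi) = sqrt (pi / e) / \<bar>k\<bar>"
      using k assms by (simp add: k_def real_sqrt_mult real_sqrt_divide)
    ultimately show ?thesis
      by (simp only: mult_exp_exp mult.assoc scaleR_conv_of_real of_real_mult of_real_divide divide_inverse of_real_inverse ac_simps)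
  qed
  finally show ?thesis
    using lborel_has_bochner_integral_real_affine_iff[of k "\<lambda>u. exp (- of_real (e * u\<^sup>2) + \<beta> * of_real u)" _ m] k(1)
    by simp
qed

lemma gaussian_integrable_real: "e > 0 \<Longrightarrow> integrable lborel (\<lambda>u::real. exp (- (e * (u - m)\<^sup>2)))"
  and gaussian_integral_real: "e > 0 \<Longrightarrow> (LINT u|lborel. exp (- (e * (u - m)\<^sup>2))) = sqrt (pi / e)"
proof -
  assume e: "e > 0"
  have "has_bochner_integral lborel (\<lambda>u. complex_of_real (exp (- (e * u\<^sup>2)))) (of_real (sqrt (pi / e)))"
    using gaussian_has_integral[OF e, of 0] by (simp add: exp_of_real[symmetric])
  then have 1: "has_bochner_integral lborel (\<lambda>u. exp (- (e * u\<^sup>2))) (sqrt (pi / e))"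
    by (simp add: has_bochner_integral_iff complex_of_real_integrable_eq)
  have "has_bochner_integral lborel (\<lambda>u. exp (- (e * (u - m)\<^sup>2))) (sqrt (pi / e))"
    using lborel_has_bochner_integral_real_affine_iff[of 1 "\<lambda>u. exp (- (e * u\<^sup>2))" "sqrt (pi / e)" "- m"] 1
    by (simp add: algebra_simps power2_commute)
  then show "integrable lborel (\<lambda>u::real. exp (- (e * (u - m)\<^sup>2)))"
    "(LINT u|lborel. exp (- (e * (u - m)\<^sup>2))) = sqrt (pi / e)"
    by (simp_all add: has_bochner_integral_iff)
qed

section \<open>Square-integrable functions\<close>

text \<open>Representatives of elements of \<open>L\<^sup>2\<close> of an arbitrary measure; with Lebesgue measure on the Borel
  sets the representatives are Borel functions, which keeps Fubini's theorem convenient.\<close>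

definition sq_int :: "'a measure \<Rightarrow> ('a \<Rightarrow> complex) \<Rightarrow> bool" where
  "sq_int M f \<longleftrightarrow> f \<in> borel_measurable M \<and> integrable M (\<lambda>u. (cmod (f u))\<^sup>2)"

lemma sq_int_mult:
  assumes "sq_int M f" "sq_int M g"
  shows "integrable M (\<lambda>u. f u * g u)"
proof (rule Bochner_Integration.integrable_bound)
  show "integrable M (\<lambda>u. (cmod (f u))\<^sup>2 + (cmod (g u))\<^sup>2)"
    using assms by (auto simp: sq_int_def)
  show "(\<lambda>u. f u * g u) \<in> borel_measurable M"
    using assms by (auto simp: sq_int_def)
  have "a * b \<le> a\<^sup>2 + b\<^sup>2" for a b :: real
    using sum_squares_bound[of a b] sum_squares_ge_zero[of a b] unfolding power2_eq_square by linarith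
  then show "AE u in M. norm (f u * g u) \<le> norm ((cmod (f u))\<^sup>2 + (cmod (g u))\<^sup>2)"
    by (intro AE_I2) (simp add: norm_mult)
qed

text \<open>Half of the Gaussian absorbs both the exponential and the power, since \<open>\<bar>u\<bar> \<le> exp \<bar>u\<bar>\<close>.\<close>

lemma gaussian_weight_bound:
  fixes M :: real
  assumes "e > 0" "M \<ge> 0"
  shows "\<bar>u\<bar> ^ n * exp (- (e * u\<^sup>2) + M * \<bar>u\<bar>) \<le> exp ((M + n)\<^sup>2 / (2 * e)) * exp (- (e / 2 * u\<^sup>2))"
proof -
  define L where "L = M + n"
  have "\<bar>u\<bar> \<le> exp \<bar>u\<bar>"
    using exp_ge_add_one_self[of "\<bar>u\<bar>"] by linarith
  then have "\<bar>u\<bar> ^ n \<le> exp \<bar>u\<bar> ^ n"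
    by (intro power_mono) auto
  then have "\<bar>u\<bar> ^ n * exp (- (e * u\<^sup>2) + M * \<bar>u\<bar>) \<le> exp (n * \<bar>u\<bar>) * exp (- (e * u\<^sup>2) + M * \<bar>u\<bar>)"
    unfolding exp_of_nat_mult by (rule mult_right_mono) simp
  also have "\<dots> = exp (L * \<bar>u\<bar> - e * u\<^sup>2)"
    unfolding mult_exp_exp by (simp add: L_def algebra_simps)
  also have "\<dots> \<le> exp (L\<^sup>2 / (2 * e) + - (e / 2 * u\<^sup>2))"
  proof -
    have "0 \<le> e / 2 * (\<bar>u\<bar> - L / e)\<^sup>2" using assms by simp
    also have "\<dots> = e / 2 * \<bar>u\<bar>\<^sup>2 - L * \<bar>u\<bar> + L\<^sup>2 / (2 * e)"
      using assms(1) unfolding power2_eq_square by (simp add: field_simps)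
    finally have "L * \<bar>u\<bar> \<le> e / 2 * u\<^sup>2 + L\<^sup>2 / (2 * e)" by simp
    then show ?thesis by simp
  qed
  finally show ?thesis unfolding L_def exp_add .
qed

lemma sq_int_gaussian_weight:
  fixes w :: "real \<Rightarrow> complex"
  assumes "e > 0" "M \<ge> 0" "w \<in> borel_measurable borel"
    "\<And>u. cmod (w u) \<le> K * (\<bar>u\<bar> ^ n * exp (- (e * u\<^sup>2) + M * \<bar>u\<bar>))" "K \<ge> 0"
  shows "sq_int lborel w"
  unfolding sq_int_def
proof
  show "integrable lborel (\<lambda>u. (cmod (w u))\<^sup>2)"
  proof (rule Bochner_Integration.integrable_bound)
    show "integrable lborel (\<lambda>u. (K * exp ((M + n)\<^sup>2 / (2 * e)))\<^sup>2 * exp (- (e * (u - 0)\<^sup>2)))"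
      by (intro integrable_mult_right gaussian_integrable_real assms)
    show "(\<lambda>u. (cmod (w u))\<^sup>2) \<in> borel_measurable lborel" using assms(3) by simp
    have "(cmod (w u))\<^sup>2 \<le> (K * exp ((M + n)\<^sup>2 / (2 * e)))\<^sup>2 * exp (- (e * (u - 0)\<^sup>2))" for u
    proof -
      have "cmod (w u) \<le> K * exp ((M + n)\<^sup>2 / (2 * e)) * exp (- (e / 2 * u\<^sup>2))"
        using assms(4)[of u] mult_left_mono[OF gaussian_weight_bound[OF assms(1,2), of u n] assms(5)]
        by (simp add: mult.assoc)
      then have "(cmod (w u))\<^sup>2 \<le> (K * exp ((M + n)\<^sup>2 / (2 * e)) * exp (- (e / 2 * u\<^sup>2)))\<^sup>2"
        by (intro power_mono) auto
      also have "\<dots> = (K * exp ((M + n)\<^sup>2 / (2 * e)))\<^sup>2 * exp (2 * - (e / 2 * u\<^sup>2))"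
        by (subst power_mult_distrib) (simp only: exp_double)
      finally show ?thesis by simp
    qed
    then show "AE u in lborel. norm ((cmod (w u))\<^sup>2) \<le> norm ((K * exp ((M + n)\<^sup>2 / (2 * e)))\<^sup>2 * exp (- (e * (u - 0)\<^sup>2)))"
      by (intro AE_I2, unfold real_norm_def abs_of_nonneg[OF zero_le_power2], rule order_trans[OF _ abs_ge_self])
  qed
qed (use assms(3) in simp)

section \<open>Smoothness of Gaussian transforms\<close>

definition gaussian_moment :: "(real \<Rightarrow> complex) \<Rightarrow> nat \<Rightarrow> complex \<Rightarrow> complex \<Rightarrow> complex" where
  "gaussian_moment f n A B = (LINT u|lborel. f u * (of_real u ^ n * exp (- A * of_real (u\<^sup>2) + B * of_real u)))"

lemma cmod_gaussian_exp:
  "cmod (exp (- A * of_real (u\<^sup>2) + B * of_real u)) = exp (- (Re A * u\<^sup>2) + Re B * u)"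
  by simp

lemma Re_mult_le: "Re B * u \<le> cmod B * \<bar>u\<bar>"
proof -
  have "Re B * u \<le> \<bar>Re B\<bar> * \<bar>u\<bar>"
    by (simp add: abs_mult[symmetric])
  also have "\<dots> \<le> cmod B * \<bar>u\<bar>"
    by (intro mult_right_mono abs_Re_le_cmod) simp
  finally show ?thesis .
qed

lemma sq_int_gaussian_moment_weight:
  assumes "Re A > 0"
  shows "sq_int lborel (\<lambda>u. of_real u ^ n * exp (- A * of_real (u\<^sup>2) + B * of_real u))"
proof (rule sq_int_gaussian_weight[of "Re A" "cmod B" _ 1 n])
  show "(\<lambda>u. of_real u ^ n * exp (- A * of_real (u\<^sup>2) + B * of_real u)) \<in> borel_measurable borel"
    by measurable
  fix u :: real
  show "cmod (of_real u ^ n * exp (- A * of_real (u\<^sup>2) + B * of_real u)) \<le> 1 * (\<bar>u\<bar> ^ n * exp (- (Re A * u\<^sup>2) + cmod B * \<bar>u\<bar>))"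
    unfolding norm_mult cmod_gaussian_exp using Re_mult_le[of B u] by (simp add: norm_power mult_left_mono)
qed (use assms in auto)

lemma gaussian_moment_integrable:
  assumes "sq_int lborel f" "Re A > 0"
  shows "integrable lborel (\<lambda>u. f u * (of_real u ^ n * exp (- A * of_real (u\<^sup>2) + B * of_real u)))"
  using sq_int_mult[OF assms(1) sq_int_gaussian_moment_weight[OF assms(2)]] .

lemma has_derivative_quadratic:
  fixes f :: "'a::real_normed_vector \<Rightarrow> 'b::real_normed_vector"
  assumes "bounded_linear D" "d > 0" "\<And>h. norm h < d \<Longrightarrow> norm (f (x + h) - f x - D h) \<le> K * (norm h)\<^sup>2"
  shows "(f has_derivative D) (at x)"
  unfolding has_derivative_at_alt
proof (intro conjI allI impI)
  fix e :: real assume e: "e > 0"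
  define d' where "d' = min d (e / (\<bar>K\<bar> + 1))"
  have "d' > 0" using e assms(2) by (simp add: d'_def)
  moreover have "norm (f y - f x - D (y - x)) \<le> e * norm (y - x)" if "norm (y - x) < d'" for y
  proof -
    have "norm (f y - f x - D (y - x)) \<le> K * (norm (y - x))\<^sup>2"
      using assms(3)[of "y - x"] that by (simp add: d'_def)
    also have "\<dots> \<le> (\<bar>K\<bar> + 1) * norm (y - x) * norm (y - x)"
      unfolding power2_eq_square mult.assoc by (intro mult_right_mono) auto
    also have "\<dots> \<le> e * norm (y - x)"
    proof (rule mult_right_mono)
      have "norm (y - x) \<le> e / (\<bar>K\<bar> + 1)" using that by (simp add: d'_def)
      then show "(\<bar>K\<bar> + 1) * norm (y - x) \<le> e" by (simp add: field_simps)
    qed simp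
    finally show ?thesis .
  qed
  ultimately show "\<exists>d>0. \<forall>y. norm (y - x) < d \<longrightarrow> norm (f y - f x - D (y - x)) \<le> e * norm (y - x)"
    by blast
qed (use assms in auto)

lemma cmod_exp_remainder: "cmod (exp z - 1 - z) \<le> exp (cmod z) * (cmod z)\<^sup>2"
proof -
  have "cmod (exp z - 1 - z) \<le> exp \<bar>Re z\<bar> * (cmod z)\<^sup>2"
    using Taylor_exp[of z 1] by (simp add: numeral_2_eq_2 algebra_simps)
  also have "\<dots> \<le> exp (cmod z) * (cmod z)\<^sup>2"
    by (intro mult_right_mono) (simp_all add: abs_Re_le_cmod)
  finally show ?thesis .
qed

text \<open>With \<open>\<delta> = - a u\<^sup>2 + b u\<close> the increment of the exponent in direction \<open>h = (a, b)\<close>, the error of the linear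
  approximation is the integral of \<open>f(u) u\<^sup>n E(u) (exp \<delta> - 1 - \<delta>)\<close>.  As long as \<open>\<parallel>h\<parallel> < Re A / 2\<close>, half of
  the Gaussian survives, and the error is at most \<open>\<parallel>h\<parallel>\<^sup>2\<close> times an integrable function of \<open>u\<close>.\<close>

lemma gaussian_moment_has_derivative:
  assumes f: "sq_int lborel f" and A: "Re A > 0"
  shows "((\<lambda>P. gaussian_moment f n (fst P) (snd P)) has_derivative
     (\<lambda>h. - fst h * gaussian_moment f (n + 2) A B + snd h * gaussian_moment f (n + 1) A B)) (at (A, B))"
proof (rule has_derivative_quadratic[where d = "Re A / 2"])
  show "bounded_linear (\<lambda>h. - fst h * gaussian_moment f (n + 2) A B + snd h * gaussian_moment f (n + 1) A B)"
    by (intro bounded_linear_add bounded_linear_const_mult bounded_linear_mult_const bounded_linear_minus bounded_linear_fst bounded_linear_snd)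
  show "Re A / 2 > 0" using A by simp
  define M where "M = cmod B + Re A"
  define w where "w = (\<lambda>k u. complex_of_real (\<bar>u\<bar> ^ k * exp (- (Re A / 2 * u\<^sup>2) + M * \<bar>u\<bar>)))"
  have cw: "cmod (w k u) = \<bar>u\<bar> ^ k * exp (- (Re A / 2 * u\<^sup>2) + M * \<bar>u\<bar>)" for k u
    unfolding w_def norm_of_real by (simp add: abs_mult)
  have w: "sq_int lborel (w k)" for k
  proof (rule sq_int_gaussian_weight[of "Re A / 2" M _ 1 k])
    show "w k \<in> borel_measurable borel" unfolding w_def by measurable
  qed (use A in \<open>simp_all add: cw M_def\<close>)
  define g where "g = (\<lambda>u. 2 * cmod (f u * w (n + 4) u) + 2 * cmod (f u * w (n + 2) u))"
  have g: "integrable lborel g"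
    unfolding g_def by (intro Bochner_Integration.integrable_add integrable_mult_right integrable_norm sq_int_mult f w)
  fix h :: "complex \<times> complex" assume h: "norm h < Re A / 2"
  define a b where "a = fst h" and "b = snd h"
  have ab: "cmod a \<le> norm h" "cmod b \<le> norm h"
    unfolding a_def b_def using norm_fst_le[of "fst h" "snd h"] norm_snd_le[of "snd h" "fst h"] by simp_all
  have Aa: "Re (A + a) > 0" using ab(1) h A abs_Re_le_cmod[of a] by simp
  define E where "E = (\<lambda>u. exp (- A * of_real (u\<^sup>2) + B * of_real u))"
  define \<delta> where "\<delta> = (\<lambda>u::real. - a * of_real (u\<^sup>2) + b * of_real u)"
  note int = gaussian_moment_integrable[OF f A] gaussian_moment_integrable[OF f Aa]
  have E: "exp (- (A + a) * of_real (u\<^sup>2) + (B + b) * of_real u) = E u * exp (\<delta> u)" for u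
    unfolding E_def \<delta>_def mult_exp_exp by (simp add: algebra_simps)
  have E0: "exp (- A * of_real (u\<^sup>2) + B * of_real u) = E u" for u
    by (simp add: E_def)
  have int': "integrable lborel (\<lambda>u. f u * (of_real u ^ k * E u))" "integrable lborel (\<lambda>u. f u * (of_real u ^ k * (E u * exp (\<delta> u))))" for k
    using int[where n=k and B=B] int[where n=k and B="B + b"] unfolding E by (simp_all add: E_def)
  have "gaussian_moment f n (A + a) (B + b) - gaussian_moment f n A B - (- a * gaussian_moment f (n + 2) A B + b * gaussian_moment f (n + 1) A B)
     = (LINT u|lborel. f u * (of_real u ^ n * (E u * exp (\<delta> u))) - f u * (of_real u ^ n * E u)
         - (- a * (f u * (of_real u ^ (n + 2) * E u)) + b * (f u * (of_real u ^ (n + 1) * E u))))"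
    unfolding gaussian_moment_def E E0 using int'
    by (simp only: Bochner_Integration.integral_diff Bochner_Integration.integral_add integral_mult_right_zero
        Bochner_Integration.integrable_diff Bochner_Integration.integrable_add integrable_mult_right)
  also have "\<dots> = (LINT u|lborel. f u * (of_real u ^ n * E u) * (exp (\<delta> u) - 1 - \<delta> u))"
    by (intro Bochner_Integration.integral_cong refl) (simp add: \<delta>_def algebra_simps power2_eq_square)
  also have "cmod \<dots> \<le> (LINT u|lborel. (norm h)\<^sup>2 * g u)"
  proof (rule Bochner_Integration.integral_norm_bound_integral)
    have "integrable lborel (\<lambda>u. f u * (of_real u ^ n * (E u * exp (\<delta> u))) - f u * (of_real u ^ n * E u)
         - (- a * (f u * (of_real u ^ (n + 2) * E u)) + b * (f u * (of_real u ^ (n + 1) * E u))))"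
      by (intro Bochner_Integration.integrable_diff Bochner_Integration.integrable_add integrable_mult_right int')
    also have "(\<lambda>u. f u * (of_real u ^ n * (E u * exp (\<delta> u))) - f u * (of_real u ^ n * E u)
         - (- a * (f u * (of_real u ^ (n + 2) * E u)) + b * (f u * (of_real u ^ (n + 1) * E u))))
       = (\<lambda>u. f u * (of_real u ^ n * E u) * (exp (\<delta> u) - 1 - \<delta> u))"
      by (rule ext) (simp add: \<delta>_def algebra_simps power2_eq_square)
    finally show "integrable lborel (\<lambda>u. f u * (of_real u ^ n * E u) * (exp (\<delta> u) - 1 - \<delta> u))" .
    show "integrable lborel (\<lambda>u. (norm h)\<^sup>2 * g u)" by (intro integrable_mult_right g)
    fix u :: real
    define q where "q = u\<^sup>2 + \<bar>u\<bar>"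
    have q0: "q \<ge> 0" by (simp add: q_def)
    have d: "cmod (\<delta> u) \<le> norm h * q"
    proof -
      have "cmod (\<delta> u) \<le> cmod a * u\<^sup>2 + cmod b * \<bar>u\<bar>"
        unfolding \<delta>_def using norm_triangle_ineq[of "- a * of_real (u\<^sup>2)" "b * of_real u"]
        by (simp add: norm_mult norm_power)
      also have "\<dots> \<le> norm h * u\<^sup>2 + norm h * \<bar>u\<bar>"
        by (intro add_mono mult_right_mono ab) auto
      finally show ?thesis by (simp add: q_def algebra_simps)
    qed
    have q2: "q\<^sup>2 \<le> 2 * \<bar>u\<bar> ^ 4 + 2 * \<bar>u\<bar> ^ 2"
    proof -
      have "q\<^sup>2 \<le> 2 * (u\<^sup>2)\<^sup>2 + 2 * \<bar>u\<bar>\<^sup>2"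
        unfolding q_def using sum_squares_bound[of "u\<^sup>2" "\<bar>u\<bar>"] by (simp add: power2_sum)
      then show ?thesis by (simp add: power_mult[symmetric])
    qed
    have "cmod (exp (\<delta> u) - 1 - \<delta> u) \<le> exp (cmod (\<delta> u)) * (cmod (\<delta> u))\<^sup>2"
      by (rule cmod_exp_remainder)
    also have "\<dots> \<le> exp (Re A / 2 * q) * (norm h * q)\<^sup>2"
    proof (intro mult_mono power_mono d)
      have "norm h * q \<le> Re A / 2 * q" using h q0 by (intro mult_right_mono) auto
      with d show "exp (cmod (\<delta> u)) \<le> exp (Re A / 2 * q)" by simp
    qed auto
    finally have r: "cmod (exp (\<delta> u) - 1 - \<delta> u) \<le> exp (Re A / 2 * q) * (norm h * q)\<^sup>2" .
    have e: "cmod (E u) * exp (Re A / 2 * q) \<le> exp (- (Re A / 2 * u\<^sup>2) + M * \<bar>u\<bar>)"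
    proof -
      note Re_mult_le[of B u]
      moreover have "0 \<le> Re A * \<bar>u\<bar>" using A by simp
      ultimately have "- (Re A * u\<^sup>2) + Re B * u + Re A / 2 * q \<le> - (Re A / 2 * u\<^sup>2) + M * \<bar>u\<bar>"
        by (simp add: M_def q_def algebra_simps)
      then show ?thesis unfolding E_def cmod_gaussian_exp mult_exp_exp by simp
    qed
    have "cmod (f u * (of_real u ^ n * E u) * (exp (\<delta> u) - 1 - \<delta> u))
       \<le> cmod (f u) * (\<bar>u\<bar> ^ n * cmod (E u)) * (exp (Re A / 2 * q) * (norm h * q)\<^sup>2)"
      unfolding norm_mult norm_power using r by (simp add: mult_left_mono)
    also have "\<dots> = (norm h)\<^sup>2 * (cmod (f u) * \<bar>u\<bar> ^ n * (cmod (E u) * exp (Re A / 2 * q)) * q\<^sup>2)"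
      by (simp add: power_mult_distrib)
    also have "\<dots> \<le> (norm h)\<^sup>2 * (cmod (f u) * \<bar>u\<bar> ^ n * exp (- (Re A / 2 * u\<^sup>2) + M * \<bar>u\<bar>) * (2 * \<bar>u\<bar> ^ 4 + 2 * \<bar>u\<bar> ^ 2))"
      by (intro mult_left_mono mult_mono e q2) auto
    also have "\<dots> = (norm h)\<^sup>2 * g u"
      by (simp add: g_def norm_mult cw algebra_simps power_add) (simp add: power2_eq_square)
    finally show "cmod (f u * (of_real u ^ n * E u) * (exp (\<delta> u) - 1 - \<delta> u)) \<le> (norm h)\<^sup>2 * g u" .
  qed
  also have "\<dots> = (LINT u|lborel. g u) * (norm h)\<^sup>2" by simp
  finally show "norm (gaussian_moment f n (fst ((A, B) + h)) (snd ((A, B) + h)) - gaussian_moment f n (fst (A, B)) (snd (A, B))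
      - (- fst h * gaussian_moment f (n + 2) A B + snd h * gaussian_moment f (n + 1) A B)) \<le> (LINT u|lborel. g u) * (norm h)\<^sup>2"
    by (simp add: a_def b_def)
qed

section \<open>Smooth functions of four variables\<close>

lemma grad4_const: "grad4 (\<lambda>p. k) (\<lambda>p. 0) (\<lambda>p. 0) (\<lambda>p. 0) (\<lambda>p. 0)"
  by (auto simp: grad4_def)

lemma grad4_coord:
  "grad4 (\<lambda>p. of_real (fst p)) (\<lambda>p. 1) (\<lambda>p. 0) (\<lambda>p. 0) (\<lambda>p. 0)"
  "grad4 (\<lambda>p. of_real (fst (snd p))) (\<lambda>p. 0) (\<lambda>p. 1) (\<lambda>p. 0) (\<lambda>p. 0)"
  "grad4 (\<lambda>p. of_real (fst (snd (snd p)))) (\<lambda>p. 0) (\<lambda>p. 0) (\<lambda>p. 1) (\<lambda>p. 0)"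
  "grad4 (\<lambda>p. of_real (snd (snd (snd p)))) (\<lambda>p. 0) (\<lambda>p. 0) (\<lambda>p. 0) (\<lambda>p. 1)"
  by (auto simp: grad4_def scaleR_conv_of_real intro!: derivative_eq_intros)

lemma grad4_add:
  assumes "grad4 F Fx Fy Fb Fr" "grad4 G Gx Gy Gb Gr"
  shows "grad4 (\<lambda>p. F p + G p) (\<lambda>p. Fx p + Gx p) (\<lambda>p. Fy p + Gy p) (\<lambda>p. Fb p + Gb p) (\<lambda>p. Fr p + Gr p)"
  unfolding grad4_def
proof (rule ballI, goal_cases)
  case (1 p)
  with assms show ?case
    unfolding grad4_def
    by (auto intro!: derivative_eq_intros simp: algebra_simps)
qed

lemma grad4_mult:
  assumes "grad4 F Fx Fy Fb Fr" "grad4 G Gx Gy Gb Gr"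
  shows "grad4 (\<lambda>p. F p * G p) (\<lambda>p. Fx p * G p + F p * Gx p) (\<lambda>p. Fy p * G p + F p * Gy p)
    (\<lambda>p. Fb p * G p + F p * Gb p) (\<lambda>p. Fr p * G p + F p * Gr p)"
  unfolding grad4_def
proof (rule ballI, goal_cases)
  case (1 p)
  with assms show ?case
    unfolding grad4_def
    by (auto intro!: derivative_eq_intros simp: scaleR_conv_of_real algebra_simps)
qed

lemma grad4_exp:
  assumes "grad4 F Fx Fy Fb Fr"
  shows "grad4 (\<lambda>p. exp (F p)) (\<lambda>p. Fx p * exp (F p)) (\<lambda>p. Fy p * exp (F p)) (\<lambda>p. Fb p * exp (F p)) (\<lambda>p. Fr p * exp (F p))"
  unfolding grad4_def
proof
  fix p :: "real \<times> real \<times> real \<times> real" assume "p \<in> R4plus"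
  with assms have "(F has_derivative (\<lambda>h. fst h *\<^sub>R Fx p + fst (snd h) *\<^sub>R Fy p +
          fst (snd (snd h)) *\<^sub>R Fb p + snd (snd (snd h)) *\<^sub>R Fr p)) (at p)"
    unfolding grad4_def by blast
  from has_derivative_compose[OF this, of exp, OF has_field_derivative_imp_has_derivative[OF DERIV_exp]]
  show "((\<lambda>p. exp (F p)) has_derivative (\<lambda>h. fst h *\<^sub>R (Fx p * exp (F p)) + fst (snd h) *\<^sub>R (Fy p * exp (F p)) +
          fst (snd (snd h)) *\<^sub>R (Fb p * exp (F p)) + snd (snd (snd h)) *\<^sub>R (Fr p * exp (F p)))) (at p)"
    by (simp add: scaleR_conv_of_real algebra_simps)
qed

lemma Ck_mono: "Ck (Suc k) F \<Longrightarrow> Ck k F"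
proof (induction k arbitrary: F)
  case 0
  then show ?case by (auto intro: grad4_continuous)
next
  case (Suc k)
  from Suc.prems obtain Fx Fy Fb Fr where "grad4 F Fx Fy Fb Fr" "Ck (Suc k) Fx" "Ck (Suc k) Fy" "Ck (Suc k) Fb" "Ck (Suc k) Fr"
    unfolding Ck.simps(2)[of "Suc k"] by blast
  then show ?case by (intro Ck_SucI[of F Fx Fy Fb Fr] Suc.IH)
qed

lemma Ck_const: "Ck k (\<lambda>p. z)"
proof (induction k arbitrary: z)
  case (Suc k) show ?case by (intro Ck_SucI[OF grad4_const] Suc.IH)
qed simp

lemma Ck_coord:
  "Ck k (\<lambda>p. of_real (fst p))" "Ck k (\<lambda>p. of_real (fst (snd p)))"
  "Ck k (\<lambda>p. of_real (fst (snd (snd p))))" "Ck k (\<lambda>p. of_real (snd (snd (snd p))))"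
  using Ck_mono[OF Ck_SucI[OF grad4_coord(1)]] Ck_mono[OF Ck_SucI[OF grad4_coord(2)]]
    Ck_mono[OF Ck_SucI[OF grad4_coord(3)]] Ck_mono[OF Ck_SucI[OF grad4_coord(4)]] Ck_const by blast+

lemma Ck_add: "Ck k F \<Longrightarrow> Ck k G \<Longrightarrow> Ck k (\<lambda>p. F p + G p)"
proof (induction k arbitrary: F G)
  case 0 then show ?case by (auto intro: continuous_intros)
next
  case (Suc k)
  from Suc.prems obtain Fx Fy Fb Fr Gx Gy Gb Gr where
     "grad4 F Fx Fy Fb Fr" "Ck k Fx" "Ck k Fy" "Ck k Fb" "Ck k Fr"
     "grad4 G Gx Gy Gb Gr" "Ck k Gx" "Ck k Gy" "Ck k Gb" "Ck k Gr" by auto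
  then show ?case by (intro Ck_SucI[OF grad4_add] Suc.IH)
qed

lemma Ck_mult: "Ck k F \<Longrightarrow> Ck k G \<Longrightarrow> Ck k (\<lambda>p. F p * G p)"
proof (induction k arbitrary: F G)
  case 0 then show ?case by (auto intro: continuous_intros)
next
  case (Suc k)
  note Ck_mono[OF Suc.prems(1)] Ck_mono[OF Suc.prems(2)]
  moreover from Suc.prems obtain Fx Fy Fb Fr Gx Gy Gb Gr where
     "grad4 F Fx Fy Fb Fr" "Ck k Fx" "Ck k Fy" "Ck k Fb" "Ck k Fr"
     "grad4 G Gx Gy Gb Gr" "Ck k Gx" "Ck k Gy" "Ck k Gb" "Ck k Gr" by auto
  ultimately show ?case by (intro Ck_SucI[OF grad4_mult] Ck_add Suc.IH)
qed

lemma Ck_exp: "Ck k F \<Longrightarrow> Ck k (\<lambda>p. exp (F p))"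
proof (induction k)
  case 0 then show ?case by (auto intro: continuous_intros)
next
  case (Suc k)
  note Ck_mono[OF Suc.prems]
  moreover from Suc.prems obtain Fx Fy Fb Fr where
     "grad4 F Fx Fy Fb Fr" "Ck k Fx" "Ck k Fy" "Ck k Fb" "Ck k Fr" by auto
  ultimately show ?case by (intro Ck_SucI[OF grad4_exp] Ck_mult Suc.IH)
qed

lemma grad4_of_real_r:
  assumes "\<And>r. r > 0 \<Longrightarrow> (g has_real_derivative g' r) (at r)"
  shows "grad4 (\<lambda>p. of_real (g (snd (snd (snd p))))) (\<lambda>p. 0) (\<lambda>p. 0) (\<lambda>p. 0) (\<lambda>p. of_real (g' (snd (snd (snd p)))))"
  unfolding grad4_def
proof
  fix p :: "real \<times> real \<times> real \<times> real" assume "p \<in> R4plus"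
  then have "snd (snd (snd p)) > 0" by (cases p) simp
  from assms[OF this] have "(g has_derivative (\<lambda>k. k * g' (snd (snd (snd p))))) (at (snd (snd (snd p))))"
    by (simp add: has_field_derivative_def mult_commute_abs)
  moreover have "((\<lambda>p. snd (snd (snd p))) has_derivative (\<lambda>h. snd (snd (snd h)))) (at p)"
    by (auto intro!: derivative_eq_intros)
  ultimately have "((\<lambda>p. g (snd (snd (snd p)))) has_derivative (\<lambda>h. snd (snd (snd h)) * g' (snd (snd (snd p))))) (at p)"
    using has_derivative_compose[where g=g and f="\<lambda>p. snd (snd (snd p))"] by blast
  from has_derivative_of_real[OF this]
  show "((\<lambda>p. complex_of_real (g (snd (snd (snd p))))) has_derivative
     (\<lambda>h. fst h *\<^sub>R 0 + fst (snd h) *\<^sub>R 0 + fst (snd (snd h)) *\<^sub>R 0 + snd (snd (snd h)) *\<^sub>R of_real (g' (snd (snd (snd p)))))) (at p)"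
    by (simp add: scaleR_conv_of_real)
qed

lemma grad4_inverse_r:
  "grad4 (\<lambda>p. of_real (1 / snd (snd (snd p)))) (\<lambda>p. 0) (\<lambda>p. 0) (\<lambda>p. 0)
     (\<lambda>p. (-1) * (of_real (1 / snd (snd (snd p))) * of_real (1 / snd (snd (snd p)))))"
  by (rule grad4_cong'[OF grad4_of_real_r[of "\<lambda>r. 1 / r" "\<lambda>r. - (1 / r * (1 / r))"]])
     (auto intro!: derivative_eq_intros simp: divide_inverse)

lemma Ck_inverse_r: "Ck k (\<lambda>p. of_real (1 / snd (snd (snd p))))"
proof (induction k)
  case 0
  then show ?case using grad4_continuous[OF grad4_inverse_r] by simp
next
  case (Suc k)
  then show ?case by (intro Ck_SucI[OF grad4_inverse_r] Ck_mult Ck_const)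
qed

lemma root4_eq: "r > 0 \<Longrightarrow> root 4 (2 * r\<^sup>2) = root 4 2 * sqrt r"
proof -
  assume r: "r > 0"
  have "root 4 (r\<^sup>2) = sqrt r"
  proof (rule real_root_pos_unique)
    have "sqrt r ^ 4 = ((sqrt r)\<^sup>2)\<^sup>2" by (simp flip: power_mult)
    then show "sqrt r ^ 4 = r\<^sup>2" using r by simp
  qed (use r in auto)
  then show ?thesis by (simp add: real_root_mult)
qed

lemma grad4_root4:
  "grad4 (\<lambda>p. of_real (root 4 (2 * (snd (snd (snd p)))\<^sup>2))) (\<lambda>p. 0) (\<lambda>p. 0) (\<lambda>p. 0)
     (\<lambda>p. (1 / 2) * (of_real (1 / snd (snd (snd p))) * of_real (root 4 (2 * (snd (snd (snd p)))\<^sup>2))))"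
proof (rule grad4_cong'[OF grad4_of_real_r[of "\<lambda>r. root 4 (2 * r\<^sup>2)" "\<lambda>r. 1 / 2 * (1 / r * root 4 (2 * r\<^sup>2))"]])
  fix r :: real assume r: "r > 0"
  have "((\<lambda>r. root 4 2 * sqrt r) has_real_derivative root 4 2 * (inverse (sqrt r) / 2)) (at r)"
    using r by (auto intro!: derivative_eq_intros)
  also have "root 4 2 * (inverse (sqrt r) / 2) = 1 / 2 * (1 / r * root 4 (2 * r\<^sup>2))"
    using r by (simp add: root4_eq field_simps)
  finally show "((\<lambda>r. root 4 (2 * r\<^sup>2)) has_real_derivative 1 / 2 * (1 / r * root 4 (2 * r\<^sup>2))) (at r)"
    by (rule has_field_derivative_transform_within_open[where S = "{0<..}"]) (use r in \<open>auto simp: root4_eq\<close>)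
qed auto

lemma Ck_root4: "Ck k (\<lambda>p. of_real (root 4 (2 * (snd (snd (snd p)))\<^sup>2)))"
proof (induction k)
  case 0
  then show ?case using grad4_continuous[OF grad4_root4] by simp
next
  case (Suc k)
  then show ?case by (intro Ck_SucI[OF grad4_root4] Ck_mult Ck_const Ck_inverse_r)
qed

section \<open>The metamorphism solves the differential equations\<close>

text \<open>The exponent of the metamorphism kernel, expanded in powers of \<open>u\<close>, is
  \<open>- kernel_quadratic u\<^sup>2 + kernel_linear u + kernel_constant\<close>.\<close>

definition kernel_quadratic :: "real \<Rightarrow> real \<times> real \<times> real \<times> real \<Rightarrow> complex" where
  "kernel_quadratic c p = of_real c * (of_real (snd (snd (snd p))) * of_real (snd (snd (snd p))) + (- \<i>) * of_real (fst (snd (snd p))))"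

definition kernel_linear :: "real \<Rightarrow> real \<times> real \<times> real \<times> real \<Rightarrow> complex" where
  "kernel_linear c p = 2 * (kernel_quadratic c p * of_real (fst (snd p)) + (- \<i> * of_real c) * of_real (fst p))"

definition kernel_constant :: "real \<Rightarrow> real \<times> real \<times> real \<times> real \<Rightarrow> complex" where
  "kernel_constant c p = - 1 * (kernel_quadratic c p * (of_real (fst (snd p)) * of_real (fst (snd p)))) + (2 * \<i> * of_real c) * (of_real (fst p) * of_real (fst (snd p)))"

lemma grad4_kernel_quadratic: "grad4 (kernel_quadratic c) (\<lambda>p. 0) (\<lambda>p. 0) (\<lambda>p. - \<i> * of_real c) (\<lambda>p. 2 * of_real c * of_real (snd (snd (snd p))))"
  unfolding kernel_quadratic_def[abs_def]
  by (rule grad4_cong'[OF grad4_mult[OF grad4_const grad4_add[OF grad4_mult[OF grad4_coord(4) grad4_coord(4)] grad4_mult[OF grad4_const grad4_coord(3)]]]])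
     (simp_all add: algebra_simps)

lemma grad4_kernel_linear: "grad4 (kernel_linear c) (\<lambda>p. - 2 * \<i> * of_real c) (\<lambda>p. 2 * kernel_quadratic c p) (\<lambda>p. - 2 * \<i> * of_real c * of_real (fst (snd p)))
     (\<lambda>p. 4 * of_real c * of_real (snd (snd (snd p))) * of_real (fst (snd p)))"
  unfolding kernel_linear_def[abs_def]
  by (rule grad4_cong'[OF grad4_mult[OF grad4_const grad4_add[OF grad4_mult[OF grad4_kernel_quadratic grad4_coord(2)] grad4_mult[OF grad4_const grad4_coord(1)]]]])
     (simp_all add: algebra_simps)

lemma grad4_kernel_constant: "grad4 (kernel_constant c) (\<lambda>p. 2 * \<i> * of_real c * of_real (fst (snd p))) (\<lambda>p. - 2 * kernel_quadratic c p * of_real (fst (snd p)) + 2 * \<i> * of_real c * of_real (fst p))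
   (\<lambda>p. \<i> * of_real c * (of_real (fst (snd p)))\<^sup>2)
     (\<lambda>p. - 2 * of_real c * of_real (snd (snd (snd p))) * (of_real (fst (snd p)))\<^sup>2)"
  unfolding kernel_constant_def[abs_def]
  by (rule grad4_cong'[OF grad4_add[OF grad4_mult[OF grad4_const grad4_mult[OF grad4_kernel_quadratic grad4_mult[OF grad4_coord(2) grad4_coord(2)]]]
       grad4_mult[OF grad4_const grad4_mult[OF grad4_coord(1) grad4_coord(2)]]]])
     (simp_all add: algebra_simps power2_eq_square)

lemma Ck_kernel_coefficients: "Ck k (kernel_quadratic c)" "Ck k (kernel_linear c)" "Ck k (kernel_constant c)"
proof -
  show A: "Ck k (kernel_quadratic c)" unfolding kernel_quadratic_def[abs_def] by (intro Ck_mult Ck_add Ck_const Ck_coord)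
  show "Ck k (kernel_linear c)" unfolding kernel_linear_def[abs_def] by (intro Ck_mult Ck_add Ck_const Ck_coord A)
  show "Ck k (kernel_constant c)" unfolding kernel_constant_def[abs_def] by (intro Ck_mult Ck_add Ck_const Ck_coord A)
qed

lemma grad4_gaussian_moment:
  assumes "sq_int lborel f" "c > 0"
  shows "grad4 (\<lambda>p. gaussian_moment f n (kernel_quadratic c p) (kernel_linear c p))
    (\<lambda>p. (- 2 * \<i> * of_real c) * gaussian_moment f (n + 1) (kernel_quadratic c p) (kernel_linear c p))
    (\<lambda>p. (2 * kernel_quadratic c p) * gaussian_moment f (n + 1) (kernel_quadratic c p) (kernel_linear c p))
    (\<lambda>p. (\<i> * of_real c) * gaussian_moment f (n + 2) (kernel_quadratic c p) (kernel_linear c p) + ((- 2 * \<i> * of_real c) * of_real (fst (snd p))) * gaussian_moment f (n + 1) (kernel_quadratic c p) (kernel_linear c p))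
    (\<lambda>p. ((- 2 * of_real c) * of_real (snd (snd (snd p)))) * gaussian_moment f (n + 2) (kernel_quadratic c p) (kernel_linear c p)
        + (4 * of_real c * of_real (snd (snd (snd p))) * of_real (fst (snd p))) * gaussian_moment f (n + 1) (kernel_quadratic c p) (kernel_linear c p))"
  unfolding grad4_def
proof
  fix p :: "real \<times> real \<times> real \<times> real" assume p: "p \<in> R4plus"
  have "Re (kernel_quadratic c p) = c * (snd (snd (snd p)))\<^sup>2" by (simp add: kernel_quadratic_def power2_eq_square)
  with p assms(2) have "Re (kernel_quadratic c p) > 0" by (cases p) simp
  from gaussian_moment_has_derivative[OF assms(1) this, of n "kernel_linear c p"]
  have D: "((\<lambda>P. gaussian_moment f n (fst P) (snd P)) has_derivative (\<lambda>h. - fst h * gaussian_moment f (n + 2) (kernel_quadratic c p) (kernel_linear c p) + snd h * gaussian_moment f (n + 1) (kernel_quadratic c p) (kernel_linear c p))) (at (kernel_quadratic c p, kernel_linear c p))" .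
  have "((\<lambda>p. (kernel_quadratic c p, kernel_linear c p)) has_derivative (\<lambda>h. (fst h *\<^sub>R 0 + fst (snd h) *\<^sub>R 0 + fst (snd (snd h)) *\<^sub>R (- \<i> * of_real c) + snd (snd (snd h)) *\<^sub>R (2 * of_real c * of_real (snd (snd (snd p)))),
      fst h *\<^sub>R (- 2 * \<i> * of_real c) + fst (snd h) *\<^sub>R (2 * kernel_quadratic c p) + fst (snd (snd h)) *\<^sub>R (- 2 * \<i> * of_real c * of_real (fst (snd p))) +
      snd (snd (snd h)) *\<^sub>R (4 * of_real c * of_real (snd (snd (snd p))) * of_real (fst (snd p)))))) (at p)"
    using grad4_kernel_quadratic[of c] grad4_kernel_linear[of c] p unfolding grad4_def by (intro has_derivative_Pair) blast+
  from has_derivative_compose[OF this D, unfolded fst_conv snd_conv]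
  show "((\<lambda>p. gaussian_moment f n (kernel_quadratic c p) (kernel_linear c p)) has_derivative (\<lambda>h.
     fst h *\<^sub>R ((- 2 * \<i> * of_real c) * gaussian_moment f (n + 1) (kernel_quadratic c p) (kernel_linear c p)) + fst (snd h) *\<^sub>R ((2 * kernel_quadratic c p) * gaussian_moment f (n + 1) (kernel_quadratic c p) (kernel_linear c p))
    + fst (snd (snd h)) *\<^sub>R ((\<i> * of_real c) * gaussian_moment f (n + 2) (kernel_quadratic c p) (kernel_linear c p) + ((- 2 * \<i> * of_real c) * of_real (fst (snd p))) * gaussian_moment f (n + 1) (kernel_quadratic c p) (kernel_linear c p))
    + snd (snd (snd h)) *\<^sub>R (((- 2 * of_real c) * of_real (snd (snd (snd p)))) * gaussian_moment f (n + 2) (kernel_quadratic c p) (kernel_linear c p)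
        + (4 * of_real c * of_real (snd (snd (snd p))) * of_real (fst (snd p))) * gaussian_moment f (n + 1) (kernel_quadratic c p) (kernel_linear c p)))) (at p)"
    by (rule has_derivative_eq_rhs) (simp add: fun_eq_iff scaleR_conv_of_real algebra_simps)
qed

text \<open>The partial derivatives of a moment are combinations of higher moments with polynomial
  coefficients, so the induction has to run over all moments at once.\<close>

lemma Ck_gaussian_moment:
  assumes "sq_int lborel f" "c > 0"
  shows "Ck k (\<lambda>p. gaussian_moment f n (kernel_quadratic c p) (kernel_linear c p))"
proof (induction k arbitrary: n)
  case 0
  show ?case using grad4_continuous[OF grad4_gaussian_moment[OF assms]] by simp
next
  case (Suc k)
  show ?case by (intro Ck_SucI[OF grad4_gaussian_moment[OF assms]] Ck_add Ck_mult Ck_const Ck_coord Ck_kernel_coefficients Suc)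
qed

lemma exp_kernel_eq:
  "exp (- complex_of_real c * ((complex_of_real (r\<^sup>2) - \<i> * complex_of_real b) * complex_of_real ((u - y)\<^sup>2)
            + 2 * \<i> * complex_of_real (u - y) * complex_of_real x))
   = exp (kernel_constant c (x, y, b, r)) * exp (- kernel_quadratic c (x, y, b, r) * of_real (u\<^sup>2) + kernel_linear c (x, y, b, r) * of_real u)"
  unfolding mult_exp_exp
  by (rule arg_cong[of _ _ exp]) (simp add: kernel_quadratic_def kernel_linear_def kernel_constant_def algebra_simps power2_eq_square)

lemma metamorphism_gaussian_moment:
  assumes "sq_int lborel f"
  shows "metamorphism hbar f p = of_real (root 4 (2 * (snd (snd (snd p)))\<^sup>2)) * exp (kernel_constant (pi * hbar) p) *
     gaussian_moment f 0 (kernel_quadratic (pi * hbar) p) (kernel_linear (pi * hbar) p)"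
proof -
  obtain x y b r where p: "p = (x, y, b, r)" by (cases p)
  define g where "g = (\<lambda>u. f u * exp (- complex_of_real (pi * hbar) * ((complex_of_real (r\<^sup>2) - \<i> * complex_of_real b) * complex_of_real ((u - y)\<^sup>2)
            + 2 * \<i> * complex_of_real (u - y) * complex_of_real x)))"
  have "f \<in> borel_measurable borel" using assms by (simp add: sq_int_def)
  then have "g \<in> borel_measurable lborel"
    unfolding g_def by measurable
  then have "(LINT u|lebesgue. g u) = (LINT u|lborel. g u)"
    by (rule integral_completion)
  also have "\<dots> = (LINT u|lborel. exp (kernel_constant (pi * hbar) p) * (f u * (of_real u ^ 0 * exp (- kernel_quadratic (pi * hbar) p * of_real (u\<^sup>2) + kernel_linear (pi * hbar) p * of_real u))))"
    unfolding g_def exp_kernel_eq p by (simp add: mult_ac)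
  also have "\<dots> = exp (kernel_constant (pi * hbar) p) * gaussian_moment f 0 (kernel_quadratic (pi * hbar) p) (kernel_linear (pi * hbar) p)"
    unfolding gaussian_moment_def by (rule integral_mult_right_zero)
  finally show ?thesis
    unfolding metamorphism_def p g_def by simp
qed

text \<open>By the product rule every derivative of the metamorphism is the common factor \<open>S\<close> times a polynomial
  combination of the moments \<open>V 0\<close>, \<open>V 1\<close>, \<open>V 2\<close>; the three equations become identities between these combinations.\<close>

lemma metamorphism_annihilated:
  assumes f: "sq_int lborel f" and h: "hbar > 0"
  shows "annihilated_by_C1_C2_S1 hbar (metamorphism hbar f)"
proof -
  define c where "c = pi * hbar"
  have c: "c > 0" using h by (simp add: c_def)
  define V where "V = (\<lambda>n p. gaussian_moment f n (kernel_quadratic c p) (kernel_linear c p))"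
  define S where "S = (\<lambda>p. of_real (root 4 (2 * (snd (snd (snd p)))\<^sup>2)) * exp (kernel_constant c p))"
  define X Y R :: fun4 where "X = (\<lambda>p. of_real (fst p))" and "Y = (\<lambda>p. of_real (fst (snd p)))" and "R = (\<lambda>p. of_real (snd (snd (snd p))))"
  define K where "K = complex_of_real c"
  have gV: "grad4 (V n) (\<lambda>p. (- 2 * \<i> * K) * V (n + 1) p) (\<lambda>p. (2 * kernel_quadratic c p) * V (n + 1) p)
    (\<lambda>p. (\<i> * K) * V (n + 2) p + ((- 2 * \<i> * K) * Y p) * V (n + 1) p)
    (\<lambda>p. ((- 2 * K) * R p) * V (n + 2) p + (4 * K * R p * Y p) * V (n + 1) p)" for n
    using grad4_gaussian_moment[OF f c, of n] unfolding V_def Y_def R_def K_def .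
  have CV: "Ck k (V n)" for k n
    using Ck_gaussian_moment[OF f c] unfolding V_def .
  have gS: "grad4 S (\<lambda>p. S p * (2 * \<i> * K * Y p)) (\<lambda>p. S p * (- 2 * kernel_quadratic c p * Y p + 2 * \<i> * K * X p)) (\<lambda>p. S p * (\<i> * K * (Y p * Y p)))
     (\<lambda>p. S p * ((1 / 2) * of_real (1 / snd (snd (snd p))) + (- 2 * K * R p * (Y p * Y p))))"
    unfolding S_def by (rule grad4_cong'[OF grad4_mult[OF grad4_root4 grad4_exp[OF grad4_kernel_constant]]])
      (simp_all add: X_def Y_def R_def K_def algebra_simps power2_eq_square)
  have CX: "Ck k X" "Ck k Y" "Ck k R" for k
    unfolding X_def Y_def R_def by (rule Ck_coord)+
  have CS: "Ck k S" for k
    unfolding S_def by (intro Ck_mult Ck_root4 Ck_exp Ck_kernel_coefficients)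
  define F where "F = (\<lambda>p. S p * V 0 p)"
  define Fx where "Fx = (\<lambda>p. S p * ((2 * \<i> * K * Y p) * V 0 p + (- 2 * \<i> * K) * V 1 p))"
  define Fy where "Fy = (\<lambda>p. S p * ((- 2 * kernel_quadratic c p * Y p + 2 * \<i> * K * X p) * V 0 p + (2 * kernel_quadratic c p) * V 1 p))"
  define Fb where "Fb = (\<lambda>p. S p * ((\<i> * K * (Y p * Y p)) * V 0 p + ((\<i> * K) * V 2 p + ((- 2 * \<i> * K) * Y p) * V 1 p)))"
  define Fr where "Fr = (\<lambda>p. S p * (((1 / 2) * of_real (1 / snd (snd (snd p))) + (- 2 * K * R p * (Y p * Y p))) * V 0 p
      + (((- 2 * K) * R p) * V 2 p + (4 * K * R p * Y p) * V 1 p)))"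
  define Fxx where "Fxx = (\<lambda>p. S p * ((2 * \<i> * K * Y p) * ((2 * \<i> * K * Y p) * V 0 p + (- 2 * \<i> * K) * V 1 p)
       + ((2 * \<i> * K * Y p) * ((- 2 * \<i> * K) * V 1 p) + (- 2 * \<i> * K) * ((- 2 * \<i> * K) * V 2 p))))"
  have gF: "grad4 F Fx Fy Fb Fr"
    unfolding F_def
    by (rule grad4_cong'[OF grad4_mult[OF gS gV[of 0]]])
      (simp_all add: Fx_def Fy_def Fb_def Fr_def algebra_simps numeral_2_eq_2)
  note gY = grad4_coord(2)[folded Y_def]
  have gFx: "\<exists>Fxy Fxb Fxr. grad4 Fx Fxx Fxy Fxb Fxr"
    unfolding Fx_def
    by (intro exI, rule grad4_cong'[OF grad4_mult[OF gS grad4_add[OF grad4_mult[OF grad4_mult[OF grad4_const gY] gV[of 0]] grad4_mult[OF grad4_const gV[of 1]]]]])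
      (simp add: Fxx_def algebra_simps numeral_2_eq_2, rule refl, rule refl, rule refl)
  have C: "Ck 1 Fx" "Ck 1 Fy" "Ck 1 Fb" "Ck 1 Fr" "Ck 0 Fxx"
    unfolding Fx_def Fy_def Fb_def Fr_def Fxx_def
    by (intro Ck_mult Ck_add Ck_const CV CS CX Ck_kernel_coefficients Ck_inverse_r)+
  have "pde c F Fx Fy Fb Fr Fxx"
    unfolding pde_def
  proof (intro allI impI conjI)
    fix x y b r :: real assume r: "r > 0"
    let ?p = "(x, y, b, r)"
    have A: "kernel_quadratic c ?p = K * (of_real (r\<^sup>2) - \<i> * of_real b)"
      by (simp add: kernel_quadratic_def K_def power2_eq_square)
    show "(of_real (r\<^sup>2) - \<i> * of_real b) * Fx ?p + \<i> * Fy ?p + of_real (2 * c * x) * F ?p = 0"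
      unfolding Fx_def Fy_def F_def A by (simp add: X_def Y_def K_def algebra_simps)
    show "2 * of_real r * Fb ?p + \<i> * Fr ?p = (\<i> / (2 * of_real r)) * F ?p"
      unfolding Fb_def Fr_def F_def using r by (simp add: R_def K_def field_simps)
    show "Fxx ?p = 4 * \<i> * of_real c * Fb ?p"
      unfolding Fb_def Fxx_def by (simp add: K_def algebra_simps)
  qed
  with gF gFx C have "pde_solution c F Fx Fy Fb Fr Fxx"
    unfolding pde_solution_def by simp
  then have "annihilated_by_C1_C2_S1 hbar F"
    unfolding annihilated_iff c_def by blast
  then show ?thesis
    by (rule annihilated_cong) (simp add: F_def S_def V_def c_def metamorphism_gaussian_moment[OF f])
qed

text \<open>A Lebesgue measurable function agrees almost everywhere with a Borel function, and the
  metamorphism only depends on the class of \<open>f\<close>.\<close>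

lemma L2_real_representative:
  assumes "f \<in> L2_real"
  obtains g where "sq_int lborel g" "metamorphism hbar g = metamorphism hbar f"
proof -
  have m: "f \<in> borel_measurable lebesgue" and i: "integrable lebesgue (\<lambda>u. (cmod (f u))\<^sup>2)"
    using assms by (auto simp: L2_real_def)
  have "(\<lambda>u. Re (f u)) \<in> borel_measurable (completion lborel)" "(\<lambda>u. Im (f u)) \<in> borel_measurable (completion lborel)"
    using m by measurable
  from this[THEN completion_ex_borel_measurable_real] obtain g1 g2
    where g: "g1 \<in> borel_measurable lborel" "AE u in lborel. Re (f u) = g1 u"
      "g2 \<in> borel_measurable lborel" "AE u in lborel. Im (f u) = g2 u" by blast
  define g where "g = (\<lambda>u. Complex (g1 u) (g2 u))"
  have gm: "g \<in> borel_measurable lborel"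
    using g(1,3) unfolding g_def Complex_eq by measurable
  have "AE u in lborel. f u = g u"
    using g(2,4) by eventually_elim (simp add: g_def complex_eq_iff)
  then have ae: "AE u in lebesgue. f u = g u"
    by (rule AE_completion)
  have gm': "g \<in> borel_measurable lebesgue" using gm by (rule measurable_completion)
  have "integrable lebesgue (\<lambda>u. (cmod (g u))\<^sup>2)"
    by (rule integrable_cong_AE_imp[OF i]) (use ae gm' in \<open>auto elim: eventually_mono\<close>)
  then have "integrable lborel (\<lambda>u. (cmod (g u))\<^sup>2)"
    using gm by (subst (asm) integrable_completion) auto
  then have "sq_int lborel g" using gm by (simp add: sq_int_def)
  moreover have "metamorphism hbar g = metamorphism hbar f"
  proof -
    have "(LINT u|lebesgue. g u * exp (E u)) = (LINT u|lebesgue. f u * exp (E u))"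
      if [measurable]: "E \<in> borel_measurable borel" for E :: "real \<Rightarrow> complex"
    proof (rule integral_cong_AE)
      show "AE u in lebesgue. g u * exp (E u) = f u * exp (E u)"
        using ae by eventually_elim simp
      have e: "(\<lambda>u. exp (E u)) \<in> borel_measurable lebesgue"
        by (rule measurable_completion) measurable
      show "(\<lambda>u. g u * exp (E u)) \<in> borel_measurable lebesgue" "(\<lambda>u. f u * exp (E u)) \<in> borel_measurable lebesgue"
        using borel_measurable_times[OF gm' e] borel_measurable_times[OF m e] by simp_all
    qed
    then show ?thesis
      unfolding metamorphism_def by (intro ext) (simp split: prod.split)
  qed
  ultimately show thesis by (rule that)
qed

section \<open>Shears preserve Lebesgue measure in the plane\<close>

lemma distr_lborel_eqI:
  fixes T :: "'a::euclidean_space \<Rightarrow> 'a"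
  assumes [measurable]: "T \<in> borel_measurable borel"
    and "\<And>A. A \<in> sets borel \<Longrightarrow> (\<integral>\<^sup>+ v. indicator A (T v) \<partial>lborel) = (\<integral>\<^sup>+ v. indicator A v \<partial>lborel)"
  shows "distr lborel lborel T = lborel"
proof (rule measure_eqI)
  fix A assume "A \<in> sets (distr lborel lborel T)"
  then have A [measurable]: "A \<in> sets borel" by simp
  have "emeasure (distr lborel lborel T) A = (\<integral>\<^sup>+ v. indicator A v \<partial>distr lborel lborel T)"
    by simp
  also have "\<dots> = (\<integral>\<^sup>+ v. indicator A (T v) \<partial>lborel)"
    by (subst nn_integral_distr) auto
  finally show "emeasure (distr lborel lborel T) A = emeasure lborel A"
    using assms(2)[OF A] by simp
qed simp

lemma nn_integral_translate:
  fixes f :: "real \<Rightarrow> ennreal"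
  assumes "f \<in> borel_measurable borel"
  shows "(\<integral>\<^sup>+ x. f (x + t) \<partial>lborel) = (\<integral>\<^sup>+ x. f x \<partial>lborel)"
  using nn_integral_real_affine[OF assms, of 1 t] by (simp add: add.commute)

lemma distr_shear_fst:
  "distr lborel lborel (\<lambda>v. (fst v + k * snd v, snd v)) = (lborel :: (real \<times> real) measure)"
proof (rule distr_lborel_eqI)
  fix A :: "(real \<times> real) set" assume [measurable]: "A \<in> sets borel"
  have [measurable]: "A \<in> sets (lborel \<Otimes>\<^sub>M lborel)" unfolding lborel_prod by simp
  have "(\<integral>\<^sup>+ v. indicator A (fst v + k * snd v, snd v) \<partial>lborel) = (\<integral>\<^sup>+ y. \<integral>\<^sup>+ x. indicator A (x + k * y, y) \<partial>lborel \<partial>lborel)"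
    unfolding lborel_prod[symmetric] by (subst lborel_pair.nn_integral_snd[symmetric]) (auto simp: case_prod_beta)
  also have "\<dots> = (\<integral>\<^sup>+ y. \<integral>\<^sup>+ x. indicator A (x, y) \<partial>lborel \<partial>lborel)"
    by (intro nn_integral_cong nn_integral_translate) measurable
  also have "\<dots> = (\<integral>\<^sup>+ v. indicator A v \<partial>lborel)"
    unfolding lborel_prod[symmetric] by (subst lborel_pair.nn_integral_snd) auto
  finally show "(\<integral>\<^sup>+ v. indicator A (fst v + k * snd v, snd v) \<partial>lborel) = (\<integral>\<^sup>+ v. indicator A v \<partial>(lborel :: (real \<times> real) measure))" .
qed (intro borel_measurable_continuous_onI continuous_intros)

lemma distr_shear_snd:
  "distr lborel lborel (\<lambda>v. (fst v, snd v + k * fst v)) = (lborel :: (real \<times> real) measure)"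
proof (rule distr_lborel_eqI)
  fix A :: "(real \<times> real) set" assume [measurable]: "A \<in> sets borel"
  have [measurable]: "A \<in> sets (lborel \<Otimes>\<^sub>M lborel)" unfolding lborel_prod by simp
  have "(\<integral>\<^sup>+ v. indicator A (fst v, snd v + k * fst v) \<partial>lborel) = (\<integral>\<^sup>+ x. \<integral>\<^sup>+ y. indicator A (x, y + k * x) \<partial>lborel \<partial>lborel)"
    unfolding lborel_prod[symmetric] by (subst lborel.nn_integral_fst[symmetric]) (auto simp: case_prod_beta)
  also have "\<dots> = (\<integral>\<^sup>+ x. \<integral>\<^sup>+ y. indicator A (x, y) \<partial>lborel \<partial>lborel)"
    by (intro nn_integral_cong nn_integral_translate) measurable
  also have "\<dots> = (\<integral>\<^sup>+ v. indicator A v \<partial>lborel)"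
    unfolding lborel_prod[symmetric] by (subst lborel.nn_integral_fst) auto
  finally show "(\<integral>\<^sup>+ v. indicator A (fst v, snd v + k * fst v) \<partial>lborel) = (\<integral>\<^sup>+ v. indicator A v \<partial>(lborel :: (real \<times> real) measure))" .
qed (intro borel_measurable_continuous_onI continuous_intros)

text \<open>Such a matrix is a product of three shears, and shears preserve Lebesgue measure by Fubini's
  theorem and translation invariance.\<close>

lemma distr_unimodular:
  fixes p q r t :: real
  assumes det: "p * t - q * r = 1" and "r \<noteq> 0"
  shows "distr lborel lborel (\<lambda>v. (p * fst v + q * snd v, r * fst v + t * snd v)) = (lborel :: (real \<times> real) measure)"
proof -
  define S where "S = (\<lambda>k (v :: real \<times> real). (fst v + k * snd v, snd v))"
  define S' where "S' = (\<lambda>k (v :: real \<times> real). (fst v, snd v + k * fst v))"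
  have "S k \<in> borel_measurable borel" "S' k \<in> borel_measurable borel" for k
    unfolding S_def S'_def by (intro borel_measurable_continuous_onI continuous_intros)+
  then have mS: "S k \<in> measurable lborel lborel" "S' k \<in> measurable lborel lborel" for k
    by simp_all
  have "(\<lambda>v. (p * fst v + q * snd v, r * fst v + t * snd v)) = S ((p - 1) / r) \<circ> (S' r \<circ> S ((t - 1) / r))"
  proof
    fix v :: "real \<times> real"
    define k l where "k = (t - 1) / r" and "l = (p - 1) / r"
    have tp: "t = 1 + r * k" "p = 1 + r * l" using \<open>r \<noteq> 0\<close> by (simp_all add: k_def l_def)
    have "r * (l + k + r * l * k - q) = 0" using det unfolding tp by (simp add: algebra_simps)
    then have q: "q = l + k + r * l * k" using \<open>r \<noteq> 0\<close> by simp
    show "(p * fst v + q * snd v, r * fst v + t * snd v) = (S ((p - 1) / r) \<circ> (S' r \<circ> S ((t - 1) / r))) v"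
      unfolding k_def[symmetric] l_def[symmetric] S_def S'_def by (simp add: tp q algebra_simps)
  qed
  then have "distr lborel lborel (\<lambda>v. (p * fst v + q * snd v, r * fst v + t * snd v))
      = distr (distr (distr lborel lborel (S ((t - 1) / r))) lborel (S' r)) lborel (S ((p - 1) / r))"
    using distr_distr[OF mS(1)[of "(p - 1) / r"] measurable_comp[OF mS(1)[of "(t - 1) / r"] mS(2)[of r]]]
      distr_distr[OF mS(2)[of r] mS(1)[of "(t - 1) / r"]]
    by (simp only:)
  also have "\<dots> = lborel"
    unfolding S_def S'_def distr_shear_fst distr_shear_snd ..
  finally show ?thesis .
qed

section \<open>The Gaussian kernel\<close>

text \<open>One slice \<open>(b, r)\<close> of the metamorphism, with \<open>c = \<pi> \<hbar>\<close> and \<open>s = r\<^sup>2\<close>.\<close>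

locale gauss_kernel =
  fixes c s b :: real
  assumes c: "c > 0" and s: "s > 0"
begin

definition a :: complex where "a = of_real s - \<i> * of_real b"

definition ker :: "real \<times> real \<Rightarrow> real \<Rightarrow> complex" where
  "ker z u = exp (- of_real c * (a * of_real ((u - snd z)\<^sup>2) + 2 * \<i> * of_real (u - snd z) * of_real (fst z)))"

text \<open>The squared modulus of \<open>a y - \<i> x\<close> for \<open>v = (x, y)\<close>.\<close>

definition Q :: "real \<times> real \<Rightarrow> real" where
  "Q v = s\<^sup>2 * (snd v)\<^sup>2 + (b * snd v + fst v)\<^sup>2"

definition repker :: "real \<times> real \<Rightarrow> real \<times> real \<Rightarrow> complex" where
  "repker z w = (LINT u|lborel. ker z u * cnj (ker w u))"

lemma cmod_ker: "cmod (ker z u) = exp (- (c * s * (u - snd z)\<^sup>2))"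
  by (simp add: ker_def a_def)

lemma ker_measurable [measurable]: "(\<lambda>p. ker (fst p) (snd p)) \<in> borel_measurable (borel \<Otimes>\<^sub>M borel)"
  unfolding ker_def borel_prod by (intro borel_measurable_continuous_onI continuous_intros)

lemma ker_measurable' [measurable (raw)]:
  "f \<in> borel_measurable M \<Longrightarrow> g \<in> borel_measurable M \<Longrightarrow> (\<lambda>x. ker (f x) (g x)) \<in> borel_measurable M"
  using measurable_compose[OF measurable_Pair ker_measurable, of f M g] by simp

lemma ker_integrable: "integrable lborel (\<lambda>u. cmod (ker z u))"
  and ker_integral: "(LINT u|lborel. cmod (ker z u)) = sqrt (pi / (c * s))"
  unfolding cmod_ker using gaussian_integrable_real[of "c * s" "snd z"] gaussian_integral_real[of "c * s" "snd z"] c s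
  by auto

lemma ker_sq_int: "sq_int lborel (ker z)"
proof -
  have "(cmod (ker z u))\<^sup>2 = exp (- (2 * (c * s) * (u - snd z)\<^sup>2))" for u
    unfolding cmod_ker exp_double[symmetric] by (simp add: algebra_simps)
  then show ?thesis
    using gaussian_integrable_real[of "2 * (c * s)" "snd z"] c s unfolding sq_int_def by simp
qed

lemma ker_sq_integral: "(LINT u|lborel. (cmod (ker z u))\<^sup>2) = sqrt (pi / (2 * (c * s)))"
proof -
  have "(cmod (ker z u))\<^sup>2 = exp (- (2 * (c * s) * (u - snd z)\<^sup>2))" for u
    unfolding cmod_ker exp_double[symmetric] by (simp add: algebra_simps)
  then show ?thesis
    using gaussian_integral_real[of "2 * (c * s)" "snd z"] c s by simp
qed

text \<open>Centring at \<open>u = snd z + t\<close> leaves the quadratic coefficient \<open>c (a + cnj a) = 2 c s\<close>, which is real, so the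
  Gaussian integral with complex linear term applies.\<close>

lemma repker_eq:
  fixes z w defines "\<delta> \<equiv> snd w - snd z" and "p \<equiv> fst w - fst z"
  shows "repker z w = of_real (sqrt (pi / (2 * c * s))) *
    exp (of_real (c / (2 * s)) * (cnj a * of_real \<delta> + \<i> * of_real p)\<^sup>2 - of_real c * (cnj a * of_real (\<delta>\<^sup>2) + 2 * \<i> * of_real \<delta> * of_real (fst w)))"
proof -
  define \<beta> where "\<beta> = 2 * of_real c * (cnj a * of_real \<delta> + \<i> * of_real p)"
  define g where "g = - of_real c * (cnj a * of_real (\<delta>\<^sup>2) + 2 * \<i> * of_real \<delta> * of_real (fst w))"
  have "ker z (snd z + t) * cnj (ker w (snd z + t)) = exp (- of_real (2 * c * s * t\<^sup>2) + \<beta> * of_real t) * exp g" for t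
  proof -
    have *: "snd z + t - snd w = t - \<delta>" "fst z = fst w - p" by (simp_all add: \<delta>_def p_def)
    have "cnj (ker w (snd z + t)) = exp (- of_real c * (cnj a * of_real ((t - \<delta>)\<^sup>2) - 2 * \<i> * of_real (t - \<delta>) * of_real (fst w)))"
      unfolding ker_def * by (simp add: exp_cnj)
    moreover have "ker z (snd z + t) = exp (- of_real c * (a * of_real (t\<^sup>2) + 2 * \<i> * of_real t * of_real (fst w - p)))"
      unfolding ker_def * by simp
    ultimately show ?thesis
      unfolding mult_exp_exp
      by (simp only: mult_exp_exp) (rule arg_cong[of _ _ exp], simp add: \<beta>_def g_def a_def algebra_simps power2_eq_square)
  qed
  moreover have "has_bochner_integral lborel (\<lambda>t. exp (- of_real (2 * c * s * t\<^sup>2) + \<beta> * of_real t) * exp g)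
      (of_real (sqrt (pi / (2 * c * s))) * exp (\<beta>\<^sup>2 / of_real (4 * (2 * c * s))) * exp g)"
    using gaussian_has_integral[of "2 * c * s" \<beta>] c s by (intro has_bochner_integral_mult_left) auto
  ultimately have "has_bochner_integral lborel (\<lambda>t. ker z (snd z + t) * cnj (ker w (snd z + t)))
      (of_real (sqrt (pi / (2 * c * s))) * exp (\<beta>\<^sup>2 / of_real (4 * (2 * c * s))) * exp g)"
    by simp
  then have "has_bochner_integral lborel (\<lambda>t. ker z t * cnj (ker w t))
      (of_real (sqrt (pi / (2 * c * s))) * exp (\<beta>\<^sup>2 / of_real (4 * (2 * c * s))) * exp g)"
    using lborel_has_bochner_integral_real_affine_iff[of 1 "\<lambda>t. ker z t * cnj (ker w t)" _ "snd z"] by simp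
  then have "repker z w = of_real (sqrt (pi / (2 * c * s))) * exp (\<beta>\<^sup>2 / of_real (4 * (2 * c * s))) * exp g"
    unfolding repker_def by (rule has_bochner_integral_integral_eq)
  also have "\<beta>\<^sup>2 / of_real (4 * (2 * c * s)) = of_real (c / (2 * s)) * (cnj a * of_real \<delta> + \<i> * of_real p)\<^sup>2"
    using c s by (simp add: \<beta>_def power_mult_distrib power2_eq_square)
  finally show ?thesis
    unfolding g_def mult.assoc mult_exp_exp by simp
qed

lemma cmod_repker: "cmod (repker z w) = sqrt (pi / (2 * c * s)) * exp (- (c / (2 * s) * Q (w - z)))"
proof -
  define \<delta> p where "\<delta> = snd w - snd z" and "p = fst w - fst z"
  have "Re ((cnj a * of_real \<delta> + \<i> * of_real p)\<^sup>2) = s\<^sup>2 * \<delta>\<^sup>2 - (b * \<delta> + p)\<^sup>2"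
    by (simp add: a_def power2_eq_square algebra_simps)
  then have "Re (of_real (c / (2 * s)) * (cnj a * of_real \<delta> + \<i> * of_real p)\<^sup>2 - of_real c * (cnj a * of_real (\<delta>\<^sup>2) + 2 * \<i> * of_real \<delta> * of_real (fst w)))
    = c / (2 * s) * (s\<^sup>2 * \<delta>\<^sup>2 - (b * \<delta> + p)\<^sup>2) - c * s * \<delta>\<^sup>2"
    unfolding minus_complex.simps Re_complex_of_real times_complex.simps Im_complex_of_real by (simp add: a_def)
  also have "\<dots> = - (c / (2 * s) * Q (w - z))"
    using s by (simp add: Q_def \<delta>_def p_def power2_eq_square field_simps)
  finally show ?thesis
    unfolding repker_eq \<delta>_def p_def using c s by (simp add: norm_mult)
qed

text \<open>Integrating first over the first coordinate, the shift \<open>b y\<close> inside \<open>Q\<close> disappears.\<close>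

lemma plane_gaussian:
  assumes "\<alpha> > 0"
  shows "(\<integral>\<^sup>+ v. ennreal (exp (- (\<alpha> * Q (v - z)))) \<partial>lborel) = ennreal (pi / (\<alpha> * s))"
proof -
  have [measurable]: "Q \<in> borel_measurable borel" unfolding Q_def by (intro borel_measurable_continuous_onI continuous_intros)
  have [measurable]: "(\<lambda>v. exp (- (\<alpha> * Q (v - z)))) \<in> borel_measurable (lborel \<Otimes>\<^sub>M lborel)"
    unfolding lborel_prod by simp
  have "(\<integral>\<^sup>+ v. ennreal (exp (- (\<alpha> * Q (v - z)))) \<partial>lborel) = (\<integral>\<^sup>+ y. \<integral>\<^sup>+ x. ennreal (exp (- (\<alpha> * Q ((x, y) - z)))) \<partial>lborel \<partial>lborel)"
    unfolding lborel_prod[symmetric] by (subst lborel_pair.nn_integral_snd[symmetric]) (auto simp: case_prod_beta)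
  also have "\<dots> = (\<integral>\<^sup>+ y. ennreal (exp (- (\<alpha> * s\<^sup>2 * (y - snd z)\<^sup>2))) * ennreal (sqrt (pi / \<alpha>)) \<partial>lborel)"
  proof (rule nn_integral_cong)
    fix y :: real
    have "(\<integral>\<^sup>+ x. ennreal (exp (- (\<alpha> * Q ((x, y) - z)))) \<partial>lborel)
       = (\<integral>\<^sup>+ x. ennreal (exp (- (\<alpha> * s\<^sup>2 * (y - snd z)\<^sup>2))) * ennreal (exp (- (\<alpha> * (x - (fst z - b * (y - snd z)))\<^sup>2))) \<partial>lborel)"
    proof (rule nn_integral_cong)
      fix x :: real
      have "exp (- (\<alpha> * Q ((x, y) - z))) = exp (- (\<alpha> * s\<^sup>2 * (y - snd z)\<^sup>2)) * exp (- (\<alpha> * (x - (fst z - b * (y - snd z)))\<^sup>2))"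
        unfolding mult_exp_exp by (rule arg_cong[of _ _ exp]) (simp add: Q_def algebra_simps)
      then show "ennreal (exp (- (\<alpha> * Q ((x, y) - z)))) = ennreal (exp (- (\<alpha> * s\<^sup>2 * (y - snd z)\<^sup>2))) * ennreal (exp (- (\<alpha> * (x - (fst z - b * (y - snd z)))\<^sup>2)))"
        by (simp add: ennreal_mult)
    qed
    also have "\<dots> = ennreal (exp (- (\<alpha> * s\<^sup>2 * (y - snd z)\<^sup>2))) * (\<integral>\<^sup>+ x. ennreal (exp (- (\<alpha> * (x - (fst z - b * (y - snd z)))\<^sup>2))) \<partial>lborel)"
      by (rule nn_integral_cmult) measurable
    also have "(\<integral>\<^sup>+ x. ennreal (exp (- (\<alpha> * (x - (fst z - b * (y - snd z)))\<^sup>2))) \<partial>lborel) = ennreal (sqrt (pi / \<alpha>))"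
      using assms by (subst nn_integral_eq_integral) (simp_all add: gaussian_integrable_real gaussian_integral_real)
    finally show "(\<integral>\<^sup>+ x. ennreal (exp (- (\<alpha> * Q ((x, y) - z)))) \<partial>lborel) = ennreal (exp (- (\<alpha> * s\<^sup>2 * (y - snd z)\<^sup>2))) * ennreal (sqrt (pi / \<alpha>))" .
  qed
  also have "\<dots> = ennreal (sqrt (pi / (\<alpha> * s\<^sup>2))) * ennreal (sqrt (pi / \<alpha>))"
    using assms s by (subst nn_integral_multc) (simp_all add: nn_integral_eq_integral gaussian_integrable_real gaussian_integral_real)
  also have "\<dots> = ennreal (pi / (\<alpha> * s))"
  proof -
    have "sqrt (pi / (\<alpha> * s\<^sup>2)) * sqrt (pi / \<alpha>) = sqrt ((pi / (\<alpha> * s))\<^sup>2)"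
      using assms s unfolding real_sqrt_mult[symmetric] by (simp add: power2_eq_square)
    then show ?thesis using assms s by (simp add: ennreal_mult'[symmetric])
  qed
  finally show ?thesis .
qed

end

section \<open>The transform of a slice and its adjoint\<close>

lemma borel_measurable_cnj [measurable (raw)]:
  "f \<in> borel_measurable M \<Longrightarrow> (\<lambda>x. cnj (f x)) \<in> borel_measurable M"
  by (rule measurable_compose[OF _ borel_measurable_continuous_onI]) (auto intro: continuous_intros)

context gauss_kernel
begin

text \<open>The metamorphism on the slice, without its normalising factor, and below its formal adjoint.\<close>

definition fwd :: "(real \<Rightarrow> complex) \<Rightarrow> real \<times> real \<Rightarrow> complex" where
  "fwd f z = (LINT u|lborel. f u * ker z u)"

definition adj :: "(real \<times> real \<Rightarrow> complex) \<Rightarrow> real \<Rightarrow> complex" where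
  "adj g u = (LINT w|lborel. g w * cnj (ker w u))"

text \<open>The common value of the integrals \<open>\<integral> \<bar>K(z, w)\<bar> dw\<close>.\<close>

definition schur_const :: real where
  "schur_const = sqrt (pi / (2 * c * s)) * (2 * pi / c)"

lemma schur_const_pos: "schur_const > 0"
  using c s by (simp add: schur_const_def)

lemma repker_commute: "repker w z = cnj (repker z w)"
  unfolding repker_def Bochner_Integration.integral_cnj[symmetric] by (simp add: mult.commute del: Bochner_Integration.integral_cnj)

lemma repker_mass: "(\<integral>\<^sup>+ w. ennreal (cmod (repker z w)) \<partial>lborel) = ennreal schur_const"
proof -
  have [measurable]: "Q \<in> borel_measurable borel"
    unfolding Q_def by (intro borel_measurable_continuous_onI continuous_intros)
  have "(\<integral>\<^sup>+ w. ennreal (cmod (repker z w)) \<partial>lborel) = ennreal (sqrt (pi / (2 * c * s))) * (\<integral>\<^sup>+ w. ennreal (exp (- (c / (2 * s) * Q (w - z)))) \<partial>lborel)"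
    using c s unfolding cmod_repker by (subst nn_integral_cmult[symmetric]) (auto simp: ennreal_mult)
  also have "\<dots> = ennreal schur_const"
  proof -
    have e: "pi / (c / (2 * s) * s) = 2 * pi / c" using c s by simp
    show ?thesis
      using c s plane_gaussian[of "c / (2 * s)" z] unfolding schur_const_def e
      by (subst ennreal_mult) simp_all
  qed
  finally show ?thesis .
qed

lemma repker_measurable: "(\<lambda>p. repker (fst p) (snd p)) \<in> borel_measurable (lborel \<Otimes>\<^sub>M lborel)"
proof -
  have "(\<lambda>p. repker (fst p) (snd p)) \<in> borel_measurable borel"
    unfolding repker_eq by (intro borel_measurable_continuous_onI continuous_intros)
  then show ?thesis unfolding lborel_prod by simp
qed

lemma repker_measurable' [measurable (raw)]:
  "f \<in> borel_measurable M \<Longrightarrow> g \<in> borel_measurable M \<Longrightarrow> (\<lambda>x. repker (f x) (g x)) \<in> borel_measurable M"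
  using measurable_compose[OF measurable_Pair, of f M borel g borel "\<lambda>p. repker (fst p) (snd p)" borel] repker_measurable
  by simp

text \<open>Fubini's theorem.  The hypotheses on \<open>\<phi>\<close> cover both bounded functions, needed when \<open>\<phi>\<close> is itself an
  adjoint transform whose square integrability is still to be shown, and square-integrable functions.\<close>

lemma duality:
  assumes g: "integrable lborel g"
    and [measurable]: "\<phi> \<in> borel_measurable borel"
    and int: "\<And>w. integrable lborel (\<lambda>u. cmod (\<phi> u) * cmod (ker w u))"
    and bound: "\<And>w. (LINT u|lborel. cmod (\<phi> u) * cmod (ker w u)) \<le> C"
  shows "integrable lborel (\<lambda>w. cnj (g w) * fwd \<phi> w)"
    and "integrable lborel (\<lambda>u. \<phi> u * cnj (adj g u))"
    and "(LINT w|lborel. cnj (g w) * fwd \<phi> w) = (LINT u|lborel. \<phi> u * cnj (adj g u))"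
proof -
  have [measurable]: "g \<in> borel_measurable borel" using borel_measurable_integrable[OF g] by simp
  define h where "h = (\<lambda>p. cnj (g (fst p)) * (\<phi> (snd p) * ker (fst p) (snd p)))"
  have h [measurable]: "h \<in> borel_measurable (lborel \<Otimes>\<^sub>M lborel)"
    unfolding h_def by measurable
  have nh: "norm (h (w, u)) = cmod (g w) * (cmod (\<phi> u) * cmod (ker w u))" for w u
    by (simp add: h_def norm_mult)
  have "integrable (lborel \<Otimes>\<^sub>M lborel) h"
  proof (rule lborel_pair.Fubini_integrable[OF h])
    show "integrable lborel (\<lambda>w. LINT u|lborel. norm (h (w, u)))"
    proof (rule Bochner_Integration.integrable_bound)
      show "integrable lborel (\<lambda>w. C * cmod (g w))" using g by simp
      show "(\<lambda>w. LINT u|lborel. norm (h (w, u))) \<in> borel_measurable lborel"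
        by (rule lborel.borel_measurable_lebesgue_integral) simp
      have "norm (LINT u|lborel. norm (h (w, u))) \<le> norm (C * cmod (g w))" for w
      proof -
        have "norm (LINT u|lborel. norm (h (w, u))) = cmod (g w) * (LINT u|lborel. cmod (\<phi> u) * cmod (ker w u))"
          unfolding nh by simp
        also have "\<dots> \<le> cmod (g w) * C" by (intro mult_left_mono bound) simp
        also have "\<dots> \<le> norm (C * cmod (g w))" by (simp add: mult.commute)
        finally show ?thesis .
      qed
      then show "AE w in lborel. norm (LINT u|lborel. norm (h (w, u))) \<le> norm (C * cmod (g w))" by simp
    qed
    have "integrable lborel (\<lambda>u. h (w, u))" for w
    proof (rule Bochner_Integration.integrable_bound[OF integrable_mult_right[OF int[of w], of "cmod (g w)"]])
      show "(\<lambda>u. h (w, u)) \<in> borel_measurable lborel" unfolding h_def by simp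
    qed (simp add: nh)
    then show "AE w in lborel. integrable lborel (\<lambda>u. h (w, u))" by simp
  qed
  then have H: "integrable (lborel \<Otimes>\<^sub>M lborel) (\<lambda>(w, u). h (w, u))" by simp
  have 1: "(LINT u|lborel. h (w, u)) = cnj (g w) * fwd \<phi> w" for w
    by (simp add: h_def fwd_def)
  have 2: "(LINT w|lborel. h (w, u)) = \<phi> u * cnj (adj g u)" for u
    unfolding h_def adj_def Bochner_Integration.integral_cnj[symmetric] integral_mult_right_zero[symmetric] by (simp add: mult_ac del: Bochner_Integration.integral_cnj integral_mult_right_zero)
  show "integrable lborel (\<lambda>w. cnj (g w) * fwd \<phi> w)"
    using lborel_pair.integrable_fst[OF H] unfolding 1 .
  show "integrable lborel (\<lambda>u. \<phi> u * cnj (adj g u))"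
    using lborel_pair.integrable_snd[OF H] unfolding 2 .
  show "(LINT w|lborel. cnj (g w) * fwd \<phi> w) = (LINT u|lborel. \<phi> u * cnj (adj g u))"
    using lborel_pair.Fubini_integral[OF H] unfolding 1 2 by simp
qed

lemma fwd_adj:
  assumes g: "integrable lborel g"
  shows "fwd (adj g) z = (LINT w|lborel. g w * repker z w)"
proof -
  have "integrable lborel (\<lambda>u. cmod (cnj (ker z u)) * cmod (ker w u))" for w
    using integrable_norm[OF sq_int_mult[OF ker_sq_int ker_sq_int, of z w]] by (simp add: norm_mult)
  moreover have "(LINT u|lborel. cmod (cnj (ker z u)) * cmod (ker w u)) \<le> sqrt (pi / (c * s))" for w
  proof -
    have "(LINT u|lborel. cmod (cnj (ker z u)) * cmod (ker w u)) \<le> (LINT u|lborel. cmod (ker w u))"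
    proof (rule integral_mono')
      fix u show "cmod (cnj (ker z u)) * cmod (ker w u) \<le> cmod (ker w u)"
        using c s by (simp add: cmod_ker mult_le_cancel_right1)
    qed (auto intro: ker_integrable)
    then show ?thesis by (simp add: ker_integral)
  qed
  ultimately have "(LINT w|lborel. cnj (g w) * fwd (\<lambda>u. cnj (ker z u)) w) = (LINT u|lborel. cnj (ker z u) * cnj (adj g u))"
    using duality(3)[OF g, of "\<lambda>u. cnj (ker z u)" "sqrt (pi / (c * s))"] by measurable
  moreover have "fwd (\<lambda>u. cnj (ker z u)) w = cnj (repker z w)" for w
    unfolding fwd_def repker_def Bochner_Integration.integral_cnj[symmetric] by (simp add: mult.commute del: Bochner_Integration.integral_cnj)
  ultimately have "cnj (LINT w|lborel. g w * repker z w) = cnj (fwd (adj g) z)"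
    unfolding fwd_def Bochner_Integration.integral_cnj[symmetric] by (simp add: mult.commute del: Bochner_Integration.integral_cnj)
  then show ?thesis by (metis complex_cnj_cnj)
qed

lemma adj_measurable:
  assumes "integrable lborel g"
  shows "adj g \<in> borel_measurable borel"
proof -
  have [measurable]: "g \<in> borel_measurable borel" using borel_measurable_integrable[OF assms] by simp
  have "(\<lambda>u. LINT w|lborel. g w * cnj (ker w u)) \<in> borel_measurable lborel"
    by (rule lborel.borel_measurable_lebesgue_integral) measurable
  then show ?thesis unfolding adj_def[abs_def] by simp
qed

lemma adj_integrand:
  assumes "integrable lborel g"
  shows "integrable lborel (\<lambda>w. g w * cnj (ker w u))"
proof (rule Bochner_Integration.integrable_bound[OF integrable_norm[OF assms]])
  have [measurable]: "g \<in> borel_measurable borel" using borel_measurable_integrable[OF assms] by simp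
  show "(\<lambda>w. g w * cnj (ker w u)) \<in> borel_measurable lborel" by measurable
  have "cmod (g w * cnj (ker w u)) \<le> cmod (g w)" for w
    using c s by (simp add: norm_mult cmod_ker mult_left_le)
  then show "AE w in lborel. norm (g w * cnj (ker w u)) \<le> norm (cmod (g w))" by simp
qed

lemma adj_bounded:
  assumes "integrable lborel g"
  shows "cmod (adj g u) \<le> (LINT w|lborel. cmod (g w))"
proof -
  have "cmod (adj g u) \<le> (LINT w|lborel. cmod (g w * cnj (ker w u)))"
    unfolding adj_def by (rule integral_norm_bound)
  also have "\<dots> \<le> (LINT w|lborel. cmod (g w))"
  proof (rule integral_mono')
    show "cmod (g w * cnj (ker w u)) \<le> cmod (g w)" for w
      using c s by (simp add: norm_mult cmod_ker mult_left_le)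
  qed (use assms in auto)
  finally show ?thesis .
qed

text \<open>Schur's test: \<open>\<parallel>adj g\<parallel>\<^sup>2 = \<langle>g, fwd (adj g)\<rangle>\<close> is a double integral of \<open>g\<close> against the reproducing kernel, and
  \<open>\<bar>g(w) g(w')\<bar> \<le> (\<bar>g(w)\<bar>\<^sup>2 + \<bar>g(w')\<bar>\<^sup>2) / 2\<close> together with the symmetry of \<open>\<bar>K\<bar>\<close> bounds it by the mass of the kernel.\<close>

lemma adj_sq_int:
  assumes g: "integrable lborel g" and g2: "sq_int lborel g"
  shows "sq_int lborel (adj g)"
    and "(LINT u|lborel. (cmod (adj g u))\<^sup>2) \<le> schur_const * (LINT w|lborel. (cmod (g w))\<^sup>2)"
proof -
  have [measurable]: "g \<in> borel_measurable borel" using borel_measurable_integrable[OF g] by simp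
  note m [measurable] = adj_measurable[OF g]
  define B where "B = (LINT w|lborel. cmod (g w))"
  have B: "B \<ge> 0" by (simp add: B_def)
  have le: "cmod (adj g u) * cmod (ker w u) \<le> B * cmod (ker w u)" for u w
    using adj_bounded[OF g, of u] by (intro mult_right_mono) (auto simp: B_def)
  have i: "integrable lborel (\<lambda>u. cmod (adj g u) * cmod (ker w u))" for w
    by (rule Bochner_Integration.integrable_bound[OF integrable_mult_right[OF ker_integrable[of w], of B]])
      (use le B in \<open>auto simp: abs_mult\<close>)
  have "(LINT u|lborel. cmod (adj g u) * cmod (ker w u)) \<le> B * sqrt (pi / (c * s))" for w
  proof -
    have "(LINT u|lborel. cmod (adj g u) * cmod (ker w u)) \<le> (LINT u|lborel. B * cmod (ker w u))"
      by (intro integral_mono i le integrable_mult_right ker_integrable)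
    then show ?thesis by (simp add: ker_integral)
  qed
  note dual = duality[OF g m i this]
  have sq: "adj g u * cnj (adj g u) = of_real ((cmod (adj g u))\<^sup>2)" for u
    by (rule complex_norm_square[symmetric])
  have int: "integrable lborel (\<lambda>u. (cmod (adj g u))\<^sup>2)"
    using dual(2) unfolding sq complex_of_real_integrable_eq .
  then show "sq_int lborel (adj g)" by (simp add: sq_int_def)
  let ?G = "\<lambda>w. ennreal ((cmod (g w))\<^sup>2 / 2)"
  have mass: "(\<integral>\<^sup>+ w. ennreal (cmod (repker w z)) \<partial>lborel) = ennreal schur_const" for z
    using repker_mass[of z] by (simp add: repker_commute[of _ z])
  have "ennreal (LINT u|lborel. (cmod (adj g u))\<^sup>2) = ennreal (cmod (LINT w|lborel. cnj (g w) * fwd (adj g) w))"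
    unfolding dual(3) sq by (simp del: of_real_power)
  also have "\<dots> \<le> (\<integral>\<^sup>+ w. ennreal (cmod (cnj (g w) * fwd (adj g) w)) \<partial>lborel)"
    by (rule integral_norm_bound_ennreal[OF dual(1)])
  also have "\<dots> \<le> (\<integral>\<^sup>+ w. \<integral>\<^sup>+ w'. ?G w * ennreal (cmod (repker w w')) + ?G w' * ennreal (cmod (repker w w')) \<partial>lborel \<partial>lborel)"
  proof (rule nn_integral_mono)
    fix w :: "real \<times> real"
    have "integrable lborel (\<lambda>w'. g w' * repker w w')"
    proof (rule Bochner_Integration.integrable_bound[OF integrable_mult_right[OF g, of "sqrt (pi / (2 * c * s))"]])
      have "cmod (repker w w') \<le> sqrt (pi / (2 * c * s))" for w'
        using c s by (simp add: cmod_repker Q_def mult_le_cancel_left1)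
      then show "AE w' in lborel. norm (g w' * repker w w') \<le> norm (complex_of_real (sqrt (pi / (2 * c * s))) * g w')"
        using c s by (intro AE_I2) (simp only: norm_mult mult.commute[of "cmod (g _)"] norm_of_real abs_of_nonneg real_sqrt_ge_0_iff divide_nonneg_pos, intro mult_right_mono, simp_all)
    qed measurable
    then have "ennreal (cmod (fwd (adj g) w)) \<le> (\<integral>\<^sup>+ w'. ennreal (cmod (g w' * repker w w')) \<partial>lborel)"
      unfolding fwd_adj[OF g] by (rule integral_norm_bound_ennreal)
    then have "ennreal (cmod (cnj (g w) * fwd (adj g) w)) \<le> ennreal (cmod (g w)) * (\<integral>\<^sup>+ w'. ennreal (cmod (g w' * repker w w')) \<partial>lborel)"
      by (simp add: norm_mult ennreal_mult mult_left_mono)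
    also have "\<dots> = (\<integral>\<^sup>+ w'. ennreal (cmod (g w)) * ennreal (cmod (g w' * repker w w')) \<partial>lborel)"
      by (rule nn_integral_cmult[symmetric]) measurable
    also have "\<dots> \<le> (\<integral>\<^sup>+ w'. ?G w * ennreal (cmod (repker w w')) + ?G w' * ennreal (cmod (repker w w')) \<partial>lborel)"
    proof (rule nn_integral_mono)
      fix w' :: "real \<times> real"
      have "cmod (g w) * cmod (g w') \<le> (cmod (g w))\<^sup>2 / 2 + (cmod (g w'))\<^sup>2 / 2"
        using sum_squares_bound[of "cmod (g w)" "cmod (g w')"] by simp
      then have "cmod (g w) * cmod (g w') * cmod (repker w w') \<le> ((cmod (g w))\<^sup>2 / 2 + (cmod (g w'))\<^sup>2 / 2) * cmod (repker w w')"
        by (rule mult_right_mono) simp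
      then have "ennreal (cmod (g w) * cmod (g w') * cmod (repker w w')) \<le> ennreal (((cmod (g w))\<^sup>2 / 2 + (cmod (g w'))\<^sup>2 / 2) * cmod (repker w w'))"
        by (rule ennreal_leI)
      then show "ennreal (cmod (g w)) * ennreal (cmod (g w' * repker w w')) \<le> ?G w * ennreal (cmod (repker w w')) + ?G w' * ennreal (cmod (repker w w'))"
        by (simp add: norm_mult ennreal_mult[symmetric] ennreal_plus[symmetric] algebra_simps del: ennreal_plus)
    qed
    finally show "ennreal (cmod (cnj (g w) * fwd (adj g) w)) \<le> (\<integral>\<^sup>+ w'. ?G w * ennreal (cmod (repker w w')) + ?G w' * ennreal (cmod (repker w w')) \<partial>lborel)" .
  qed
  also have "\<dots> = (\<integral>\<^sup>+ w. ?G w * ennreal schur_const + (\<integral>\<^sup>+ w'. ?G w' * ennreal (cmod (repker w w')) \<partial>lborel) \<partial>lborel)"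
    by (intro nn_integral_cong) (simp add: nn_integral_add nn_integral_cmult repker_mass)
  also have "\<dots> = (\<integral>\<^sup>+ w. ?G w * ennreal schur_const \<partial>lborel) + (\<integral>\<^sup>+ w. \<integral>\<^sup>+ w'. ?G w' * ennreal (cmod (repker w w')) \<partial>lborel \<partial>lborel)"
    by (rule nn_integral_add) measurable
  also have "(\<integral>\<^sup>+ w. \<integral>\<^sup>+ w'. ?G w' * ennreal (cmod (repker w w')) \<partial>lborel \<partial>lborel) = (\<integral>\<^sup>+ w'. \<integral>\<^sup>+ w. ?G w' * ennreal (cmod (repker w w')) \<partial>lborel \<partial>lborel)"
    by (rule lborel_pair.Fubini') measurable
  also have "\<dots> = (\<integral>\<^sup>+ w. ?G w * ennreal schur_const \<partial>lborel)"
    by (intro nn_integral_cong) (simp add: nn_integral_cmult mass)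
  also have "(\<integral>\<^sup>+ w. ?G w * ennreal schur_const \<partial>lborel) = ennreal ((LINT w|lborel. (cmod (g w))\<^sup>2) / 2 * schur_const)"
  proof -
    have "(\<integral>\<^sup>+ w. ?G w \<partial>lborel) = ennreal ((LINT w|lborel. (cmod (g w))\<^sup>2) / 2)"
      using g2 by (subst nn_integral_eq_integral) (auto simp: sq_int_def)
    then show ?thesis
      using schur_const_pos by (subst ennreal_mult) (simp_all add: nn_integral_multc)
  qed
  also have "\<dots> + \<dots> = ennreal (schur_const * (LINT w|lborel. (cmod (g w))\<^sup>2))"
    using schur_const_pos by (simp add: ennreal_plus[symmetric] algebra_simps del: ennreal_plus)
  finally show "(LINT u|lborel. (cmod (adj g u))\<^sup>2) \<le> schur_const * (LINT w|lborel. (cmod (g w))\<^sup>2)"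
    using schur_const_pos by (subst (asm) ennreal_le_iff) auto
qed

end

section \<open>Completeness of the space of square-integrable functions\<close>

lemma sq_int_cmult: "sq_int M f \<Longrightarrow> sq_int M (\<lambda>u. k * f u)"
  unfolding sq_int_def by (auto simp: norm_mult power_mult_distrib)

lemma sq_int_diff:
  assumes "sq_int M f" "sq_int M g"
  shows "sq_int M (\<lambda>u. f u - g u)"
  unfolding sq_int_def
proof
  have [measurable]: "f \<in> borel_measurable M" "g \<in> borel_measurable M" using assms by (auto simp: sq_int_def)
  show "(\<lambda>u. f u - g u) \<in> borel_measurable M" by measurable
  show "integrable M (\<lambda>u. (cmod (f u - g u))\<^sup>2)"
  proof (rule Bochner_Integration.integrable_bound)
    show "integrable M (\<lambda>u. 2 * (cmod (f u))\<^sup>2 + 2 * (cmod (g u))\<^sup>2)"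
      using assms by (auto simp: sq_int_def)
    have "(cmod (f u - g u))\<^sup>2 \<le> 2 * (cmod (f u))\<^sup>2 + 2 * (cmod (g u))\<^sup>2" for u
    proof -
      have "(cmod (f u - g u))\<^sup>2 \<le> (cmod (f u) + cmod (g u))\<^sup>2"
        by (intro power_mono norm_triangle_ineq4) simp
      also have "\<dots> \<le> 2 * (cmod (f u))\<^sup>2 + 2 * (cmod (g u))\<^sup>2"
        using sum_squares_bound[of "cmod (f u)" "cmod (g u)"] unfolding power2_sum by linarith
      finally show ?thesis .
    qed
    then show "AE u in M. norm ((cmod (f u - g u))\<^sup>2) \<le> norm (2 * (cmod (f u))\<^sup>2 + 2 * (cmod (g u))\<^sup>2)"
      by (intro AE_I2) (simp add: order_trans[OF _ abs_ge_self])
  qed measurable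
qed

text \<open>Fatou's lemma.\<close>

lemma sq_int_limit:
  assumes g: "\<And>n. sq_int M (g n)" and h: "h \<in> borel_measurable M"
    and lim: "AE x in M. (\<lambda>n. g n x) \<longlonglongrightarrow> h x"
    and bound: "\<And>n::nat. (LINT x|M. (cmod (g n x))\<^sup>2) \<le> K"
  shows "sq_int M h" "(LINT x|M. (cmod (h x))\<^sup>2) \<le> K"
proof -
  have [measurable]: "g n \<in> borel_measurable M" for n using g by (simp add: sq_int_def)
  note h [measurable]
  have K: "K \<ge> 0" using bound[of 0] by (rule order_trans[rotated]) simp
  have "(\<integral>\<^sup>+ x. ennreal ((cmod (h x))\<^sup>2) \<partial>M) = (\<integral>\<^sup>+ x. liminf (\<lambda>n. ennreal ((cmod (g n x))\<^sup>2)) \<partial>M)"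
  proof (rule nn_integral_cong_AE)
    show "AE x in M. ennreal ((cmod (h x))\<^sup>2) = liminf (\<lambda>n. ennreal ((cmod (g n x))\<^sup>2))"
      using lim
    proof eventually_elim
      case (elim x)
      then have "(\<lambda>n. ennreal ((cmod (g n x))\<^sup>2)) \<longlonglongrightarrow> ennreal ((cmod (h x))\<^sup>2)"
        by (intro tendsto_ennrealI tendsto_power tendsto_norm)
      then show ?case by (rule lim_imp_Liminf[OF trivial_limit_sequentially, symmetric])
    qed
  qed
  also have "\<dots> \<le> liminf (\<lambda>n. \<integral>\<^sup>+ x. ennreal ((cmod (g n x))\<^sup>2) \<partial>M)"
    by (rule nn_integral_liminf) measurable
  also have "\<dots> \<le> ennreal K"
  proof (rule Liminf_le)
    show "\<forall>\<^sub>F n in sequentially. (\<integral>\<^sup>+ x. ennreal ((cmod (g n x))\<^sup>2) \<partial>M) \<le> ennreal K"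
    proof (rule always_eventually, rule allI)
      fix n
      have "(\<integral>\<^sup>+ x. ennreal ((cmod (g n x))\<^sup>2) \<partial>M) = ennreal (LINT x|M. (cmod (g n x))\<^sup>2)"
        using g[of n] by (intro nn_integral_eq_integral) (auto simp: sq_int_def)
      then show "(\<integral>\<^sup>+ x. ennreal ((cmod (g n x))\<^sup>2) \<partial>M) \<le> ennreal K"
        using bound[of n] by (simp add: ennreal_leI)
    qed
  qed simp
  finally have le: "(\<integral>\<^sup>+ x. ennreal ((cmod (h x))\<^sup>2) \<partial>M) \<le> ennreal K" .
  have i: "integrable M (\<lambda>x. (cmod (h x))\<^sup>2)"
  proof (rule integrableI_bounded)
    show "(\<integral>\<^sup>+ x. ennreal (norm ((cmod (h x))\<^sup>2)) \<partial>M) < \<infinity>"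
      using le by (simp add: le_less_trans)
  qed simp
  then show "sq_int M h" using h by (simp add: sq_int_def)
  have "ennreal (LINT x|M. (cmod (h x))\<^sup>2) \<le> ennreal K"
    using le nn_integral_eq_integral[OF i] by simp
  then show "(LINT x|M. (cmod (h x))\<^sup>2) \<le> K" using K by simp
qed

text \<open>Along a subsequence with \<open>\<parallel>d\<^sub>k\<parallel>\<^sup>2 \<le> (1/4)\<^sup>k\<close> for the increments \<open>d\<^sub>k\<close>, the sum of \<open>2\<^sup>k \<bar>d\<^sub>k\<bar>\<^sup>2\<close> is finite almost
  everywhere; since \<open>\<bar>d\<^sub>k\<bar> \<le> 2\<^sup>k \<bar>d\<^sub>k\<bar>\<^sup>2 + (1/2)\<^sup>k\<close>, the subsequence converges almost everywhere.  Fatou's lemma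
  turns this into convergence in the mean.\<close>

lemma L2_complete:
  fixes f :: "nat \<Rightarrow> 'a \<Rightarrow> complex"
  assumes f: "\<And>n. sq_int M (f n)"
    and Cauchy: "\<And>e. e > 0 \<Longrightarrow> \<exists>N. \<forall>m\<ge>N. \<forall>n\<ge>N. (LINT x|M. (cmod (f m x - f n x))\<^sup>2) \<le> e"
  obtains h where "sq_int M h" "(\<lambda>n. LINT x|M. (cmod (f n x - h x))\<^sup>2) \<longlonglongrightarrow> 0"
proof -
  have [measurable]: "f n \<in> borel_measurable M" for n using f by (simp add: sq_int_def)
  have "\<exists>N. \<forall>k. \<forall>m\<ge>N k. \<forall>n\<ge>N k. (LINT x|M. (cmod (f m x - f n x))\<^sup>2) \<le> (1 / 4) ^ k"
    using Cauchy by (intro choice) simp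
  then obtain N0 where N0: "\<And>k m n. m \<ge> N0 k \<Longrightarrow> n \<ge> N0 k \<Longrightarrow> (LINT x|M. (cmod (f m x - f n x))\<^sup>2) \<le> (1 / 4) ^ k"
    by blast
  \<comment> \<open>The partial sums dominate \<open>N0\<close> and are monotone.\<close>
  define N where "N = (\<lambda>k. \<Sum>j\<le>k. N0 j)"
  have N0N: "N0 k \<le> N j" if "k \<le> j" for k j
    unfolding N_def by (rule member_le_sum) (use that in auto)
  define d where "d = (\<lambda>k x. f (N (Suc k)) x - f (N k) x)"
  have [measurable]: "d k \<in> borel_measurable M" for k unfolding d_def by measurable
  have d2: "sq_int M (d k)" for k unfolding d_def by (intro sq_int_diff f)
  have d: "(LINT x|M. (cmod (d k x))\<^sup>2) \<le> (1 / 4) ^ k" for k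
    unfolding d_def by (intro N0 N0N) auto
  have "(\<integral>\<^sup>+ x. (\<Sum>k. ennreal (2 ^ k * (cmod (d k x))\<^sup>2)) \<partial>M) = (\<Sum>k. \<integral>\<^sup>+ x. ennreal (2 ^ k * (cmod (d k x))\<^sup>2) \<partial>M)"
    by (rule nn_integral_suminf) measurable
  also have "\<dots> \<le> (\<Sum>k. ennreal ((1 / 2) ^ k))"
  proof (rule suminf_le)
    fix k
    have "(\<integral>\<^sup>+ x. ennreal (2 ^ k * (cmod (d k x))\<^sup>2) \<partial>M) = ennreal (2 ^ k * (LINT x|M. (cmod (d k x))\<^sup>2))"
      using d2[of k] by (subst nn_integral_eq_integral) (auto simp: sq_int_def)
    also have "\<dots> \<le> ennreal ((1 / 2) ^ k)"
    proof (rule ennreal_leI)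
      have "2 ^ k * (LINT x|M. (cmod (d k x))\<^sup>2) \<le> 2 ^ k * (1 / 4) ^ k"
        by (intro mult_left_mono d) simp
      also have "\<dots> = (1 / 2) ^ k" unfolding power_mult_distrib[symmetric] by simp
      finally show "2 ^ k * (LINT x|M. (cmod (d k x))\<^sup>2) \<le> (1 / 2) ^ k" .
    qed
    finally show "(\<integral>\<^sup>+ x. ennreal (2 ^ k * (cmod (d k x))\<^sup>2) \<partial>M) \<le> ennreal ((1 / 2) ^ k)" .
  qed auto
  also have "\<dots> < \<infinity>"
    by (subst suminf_ennreal2) (auto intro: summable_geometric)
  finally have fin: "(\<integral>\<^sup>+ x. (\<Sum>k. ennreal (2 ^ k * (cmod (d k x))\<^sup>2)) \<partial>M) \<noteq> \<infinity>" by simp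
  have "AE x in M. (\<Sum>k. ennreal (2 ^ k * (cmod (d k x))\<^sup>2)) \<noteq> \<infinity>"
    by (rule nn_integral_PInf_AE[OF _ fin]) measurable
  then have conv: "AE x in M. convergent (\<lambda>k. f (N k) x)"
  proof eventually_elim
    case (elim x)
    have sm: "summable (\<lambda>k. 2 ^ k * (cmod (d k x))\<^sup>2)"
      by (rule summable_suminf_not_top) (use elim in auto)
    have "summable (\<lambda>k. norm (d k x))"
    proof (rule summable_comparison_test')
      show "summable (\<lambda>k. 2 ^ k * (cmod (d k x))\<^sup>2 + (1 / 2) ^ k)"
        by (intro summable_add sm summable_geometric) simp
      fix k :: nat assume "k \<ge> 0"
      have "cmod (d k x) \<le> 2 ^ k * (cmod (d k x))\<^sup>2 + (1 / 2) ^ k"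
      proof -
        have "0 \<le> (2 ^ k * cmod (d k x) - 1 / 2)\<^sup>2 + 3 / 4" by simp
        also have "\<dots> = 2 ^ k * (2 ^ k * (cmod (d k x))\<^sup>2 - cmod (d k x)) + 1"
          by (simp add: power2_eq_square algebra_simps)
        finally have "0 \<le> (1 / 2) ^ k * (2 ^ k * (2 ^ k * (cmod (d k x))\<^sup>2 - cmod (d k x)) + 1)" by simp
        also have "\<dots> = 2 ^ k * (cmod (d k x))\<^sup>2 - cmod (d k x) + (1 / 2) ^ k"
          by (simp add: power_one_over field_simps)
        finally show ?thesis by simp
      qed
      then show "norm (norm (d k x)) \<le> 2 ^ k * (cmod (d k x))\<^sup>2 + (1 / 2) ^ k" by simp
    qed
    then have "summable (\<lambda>k. d k x)" by (rule summable_norm_cancel)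
    then have "convergent (\<lambda>n. \<Sum>k<n. d k x)" by (simp add: summable_iff_convergent)
    moreover have "(\<Sum>k<n. d k x) = f (N n) x - f (N 0) x" for n
      unfolding d_def by (rule sum_lessThan_telescope)
    ultimately have "convergent (\<lambda>n. f (N n) x - f (N 0) x + f (N 0) x)"
      by (intro convergent_add convergent_const) simp
    then show "convergent (\<lambda>k. f (N k) x)" by simp
  qed
  define h where "h = (\<lambda>x. lim (\<lambda>k. f (N k) x))"
  have hm [measurable]: "h \<in> borel_measurable M"
    unfolding h_def by (rule borel_measurable_lim_metric) simp
  have lim: "AE x in M. (\<lambda>k. f (N k) x) \<longlonglongrightarrow> h x"
    using conv by eventually_elim (simp add: h_def convergent_LIMSEQ_iff)
  have key: "sq_int M (\<lambda>x. f n x - h x) \<and> (LINT x|M. (cmod (f n x - h x))\<^sup>2) \<le> (1 / 4) ^ k" if "n \<ge> N0 k" for n k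
  proof -
    have a: "sq_int M (\<lambda>x. f n x - f (N (j + k)) x)" for j by (intro sq_int_diff f)
    have b: "(LINT x|M. (cmod (f n x - f (N (j + k)) x))\<^sup>2) \<le> (1 / 4) ^ k" for j
      by (intro N0 that N0N) simp
    have c: "AE x in M. (\<lambda>j. f n x - f (N (j + k)) x) \<longlonglongrightarrow> f n x - h x"
      using lim by eventually_elim (intro tendsto_diff tendsto_const LIMSEQ_ignore_initial_segment)
    show ?thesis using sq_int_limit[OF a _ c b] by simp
  qed
  have "sq_int M (\<lambda>x. f (N0 0) x - (f (N0 0) x - h x))"
    by (rule sq_int_diff[OF f]) (use key[where n = "N0 0" and k = 0] in simp)
  then have "sq_int M h" by simp
  moreover have "(\<lambda>n. LINT x|M. (cmod (f n x - h x))\<^sup>2) \<longlonglongrightarrow> 0"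
  proof (rule LIMSEQ_I)
    fix e :: real assume e: "e > 0"
    obtain k where k: "(1 / 4 :: real) ^ k < e" using real_arch_pow_inv[OF e, of "1 / 4"] by auto
    have "norm ((LINT x|M. (cmod (f n x - h x))\<^sup>2) - 0) < e" if "n \<ge> N0 k" for n
      using key[OF that] k by simp
    then show "\<exists>no. \<forall>n\<ge>no. norm ((LINT x|M. (cmod (f n x - h x))\<^sup>2) - 0) < e" by blast
  qed
  ultimately show thesis by (rule that)
qed

context gauss_kernel
begin

section \<open>Boundedness of the transform\<close>

text \<open>The Cauchy-Schwarz inequality in the additive form \<open>p q \<le> t p\<^sup>2 + q\<^sup>2 / t\<close>.  The free parameter \<open>t\<close> is
  what later makes \<open>\<parallel>f\<parallel> \<rightarrow> 0\<close> force the transform to tend to 0.\<close>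

lemma sq_int_kernel:
  assumes f: "sq_int lborel f" and t: "t > 0"
  shows "integrable lborel (\<lambda>u. cmod (f u) * cmod (ker w u))"
    and "(LINT u|lborel. cmod (f u) * cmod (ker w u)) \<le> t * (LINT u|lborel. (cmod (f u))\<^sup>2) + sqrt (pi / (2 * (c * s))) / t"
proof -
  show i: "integrable lborel (\<lambda>u. cmod (f u) * cmod (ker w u))"
    using integrable_norm[OF sq_int_mult[OF f ker_sq_int[of w]]] by (simp add: norm_mult)
  have "(LINT u|lborel. cmod (f u) * cmod (ker w u)) \<le> (LINT u|lborel. t * (cmod (f u))\<^sup>2 + (cmod (ker w u))\<^sup>2 / t)"
  proof (rule integral_mono[OF i])
    show "integrable lborel (\<lambda>u. t * (cmod (f u))\<^sup>2 + (cmod (ker w u))\<^sup>2 / t)"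
      using f ker_sq_int[of w] by (auto simp: sq_int_def)
    fix u
    have "0 \<le> (t * cmod (f u) - cmod (ker w u) / 2)\<^sup>2 + 3 / 4 * (cmod (ker w u))\<^sup>2" by simp
    also have "\<dots> = t * (t * (cmod (f u))\<^sup>2 + (cmod (ker w u))\<^sup>2 / t - cmod (f u) * cmod (ker w u))"
      using t by (simp add: power2_eq_square field_simps)
    finally have "0 \<le> t * (cmod (f u))\<^sup>2 + (cmod (ker w u))\<^sup>2 / t - cmod (f u) * cmod (ker w u)"
      using t by (simp add: zero_le_mult_iff)
    then show "cmod (f u) * cmod (ker w u) \<le> t * (cmod (f u))\<^sup>2 + (cmod (ker w u))\<^sup>2 / t" by simp
  qed
  also have "\<dots> = t * (LINT u|lborel. (cmod (f u))\<^sup>2) + sqrt (pi / (2 * (c * s))) / t"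
    using f ker_sq_int[of w] by (subst Bochner_Integration.integral_add) (auto simp: sq_int_def ker_sq_integral)
  finally show "(LINT u|lborel. cmod (f u) * cmod (ker w u)) \<le> t * (LINT u|lborel. (cmod (f u))\<^sup>2) + sqrt (pi / (2 * (c * s))) / t" .
qed

lemma cmod_fwd_le:
  assumes "sq_int lborel f" "t > 0"
  shows "cmod (fwd f w) \<le> t * (LINT u|lborel. (cmod (f u))\<^sup>2) + sqrt (pi / (2 * (c * s))) / t"
proof -
  have "cmod (fwd f w) \<le> (LINT u|lborel. cmod (f u * ker w u))"
    unfolding fwd_def by (rule integral_norm_bound)
  then show ?thesis using sq_int_kernel(2)[OF assms, of w] by (simp add: norm_mult)
qed

lemma fwd_measurable:
  assumes [measurable]: "f \<in> borel_measurable borel"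
  shows "fwd f \<in> borel_measurable borel"
proof -
  have "(\<lambda>w. LINT u|lborel. f u * ker w u) \<in> borel_measurable lborel"
    by (rule lborel.borel_measurable_lebesgue_integral) measurable
  then show ?thesis unfolding fwd_def[abs_def] by simp
qed

text \<open>Truncate the transform to a ball to get a function \<open>g\<close> to which the adjoint applies.  Then
  \<open>\<parallel>g\<parallel>\<^sup>2 = \<langle>g, fwd f\<rangle> = \<langle>adj g, f\<rangle> \<le> \<kappa> \<parallel>f\<parallel>\<^sup>2 / 2 + \<parallel>adj g\<parallel>\<^sup>2 / (2 \<kappa>)\<close>, and Schur's test with constant \<open>\<kappa>\<close>
  bounds the last term by \<open>\<parallel>g\<parallel>\<^sup>2 / 2\<close>.  The bound does not depend on the radius of the ball.\<close>

lemma fwd_sq_int: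
  assumes f: "sq_int lborel f"
  shows "sq_int lborel (fwd f)"
proof -
  have fm [measurable]: "f \<in> borel_measurable borel" using f by (simp add: sq_int_def)
  note Wm [measurable] = fwd_measurable[OF fm]
  define C where "C = (LINT u|lborel. (cmod (f u))\<^sup>2) + sqrt (pi / (2 * (c * s)))"
  have WC: "cmod (fwd f w) \<le> C" for w using cmod_fwd_le[OF f, of 1 w] by (simp add: C_def)
  define g where "g = (\<lambda>n w. fwd f w * indicator (cball 0 (real n)) w)"
  have [measurable]: "cball 0 (real n) \<in> sets (borel :: (real \<times> real) measure)" for n by simp
  have [measurable]: "g n \<in> borel_measurable borel" for n unfolding g_def by measurable
  have ind: "integrable lborel (\<lambda>w :: real \<times> real. k * indicator (cball 0 (real n)) w :: real)" for n k
    using emeasure_lborel_cball_finite[of "0 :: real \<times> real" "real n"] by (intro integrable_mult_right integrable_real_indicator) auto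
  have g1: "integrable lborel (g n)" for n
    by (rule Bochner_Integration.integrable_bound[OF ind[of C n]])
      (use WC in \<open>auto simp: g_def indicator_def intro!: AE_I2 order_trans[OF WC abs_ge_self]\<close>)
  have g2: "sq_int lborel (g n)" for n
    unfolding sq_int_def
  proof
    show "integrable lborel (\<lambda>w. (cmod (g n w))\<^sup>2)"
    proof (rule Bochner_Integration.integrable_bound[OF ind[of "C\<^sup>2" n]])
      have "(cmod (fwd f w))\<^sup>2 \<le> C\<^sup>2" for w using WC by (intro power_mono) auto
      then show "AE w in lborel. norm ((cmod (g n w))\<^sup>2) \<le> norm (C\<^sup>2 * indicator (cball 0 (real n)) w)"
        by (intro AE_I2) (auto simp: g_def indicator_def)
    qed simp
  qed simp
  have bound: "(LINT w|lborel. (cmod (g n w))\<^sup>2) \<le> schur_const * (LINT u|lborel. (cmod (f u))\<^sup>2)" for n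
  proof -
    let ?k = schur_const
    have "cnj (g n w) * fwd f w = of_real ((cmod (g n w))\<^sup>2)" for w
      using complex_norm_square[of "fwd f w"] by (auto simp: g_def indicator_def mult.commute)
    moreover have "(LINT u|lborel. cmod (f u) * cmod (ker w u)) \<le> C" for w
      using sq_int_kernel(2)[OF f, of 1 w] by (simp add: C_def)
    note dual = duality(2,3)[OF g1[of n] fm sq_int_kernel(1)[OF f zero_less_one] this]
    ultimately have "of_real (LINT w|lborel. (cmod (g n w))\<^sup>2) = (LINT u|lborel. f u * cnj (adj (g n) u))"
      using dual(2) by (simp del: of_real_power)
    moreover have "cmod (of_real (LINT w|lborel. (cmod (g n w))\<^sup>2)) = (LINT w|lborel. (cmod (g n w))\<^sup>2)"
      unfolding norm_of_real by (intro abs_of_nonneg Bochner_Integration.integral_nonneg) simp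
    ultimately have "(LINT w|lborel. (cmod (g n w))\<^sup>2) = cmod (LINT u|lborel. f u * cnj (adj (g n) u))"
      by simp
    also have "\<dots> \<le> (LINT u|lborel. cmod (f u * cnj (adj (g n) u)))"
      by (rule integral_norm_bound)
    also have "\<dots> \<le> (LINT u|lborel. ?k / 2 * (cmod (f u))\<^sup>2 + 1 / (2 * ?k) * (cmod (adj (g n) u))\<^sup>2)"
    proof (rule integral_mono)
      show "integrable lborel (\<lambda>u. cmod (f u * cnj (adj (g n) u)))"
        using dual(1) by (rule integrable_norm)
      show "integrable lborel (\<lambda>u. ?k / 2 * (cmod (f u))\<^sup>2 + 1 / (2 * ?k) * (cmod (adj (g n) u))\<^sup>2)"
        using f adj_sq_int(1)[OF g1 g2, of n] by (auto simp: sq_int_def)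
      fix u
      have "0 \<le> (?k * cmod (f u) - cmod (adj (g n) u))\<^sup>2 / (2 * ?k)" using schur_const_pos by simp
      also have "\<dots> = ?k / 2 * (cmod (f u))\<^sup>2 + 1 / (2 * ?k) * (cmod (adj (g n) u))\<^sup>2 - cmod (f u) * cmod (adj (g n) u)"
        using schur_const_pos by (simp add: power2_eq_square field_simps)
      finally show "cmod (f u * cnj (adj (g n) u)) \<le> ?k / 2 * (cmod (f u))\<^sup>2 + 1 / (2 * ?k) * (cmod (adj (g n) u))\<^sup>2"
        by (simp add: norm_mult)
    qed
    also have "\<dots> = ?k / 2 * (LINT u|lborel. (cmod (f u))\<^sup>2) + 1 / (2 * ?k) * (LINT u|lborel. (cmod (adj (g n) u))\<^sup>2)"
      using f adj_sq_int(1)[OF g1 g2, of n] by (subst Bochner_Integration.integral_add) (auto simp: sq_int_def)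
    also have "\<dots> \<le> ?k / 2 * (LINT u|lborel. (cmod (f u))\<^sup>2) + 1 / (2 * ?k) * (?k * (LINT w|lborel. (cmod (g n w))\<^sup>2))"
      using schur_const_pos by (intro add_left_mono mult_left_mono adj_sq_int(2)[OF g1 g2]) auto
    also have "1 / (2 * ?k) * (?k * (LINT w|lborel. (cmod (g n w))\<^sup>2)) = (LINT w|lborel. (cmod (g n w))\<^sup>2) / 2"
      using schur_const_pos by simp
    finally show ?thesis by simp
  qed
  have lim: "AE w in lborel. (\<lambda>n. g n w) \<longlonglongrightarrow> fwd f w"
  proof (rule AE_I2)
    fix w :: "real \<times> real"
    obtain n0 where "norm w \<le> real n0" using real_arch_simple by blast
    then have "\<forall>n\<ge>n0. g n w = fwd f w" by (auto simp: g_def indicator_def)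
    then show "(\<lambda>n. g n w) \<longlonglongrightarrow> fwd f w"
      by (intro tendsto_eventually) (auto simp: eventually_sequentially)
  qed
  show ?thesis
    by (rule sq_int_limit(1)[OF g2 _ lim bound]) simp
qed

end

section \<open>The reproducing property\<close>

lemma mean_value_entire:
  assumes H: "H holomorphic_on UNIV"
  shows "(LINT t|lborel. indicator {0..1} t *\<^sub>R H (exp (2 * of_real pi * \<i> * of_real t) * \<eta>)) = H 0"
proof -
  define G where "G = (\<lambda>w. H (w * \<eta>))"
  have G: "G holomorphic_on UNIV"
    unfolding G_def by (rule holomorphic_on_compose_gen[OF _ H, unfolded o_def]) (auto intro: holomorphic_intros)
  have contG: "continuous_on UNIV G" using G by (rule holomorphic_on_imp_continuous_on)
  have "((\<lambda>u. G u / (u - 0)) has_contour_integral (2 * of_real pi * \<i> * G 0)) (circlepath 0 1)"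
    by (rule Cauchy_integral_circlepath_simple) (use G in \<open>auto intro: holomorphic_on_subset\<close>)
  then have "((\<lambda>t. G (circlepath 0 1 t) / circlepath 0 1 t * vector_derivative (circlepath 0 1) (at t)) has_integral (2 * of_real pi * \<i> * G 0)) {0..1}"
    by (simp add: has_contour_integral)
  then have "((\<lambda>t. 2 * of_real pi * \<i> * G (exp (2 * of_real pi * \<i> * of_real t))) has_integral (2 * of_real pi * \<i> * G 0)) {0..1}"
    by (rule has_integral_eq[rotated]) (simp only: vector_derivative_circlepath, simp add: circlepath)
  from has_integral_mult_right[OF this, of "1 / (2 * of_real pi * \<i>)"]
  have I: "((\<lambda>t. G (exp (2 * of_real pi * \<i> * of_real t))) has_integral G 0) {0..1}"
    by simp
  have "continuous_on {0..1} (\<lambda>t. G (exp (2 * of_real pi * \<i> * of_real t)))"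
    by (rule continuous_on_compose2[OF contG]) (auto intro!: continuous_intros)
  then have "set_integrable lborel {0..1} (\<lambda>t. G (exp (2 * of_real pi * \<i> * of_real t)))"
    by (rule borel_integrable_atLeastAtMost')
  from set_borel_integral_eq_integral(2)[OF this]
  have "(LINT t:{0..1}|lborel. G (exp (2 * of_real pi * \<i> * of_real t))) = G 0"
    using integral_unique[OF I] by simp
  then show ?thesis by (simp add: set_lebesgue_integral_def G_def)
qed

context gauss_kernel
begin

definition eta :: "real \<times> real \<Rightarrow> complex" where
  "eta v = a * of_real (snd v) - \<i> * of_real (fst v)"

text \<open>The rotation \<open>\<eta> \<mapsto> exp (\<i> \<theta>) \<eta>\<close> of the complex coordinate, written in the coordinates of the plane.\<close>

definition rot :: "real \<Rightarrow> real \<times> real \<Rightarrow> real \<times> real" where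
  "rot \<theta> v = ((cos \<theta> - b * sin \<theta> / s) * fst v + (- (s + b\<^sup>2 / s) * sin \<theta>) * snd v,
     (sin \<theta> / s) * fst v + (cos \<theta> + b * sin \<theta> / s) * snd v)"

lemma Re_eta: "Re (eta v) = s * snd v" and Im_eta: "Im (eta v) = - (b * snd v + fst v)"
  by (simp_all add: eta_def a_def)

lemma cmod_eta: "(cmod (eta v))\<^sup>2 = Q v"
  unfolding cmod_power2 Re_eta Im_eta Q_def by (simp only: power2_minus power_mult_distrib)

lemma eta_rot: "eta (rot \<theta> v) = exp (\<i> * of_real \<theta>) * eta v"
proof -
  have e: "exp (\<i> * of_real \<theta>) = Complex (cos \<theta>) (sin \<theta>)"
    by (simp add: complex_eq_iff Re_exp Im_exp)
  show ?thesis
  proof (rule complex_eqI)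
    show "Re (eta (rot \<theta> v)) = Re (exp (\<i> * of_real \<theta>) * eta v)"
      unfolding e times_complex.simps Re_eta Im_eta using s by (simp add: rot_def field_simps)
    show "Im (eta (rot \<theta> v)) = Im (exp (\<i> * of_real \<theta>) * eta v)"
      unfolding e times_complex.simps Re_eta Im_eta using s by (simp add: rot_def field_simps power2_eq_square)
  qed
qed

lemma Q_rot: "Q (rot \<theta> v) = Q v"
  unfolding cmod_eta[symmetric] eta_rot by (simp add: norm_mult)

lemma rot_measurable: "rot \<theta> \<in> borel_measurable borel"
  unfolding rot_def by (intro borel_measurable_continuous_onI continuous_intros)

lemma distr_rot:
  assumes "sin \<theta> \<noteq> 0"
  shows "distr lborel lborel (rot \<theta>) = lborel"
proof -
  have det: "(cos \<theta> - b * sin \<theta> / s) * (cos \<theta> + b * sin \<theta> / s) - (- (s + b\<^sup>2 / s) * sin \<theta>) * (sin \<theta> / s) = 1"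
  proof -
    have "(s + b\<^sup>2 / s) * sin \<theta> * (sin \<theta> / s) = (sin \<theta>)\<^sup>2 + (b * sin \<theta> / s)\<^sup>2"
      using s by (simp add: field_simps power2_eq_square)
    then have "(cos \<theta> - b * sin \<theta> / s) * (cos \<theta> + b * sin \<theta> / s) - (- (s + b\<^sup>2 / s) * sin \<theta>) * (sin \<theta> / s)
      = (cos \<theta>)\<^sup>2 + (sin \<theta>)\<^sup>2"
      by (simp add: power2_eq_square[of "cos \<theta>"] power2_eq_square[of "b * sin \<theta> / s"] algebra_simps)
    then show ?thesis by simp
  qed
  show ?thesis
    using distr_unimodular[OF det] assms s unfolding rot_def[abs_def] by simp
qed

text \<open>Rotations preserve both the Gaussian and Lebesgue measure, so the integral may be replaced by its
  average over all rotations; inside, the average of \<open>H\<close> over a circle is \<open>H 0\<close>.\<close>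

lemma gaussian_mean_value:
  assumes H: "H holomorphic_on UNIV"
    and int: "integrable lborel (\<lambda>v. of_real (exp (- (k * Q v))) * H (eta v))" and k: "k > 0"
  shows "(LINT v|lborel. of_real (exp (- (k * Q v))) * H (eta v)) = of_real (pi / (k * s)) * H 0"
proof -
  define \<psi> where "\<psi> = (\<lambda>v. of_real (exp (- (k * Q v))) * H (eta v))"
  have contH: "continuous_on UNIV H" using H by (rule holomorphic_on_imp_continuous_on)
  have contQ: "continuous_on UNIV Q" unfolding Q_def by (intro continuous_intros)
  have \<psi>int: "integrable lborel \<psi>" using int unfolding \<psi>_def .
  have rot\<psi>: "\<psi> (rot (2 * pi * t) v) = of_real (exp (- (k * Q v))) * H (exp (2 * of_real pi * \<i> * of_real t) * eta v)" for t v
    unfolding \<psi>_def Q_rot eta_rot by (simp add: mult_ac)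
  define h where "h = (\<lambda>(t, v). indicator {0..1::real} t *\<^sub>R \<psi> (rot (2 * pi * t) v))"
  have "continuous_on UNIV (\<lambda>p. \<psi> (rot (2 * pi * fst p) (snd p)))"
    unfolding rot\<psi> eta_def
    by (intro continuous_intros continuous_on_compose2[OF contH] continuous_on_compose2[OF contQ]) auto
  then have [measurable]: "(\<lambda>p. \<psi> (rot (2 * pi * fst p) (snd p))) \<in> borel_measurable (lborel \<Otimes>\<^sub>M lborel)"
    unfolding lborel_prod measurable_lborel2 by (simp add: borel_measurable_continuous_onI)
  have hm [measurable]: "h \<in> borel_measurable (lborel \<Otimes>\<^sub>M lborel)"
    unfolding h_def case_prod_beta by measurable
  \<comment> \<open>The factorisation into shears excludes the angles 0 and \<open>\<pi>\<close>, which form a null set.\<close>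
  have ae: "AE t in lborel. t \<in> {0..1} \<longrightarrow> sin (2 * pi * t) \<noteq> 0"
  proof -
    have "finite {t \<in> {0..1::real}. sin (2 * pi * t) = 0}"
    proof (rule finite_subset)
      show "{t \<in> {0..1::real}. sin (2 * pi * t) = 0} \<subseteq> {0, 1 / 2, 1}"
      proof
        fix t assume t: "t \<in> {t \<in> {0..1::real}. sin (2 * pi * t) = 0}"
        then obtain i :: int where i: "2 * pi * t = of_int i * pi" by (auto simp: sin_zero_iff_int2)
        then have t2: "t = of_int i / 2" by simp
        then have "0 \<le> i" "i \<le> 2" using t by auto
        then have "i = 0 \<or> i = 1 \<or> i = 2" by arith
        then show "t \<in> {0, 1 / 2, 1}" using t2 by auto
      qed
    qed simp
    then have "emeasure lborel {t \<in> {0..1::real}. sin (2 * pi * t) = 0} = 0"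
      by (rule emeasure_lborel_countable[OF countable_finite])
    then show ?thesis
      by (intro AE_I[where N = "{t \<in> {0..1::real}. sin (2 * pi * t) = 0}"]) (auto intro: \<open>finite _\<close>)
  qed
  have meas\<psi>: "\<psi> \<in> borel_measurable lborel" using \<psi>int by simp
  have rotint: "integrable lborel (\<lambda>v. \<psi> (rot \<theta> v))" "(LINT v|lborel. \<psi> (rot \<theta> v)) = (LINT v|lborel. \<psi> v)"
     "(LINT v|lborel. norm (\<psi> (rot \<theta> v))) = (LINT v|lborel. norm (\<psi> v))" if "sin \<theta> \<noteq> 0" for \<theta>
  proof -
    have m: "rot \<theta> \<in> measurable lborel lborel" using rot_measurable by simp
    show "integrable lborel (\<lambda>v. \<psi> (rot \<theta> v))"
      using integrable_distr[OF m, of \<psi>] \<psi>int distr_rot[OF that] by simp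
    show "(LINT v|lborel. \<psi> (rot \<theta> v)) = (LINT v|lborel. \<psi> v)"
      using integral_distr[OF m meas\<psi>] distr_rot[OF that] by simp
    show "(LINT v|lborel. norm (\<psi> (rot \<theta> v))) = (LINT v|lborel. norm (\<psi> v))"
      using integral_distr[OF m, of "\<lambda>v. norm (\<psi> v)"] meas\<psi> distr_rot[OF that] by simp
  qed
  have ind: "integrable lborel (\<lambda>t. indicator {0..1::real} t * K :: real)" for K
    by (intro integrable_mult_left integrable_real_indicator) auto
  have H: "integrable (lborel \<Otimes>\<^sub>M lborel) h"
  proof (rule lborel_pair.Fubini_integrable[OF hm])
    show "integrable lborel (\<lambda>t. LINT v|lborel. norm (h (t, v)))"
    proof (rule integrable_cong_AE_imp[OF ind[of "LINT v|lborel. norm (\<psi> v)"]])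
      show "(\<lambda>t. LINT v|lborel. norm (h (t, v))) \<in> borel_measurable lborel"
        by (rule lborel.borel_measurable_lebesgue_integral) simp
      show "AE t in lborel. indicator {0..1} t * (LINT v|lborel. norm (\<psi> v)) = (LINT v|lborel. norm (h (t, v)))"
        using ae by eventually_elim (auto simp: h_def indicator_def rotint(3))
    qed
    show "AE t in lborel. integrable lborel (\<lambda>v. h (t, v))"
      using ae by eventually_elim (auto simp: h_def indicator_def rotint(1))
  qed
  then have H': "integrable (lborel \<Otimes>\<^sub>M lborel) (\<lambda>(t, v). h (t, v))" by simp
  have gi: "has_bochner_integral lborel (\<lambda>v. exp (- (k * Q v))) (pi / (k * s))"
  proof (rule has_bochner_integral_nn_integral)
    show "(\<lambda>v. exp (- (k * Q v))) \<in> borel_measurable lborel"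
      using borel_measurable_continuous_onI[OF contQ] by simp
  qed (use plane_gaussian[OF k, of 0] k s in simp_all)
  have "(LINT v|lborel. \<psi> v) = (LINT t|lborel. indicator {0..1::real} t *\<^sub>R (LINT v|lborel. \<psi> v))"
    by simp
  also have "\<dots> = (LINT t|lborel. LINT v|lborel. h (t, v))"
  proof (rule integral_cong_AE)
    show "AE t in lborel. indicator {0..1} t *\<^sub>R (LINT v|lborel. \<psi> v) = (LINT v|lborel. h (t, v))"
      using ae by eventually_elim (auto simp: h_def indicator_def rotint(2))
    show "(\<lambda>t. LINT v|lborel. h (t, v)) \<in> borel_measurable lborel"
      by (rule lborel.borel_measurable_lebesgue_integral) simp
  qed simp
  also have "\<dots> = (LINT v|lborel. LINT t|lborel. h (t, v))"
    using lborel_pair.Fubini_integral[OF H'] by simp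
  also have "\<dots> = (LINT v|lborel. of_real (exp (- (k * Q v))) * H 0)"
  proof (rule Bochner_Integration.integral_cong[OF refl])
    fix v
    have "(LINT t|lborel. h (t, v)) = (LINT t|lborel. of_real (exp (- (k * Q v))) * (indicator {0..1} t *\<^sub>R H (exp (2 * of_real pi * \<i> * of_real t) * eta v)))"
      unfolding h_def rot\<psi> by (simp add: scaleR_conv_of_real mult_ac)
    also have "\<dots> = of_real (exp (- (k * Q v))) * H 0"
      unfolding integral_mult_right_zero mean_value_entire[OF assms(1)] ..
    finally show "(LINT t|lborel. h (t, v)) = of_real (exp (- (k * Q v))) * H 0" .
  qed
  also have "\<dots> = of_real (pi / (k * s)) * H 0"
    using gi by (simp add: has_bochner_integral_iff)
  finally show ?thesis unfolding \<psi>_def .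
qed

lemma repker_sq_int: "sq_int lborel (repker z)"
proof -
  have [measurable]: "Q \<in> borel_measurable borel"
    unfolding Q_def by (intro borel_measurable_continuous_onI continuous_intros)
  have "has_bochner_integral lborel (\<lambda>w. exp (- (c / s * Q (w - z)))) (pi / (c / s * s))"
    by (rule has_bochner_integral_nn_integral) (use plane_gaussian[of "c / s" z] c s in simp_all)
  then have i: "integrable lborel (\<lambda>w. exp (- (c / s * Q (w - z))))" by (simp add: has_bochner_integral_iff)
  have "(cmod (repker z w))\<^sup>2 = pi / (2 * c * s) * exp (- (c / s * Q (w - z)))" for w
    using c s unfolding cmod_repker power_mult_distrib exp_double[symmetric] by simp
  then show ?thesis unfolding sq_int_def using i by simp
qed

text \<open>In the coordinate \<open>\<eta>\<close> the vector field \<open>a \<partial>\<^sub>x + \<i> \<partial>\<^sub>y\<close> is a multiple of the Cauchy-Riemann operator.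
  The exponential factor removes the zeroth-order term \<open>2 c x\<close> from the equation.\<close>

lemma gauged_holomorphic:
  fixes G Gx Gy :: "real \<times> real \<Rightarrow> complex"
  assumes G: "\<And>w. (G has_derivative (\<lambda>h. fst h *\<^sub>R Gx w + snd h *\<^sub>R Gy w)) (at w)"
    and pde: "\<And>w. a * Gx w + \<i> * Gy w + of_real (2 * c * fst w) * G w = 0"
  obtains H where "H holomorphic_on UNIV" "H 0 = G z"
    "\<And>v. H (eta v) = G (z + v) * exp (of_real (c / (2 * s) * Q v) - \<i> * of_real (c * snd v * (fst v + 2 * fst z)))"
proof -
  \<comment> \<open>\<open>V\<close> inverts \<open>eta\<close>.\<close>
  define V where "V = (\<lambda>\<eta>. (- Im \<eta> - b * (Re \<eta> / s), Re \<eta> / s))"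
  have V: "V (eta v) = v" for v
    using s by (cases v) (simp add: V_def Re_eta Im_eta)
  define E where "E = (\<lambda>\<eta>. of_real (c / (2 * s) * ((Re \<eta>)\<^sup>2 + (Im \<eta>)\<^sup>2)) - \<i> * of_real (c * snd (V \<eta>) * (fst (V \<eta>) + 2 * fst z)))"
  define H where "H = (\<lambda>\<eta>. G (z + V \<eta>) * exp (E \<eta>))"
  have "(H has_field_derivative exp (E \<eta>) * (\<i> * Gx (z + V \<eta>) + of_real (c / s) * cnj \<eta> * G (z + V \<eta>))) (at \<eta>)" for \<eta>
  proof -
    define w where "w = z + V \<eta>"
    define p \<delta> where "p = fst (V \<eta>)" and "\<delta> = snd (V \<eta>)"
    have dV: "((\<lambda>\<eta>. z + V \<eta>) has_derivative (\<lambda>h. (- Im h - b * (Re h / s), Re h / s))) (at \<eta>)"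
      unfolding V_def using s by (auto intro!: derivative_eq_intros)
    from has_derivative_compose[OF dV, OF G]
    have dG: "((\<lambda>\<eta>. G (z + V \<eta>)) has_derivative (\<lambda>h. (- Im h - b * (Re h / s)) *\<^sub>R Gx w + (Re h / s) *\<^sub>R Gy w)) (at \<eta>)"
      unfolding w_def by simp
    have dE: "(E has_derivative (\<lambda>h. of_real (c / s * (Re \<eta> * Re h + Im \<eta> * Im h))
        - \<i> * of_real (c * (Re h / s * (p + 2 * fst z) + \<delta> * (- Im h - b * (Re h / s)))))) (at \<eta>)"
      unfolding E_def p_def \<delta>_def V_def fst_conv snd_conv using s
      by (auto intro!: derivative_eq_intros simp: fun_eq_iff field_simps)
    have dexp: "((\<lambda>\<eta>. exp (E \<eta>)) has_derivative (\<lambda>h. exp (E \<eta>) * (of_real (c / s * (Re \<eta> * Re h + Im \<eta> * Im h))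
        - \<i> * of_real (c * (Re h / s * (p + 2 * fst z) + \<delta> * (- Im h - b * (Re h / s))))))) (at \<eta>)"
      using has_derivative_compose[OF dE has_field_derivative_imp_has_derivative[OF DERIV_exp]] .
    have Gy: "Gy w = \<i> * (a * Gx w + of_real (2 * c * (fst z + p)) * G w)"
    proof -
      have "\<i> * (a * Gx w + \<i> * Gy w + of_real (2 * c * fst w) * G w) = 0"
        using pde[of w] by simp
      then have "Gy w = \<i> * (a * Gx w) + \<i> * (of_real (2 * c * fst w) * G w)"
        by (simp add: algebra_simps)
      then show ?thesis by (simp add: w_def p_def algebra_simps)
    qed
    have Re\<eta>: "Re \<eta> = s * \<delta>" and Im\<eta>: "Im \<eta> = - (p + b * \<delta>)"
      using s by (simp_all add: \<delta>_def p_def V_def)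
    have "(H has_derivative (\<lambda>h. exp (E \<eta>) * (\<i> * Gx w + of_real (c / s) * cnj \<eta> * G w) * h)) (at \<eta>)"
      unfolding H_def
    proof (rule has_derivative_eq_rhs[OF has_derivative_mult[OF dG dexp]], rule ext, unfold w_def[symmetric])
      fix h :: complex
      define R I where "R = Re h" and "I = Im h"
      have h: "h = of_real R + \<i> * of_real I" by (simp add: R_def I_def complex_eq_iff)
      have eta: "cnj \<eta> = of_real (s * \<delta>) + \<i> * of_real (p + b * \<delta>)"
        by (simp add: complex_eq_iff Re\<eta> Im\<eta>)
      have s': "complex_of_real s \<noteq> 0" using s by simp
      have factor: "g * (e * x) + y * e = e * q * k" if "g * x + y = q * k" for g e x y q k :: complex
      proof -
        have "g * (e * x) + y * e = e * (g * x + y)" by (simp add: algebra_simps)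
        then show ?thesis using that by simp
      qed
      show "G w * (exp (E \<eta>) * (of_real (c / s * (Re \<eta> * Re h + Im \<eta> * Im h)) - \<i> * of_real (c * (Re h / s * (p + 2 * fst z) + \<delta> * (- Im h - b * (Re h / s))))))
         + ((- Im h - b * (Re h / s)) *\<^sub>R Gx w + (Re h / s) *\<^sub>R Gy w) * exp (E \<eta>)
         = exp (E \<eta>) * (\<i> * Gx w + of_real (c / s) * cnj \<eta> * G w) * h"
      proof -
        have "G w * (of_real (c / s * (Re \<eta> * Re h + Im \<eta> * Im h)) - \<i> * of_real (c * (Re h / s * (p + 2 * fst z) + \<delta> * (- Im h - b * (Re h / s)))))
         + ((- Im h - b * (Re h / s)) *\<^sub>R Gx w + (Re h / s) *\<^sub>R Gy w)
         = (\<i> * Gx w + of_real (c / s) * cnj \<eta> * G w) * h"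
          unfolding R_def[symmetric] I_def[symmetric] eta Gy Re\<eta> Im\<eta> scaleR_conv_of_real h a_def
          using s' by (simp add: field_simps)
        then show ?thesis by (rule factor)
      qed
    qed
    then show ?thesis by (simp add: has_field_derivative_def w_def mult_commute_abs)
  qed
  then have "H holomorphic_on UNIV"
    unfolding holomorphic_on_def field_differentiable_def using has_field_derivative_at_within by blast
  moreover have "H 0 = G z" by (simp add: H_def E_def V_def zero_prod_def[symmetric])
  moreover have "H (eta v) = G (z + v) * exp (of_real (c / (2 * s) * Q v) - \<i> * of_real (c * snd v * (fst v + 2 * fst z)))" for v
    unfolding H_def E_def V cmod_power2[symmetric] cmod_eta ..
  ultimately show thesis by (rule that)
qed

definition rep_const :: real where
  "rep_const = sqrt (pi / (2 * c * s)) * (pi / c)"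

lemma rep_const_pos: "rep_const > 0"
  using c s by (simp add: rep_const_def)

text \<open>For fixed \<open>z\<close>, the Gaussian of the reproducing kernel and the gauge factor of \<open>G\<close> combine to the radial Gaussian
  \<open>exp (- (c / s) Q(w - z))\<close> times an entire function with value \<open>G z\<close> at \<open>\<eta> = 0\<close>.\<close>

lemma reproducing:
  fixes G Gx Gy :: "real \<times> real \<Rightarrow> complex"
  assumes G: "\<And>w. (G has_derivative (\<lambda>h. fst h *\<^sub>R Gx w + snd h *\<^sub>R Gy w)) (at w)"
    and pde: "\<And>w. a * Gx w + \<i> * Gy w + of_real (2 * c * fst w) * G w = 0"
    and G2: "sq_int lborel G"
  shows "(LINT w|lborel. G w * repker z w) = of_real rep_const * G z"
proof -
  obtain H where H: "H holomorphic_on UNIV" "H 0 = G z"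
    "\<And>v. H (eta v) = G (z + v) * exp (of_real (c / (2 * s) * Q v) - \<i> * of_real (c * snd v * (fst v + 2 * fst z)))"
    by (rule gauged_holomorphic[OF G pde, of z]) (rule that; assumption)
  have K: "G (z + v) * repker z (z + v) = of_real (sqrt (pi / (2 * c * s))) * (of_real (exp (- (c / s * Q v))) * H (eta v))" for v
  proof -
    define p \<delta> where "p = fst v" and "\<delta> = snd v"
    have "of_real (c / (2 * s)) * (cnj a * of_real \<delta> + \<i> * of_real p)\<^sup>2 - of_real c * (cnj a * of_real (\<delta>\<^sup>2) + 2 * \<i> * of_real \<delta> * of_real (fst z + p))
      = of_real (- (c / s * Q v)) + (of_real (c / (2 * s) * Q v) - \<i> * of_real (c * \<delta> * (p + 2 * fst z)))"
    proof -
      have sq: "(cnj a * of_real \<delta> + \<i> * of_real p)\<^sup>2 = Complex (s\<^sup>2 * \<delta>\<^sup>2 - (b * \<delta> + p)\<^sup>2) (2 * s * \<delta> * (b * \<delta> + p))"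
        by (simp add: complex_eq_iff a_def power2_eq_square algebra_simps)
      have 1: "c / (2 * s) * (s\<^sup>2 * \<delta>\<^sup>2 - (b * \<delta> + p)\<^sup>2) - c * (s * \<delta>\<^sup>2) = - (c / s * Q v) + c / (2 * s) * Q v"
        using s unfolding Q_def p_def[symmetric] \<delta>_def[symmetric] by (simp add: field_simps power2_eq_square)
      have 2: "c / (2 * s) * (2 * s * \<delta> * (b * \<delta> + p)) - c * (b * \<delta>\<^sup>2 + 2 * \<delta> * (fst z + p)) = - (c * \<delta> * (p + 2 * fst z))"
        using s by (simp add: field_simps power2_eq_square)
      have "of_real (c / (2 * s)) * Complex (s\<^sup>2 * \<delta>\<^sup>2 - (b * \<delta> + p)\<^sup>2) (2 * s * \<delta> * (b * \<delta> + p)) - of_real c * (cnj a * of_real (\<delta>\<^sup>2) + 2 * \<i> * of_real \<delta> * of_real (fst z + p))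
         = Complex (c / (2 * s) * (s\<^sup>2 * \<delta>\<^sup>2 - (b * \<delta> + p)\<^sup>2) - c * (s * \<delta>\<^sup>2)) (c / (2 * s) * (2 * s * \<delta> * (b * \<delta> + p)) - c * (b * \<delta>\<^sup>2 + 2 * \<delta> * (fst z + p)))"
        by (rule complex_eqI) (simp_all add: a_def)
      also have "\<dots> = of_real (- (c / s * Q v)) + (of_real (c / (2 * s) * Q v) - \<i> * of_real (c * \<delta> * (p + 2 * fst z)))"
        unfolding 1 2 by (rule complex_eqI) simp_all
      finally show ?thesis unfolding sq .
    qed
    then have "repker z (z + v) = of_real (sqrt (pi / (2 * c * s))) * (exp (of_real (- (c / s * Q v))) * exp (of_real (c / (2 * s) * Q v) - \<i> * of_real (c * \<delta> * (p + 2 * fst z))))"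
      unfolding repker_eq mult_exp_exp by (simp add: p_def \<delta>_def)
    then show ?thesis
      unfolding H(3) p_def \<delta>_def exp_of_real by (simp only: mult_ac)
  qed
  have "distr lborel lborel ((+) z) = distr lborel borel ((+) z)"
    by (rule distr_cong) simp_all
  then have tr: "distr lborel lborel ((+) z) = lborel"
    using lborel_distr_plus[of z] by simp
  have m: "(+) z \<in> measurable lborel lborel" by simp
  have int: "integrable lborel (\<lambda>w. G w * repker z w)"
    by (rule sq_int_mult[OF G2 repker_sq_int])
  have "integrable lborel (\<lambda>v. G (z + v) * repker z (z + v))"
    using integrable_distr[OF m, of "\<lambda>w. G w * repker z w"] int unfolding tr by simp
  from integrable_mult_right[OF this, of "inverse (of_real (sqrt (pi / (2 * c * s))))"]
  have "integrable lborel (\<lambda>v. inverse (of_real (sqrt (pi / (2 * c * s)))) * (of_real (sqrt (pi / (2 * c * s))) * (of_real (exp (- (c / s * Q v))) * H (eta v))))"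
    unfolding K .
  moreover have "inverse k * (k * x) = x" if "k \<noteq> 0" for k x :: complex
    using that by (simp add: mult.assoc[symmetric])
  moreover have "complex_of_real (sqrt (pi / (2 * c * s))) \<noteq> 0" using c s by simp
  ultimately have int': "integrable lborel (\<lambda>v. of_real (exp (- (c / s * Q v))) * H (eta v))"
    by (simp only: not_False_eq_True)
  have "(LINT w|lborel. G w * repker z w) = (LINT v|lborel. G (z + v) * repker z (z + v))"
    using integral_distr[OF m, of "\<lambda>w. G w * repker z w"] int unfolding tr by simp
  also have "\<dots> = of_real (sqrt (pi / (2 * c * s))) * (of_real (pi / (c / s * s)) * H 0)"
    unfolding K integral_mult_right_zero gaussian_mean_value[OF H(1) int' divide_pos_pos[OF c s]] ..
  also have "\<dots> = of_real rep_const * G z"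
    using s by (simp add: H(2) rep_const_def)
  finally show ?thesis .
qed


section \<open>Every solution on a slice is a transform\<close>

lemma fwd_diff:
  assumes "sq_int lborel f" "sq_int lborel g"
  shows "fwd (\<lambda>u. f u - g u) z = fwd f z - fwd g z"
  unfolding fwd_def left_diff_distrib
  by (intro Bochner_Integration.integral_diff sq_int_mult assms ker_sq_int)

lemma fwd_cmult: "fwd (\<lambda>u. k * f u) z = k * fwd f z"
  unfolding fwd_def mult.assoc by (rule integral_mult_right_zero)

text \<open>The candidate is \<open>adj G / rep_const\<close>, but the adjoint integral need not converge for a function that is
  only square-integrable: the kernel does not decay in \<open>x\<close>.  It is therefore defined as a limit over the
  truncations of \<open>G\<close> to balls.\<close>

lemma fwd_onto:
  fixes G Gx Gy :: "real \<times> real \<Rightarrow> complex"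
  assumes G: "\<And>w. (G has_derivative (\<lambda>h. fst h *\<^sub>R Gx w + snd h *\<^sub>R Gy w)) (at w)"
    and pde: "\<And>w. a * Gx w + \<i> * Gy w + of_real (2 * c * fst w) * G w = 0"
    and G2: "sq_int lborel G"
  obtains f where "sq_int lborel f" "\<And>z. fwd f z = G z"
proof -
  have Gm [measurable]: "G \<in> borel_measurable borel" and Gi: "integrable lborel (\<lambda>w. (cmod (G w))\<^sup>2)"
    using G2 by (auto simp: sq_int_def)
  define B where "B = (\<lambda>n. cball (0 :: real \<times> real) (real n))"
  have [measurable]: "B n \<in> sets borel" for n by (simp add: B_def)
  define Gn where "Gn = (\<lambda>n w. G w * indicator (B n) w)"
  have [measurable]: "Gn n \<in> borel_measurable borel" for n unfolding Gn_def by measurable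
  have Bi: "integrable lborel (\<lambda>w. indicator (B n) w :: real)" for n
    unfolding B_def using emeasure_lborel_cball_finite[of "0 :: real \<times> real" "real n"] by (intro integrable_real_indicator) auto
  have Gn1: "integrable lborel (Gn n)" for n
  proof (rule Bochner_Integration.integrable_bound)
    show "integrable lborel (\<lambda>w. (cmod (G w))\<^sup>2 + indicator (B n) w)"
      by (intro Bochner_Integration.integrable_add Gi Bi)
    have "k \<le> k\<^sup>2 + 1" for k :: real
    proof -
      have "0 \<le> (k - 1 / 2)\<^sup>2 + 3 / 4" by simp
      then show ?thesis by (simp add: power2_eq_square algebra_simps)
    qed
    then show "AE w in lborel. norm (Gn n w) \<le> norm ((cmod (G w))\<^sup>2 + indicator (B n) w)"
      by (intro AE_I2) (auto simp: Gn_def indicator_def)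
  qed simp
  have Gn2: "sq_int lborel (Gn n)" for n
    unfolding sq_int_def
  proof
    show "integrable lborel (\<lambda>w. (cmod (Gn n w))\<^sup>2)"
      by (rule Bochner_Integration.integrable_bound[OF Gi]) (auto simp: Gn_def indicator_def)
  qed simp
  define f where "f = (\<lambda>n u. of_real (1 / rep_const) * adj (Gn n) u)"
  have f2: "sq_int lborel (f n)" for n
    unfolding f_def by (intro sq_int_cmult adj_sq_int(1) Gn1 Gn2)
  define K where "K = (1 / rep_const)\<^sup>2 * schur_const"
  have Kpos: "K > 0" using rep_const_pos schur_const_pos by (simp add: K_def)
  have diff: "(LINT u|lborel. (cmod (f m u - f n u))\<^sup>2) \<le> K * (LINT w|lborel. (cmod (Gn m w - Gn n w))\<^sup>2)" for m n
  proof -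
    have "f m u - f n u = of_real (1 / rep_const) * adj (\<lambda>w. Gn m w - Gn n w) u" for u
      unfolding f_def adj_def left_diff_distrib using adj_integrand[OF Gn1]
      by (simp add: right_diff_distrib del: of_real_divide)
    then have "(cmod (f m u - f n u))\<^sup>2 = (1 / rep_const)\<^sup>2 * (cmod (adj (\<lambda>w. Gn m w - Gn n w) u))\<^sup>2" for u
      by (simp add: norm_mult norm_divide power_mult_distrib power_divide)
    then have "(LINT u|lborel. (cmod (f m u - f n u))\<^sup>2) = (1 / rep_const)\<^sup>2 * (LINT u|lborel. (cmod (adj (\<lambda>w. Gn m w - Gn n w) u))\<^sup>2)"
      by simp
    also have "\<dots> \<le> (1 / rep_const)\<^sup>2 * (schur_const * (LINT w|lborel. (cmod (Gn m w - Gn n w))\<^sup>2))"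
      by (intro mult_left_mono adj_sq_int(2) Bochner_Integration.integrable_diff Gn1 sq_int_diff Gn2) simp
    finally show ?thesis by (simp add: K_def)
  qed
  have ind_lim: "(\<lambda>n. indicator (B n) w :: real) \<longlonglongrightarrow> 1" for w
  proof -
    obtain n0 where "norm w \<le> real n0" using real_arch_simple by blast
    then have "\<forall>n\<ge>n0. indicator (B n) w = (1 :: real)" by (auto simp: B_def indicator_def)
    then show ?thesis by (intro tendsto_eventually) (auto simp: eventually_sequentially)
  qed
  have tail: "(\<lambda>n. LINT w|lborel. (cmod (G w))\<^sup>2 * (1 - indicator (B n) w)) \<longlonglongrightarrow> (LINT w|(lborel :: (real \<times> real) measure). 0)"
  proof (rule integral_dominated_convergence[where w = "\<lambda>w. (cmod (G w))\<^sup>2"])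
    have "(\<lambda>n. (cmod (G w))\<^sup>2 * (1 - indicator (B n) w)) \<longlonglongrightarrow> (cmod (G w))\<^sup>2 * (1 - 1)" for w
      by (intro tendsto_intros ind_lim)
    then show "AE w in lborel. (\<lambda>n. (cmod (G w))\<^sup>2 * (1 - indicator (B n) w)) \<longlonglongrightarrow> 0" by simp
    show "AE w in lborel. norm ((cmod (G w))\<^sup>2 * (1 - indicator (B n) w)) \<le> (cmod (G w))\<^sup>2" for n
      by (intro AE_I2) (auto simp: indicator_def)
  qed (use Gi in measurable)
  have tail_le: "(LINT w|lborel. (cmod (Gn m w - Gn n w))\<^sup>2) \<le> (LINT w|lborel. (cmod (G w))\<^sup>2 * (1 - indicator (B N) w))"
    if "m \<ge> N" "n \<ge> N" for m n N
  proof (rule integral_mono)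
    show "integrable lborel (\<lambda>w. (cmod (Gn m w - Gn n w))\<^sup>2)"
      using sq_int_diff[OF Gn2 Gn2] by (simp add: sq_int_def)
    show "integrable lborel (\<lambda>w. (cmod (G w))\<^sup>2 * (1 - indicator (B N) w))"
      by (rule Bochner_Integration.integrable_bound[OF Gi]) (auto simp: indicator_def)
    show "(cmod (Gn m w - Gn n w))\<^sup>2 \<le> (cmod (G w))\<^sup>2 * (1 - indicator (B N) w)" for w
      using that by (auto simp: Gn_def indicator_def B_def)
  qed
  have "\<exists>N. \<forall>m\<ge>N. \<forall>n\<ge>N. (LINT u|lborel. (cmod (f m u - f n u))\<^sup>2) \<le> e" if "e > 0" for e
  proof -
    have "e / K > 0" using that Kpos by simp
    from LIMSEQ_D[OF tail this] obtain N where N: "\<And>n. n \<ge> N \<Longrightarrow> norm ((LINT w|lborel. (cmod (G w))\<^sup>2 * (1 - indicator (B n) w)) - (LINT w|(lborel :: (real \<times> real) measure). 0)) < e / K"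
      by blast
    have "(LINT u|lborel. (cmod (f m u - f n u))\<^sup>2) \<le> e" if "m \<ge> N" "n \<ge> N" for m n
    proof -
      have "(LINT w|lborel. (cmod (Gn m w - Gn n w))\<^sup>2) \<le> e / K"
        using tail_le[OF that] N[of N] by simp
      then have "K * (LINT w|lborel. (cmod (Gn m w - Gn n w))\<^sup>2) \<le> e"
        using Kpos by (simp add: field_simps)
      then show ?thesis using diff[of m n] by linarith
    qed
    then show ?thesis by blast
  qed
  from L2_complete[OF f2 this] obtain h where h: "sq_int lborel h" "(\<lambda>n. LINT u|lborel. (cmod (f n u - h u))\<^sup>2) \<longlonglongrightarrow> 0"
    by blast
  have "fwd h z = G z" for z
  proof -
    have "(\<lambda>n. LINT w|lborel. Gn n w * repker z w) \<longlonglongrightarrow> (LINT w|lborel. G w * repker z w)"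
    proof (rule integral_dominated_convergence[where w = "\<lambda>w. cmod (G w * repker z w)"])
      have "(\<lambda>n. G w * of_real (indicator (B n) w) * repker z w) \<longlonglongrightarrow> G w * of_real 1 * repker z w" for w
        by (intro tendsto_intros tendsto_of_real ind_lim)
      moreover have "Gn n w = G w * of_real (indicator (B n) w)" for n w
        by (simp add: Gn_def indicator_def)
      ultimately show "AE w in lborel. (\<lambda>n. Gn n w * repker z w) \<longlonglongrightarrow> G w * repker z w" by simp
      show "integrable lborel (\<lambda>w. cmod (G w * repker z w))"
        by (intro integrable_norm sq_int_mult G2 repker_sq_int)
      show "AE w in lborel. norm (Gn n w * repker z w) \<le> cmod (G w * repker z w)" for n
        by (intro AE_I2) (auto simp: Gn_def indicator_def)
    qed measurable
    then have "(\<lambda>n. of_real (1 / rep_const) * (LINT w|lborel. Gn n w * repker z w)) \<longlonglongrightarrow> of_real (1 / rep_const) * (of_real rep_const * G z)"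
      unfolding reproducing[OF G pde G2] by (intro tendsto_mult tendsto_const)
    moreover have "fwd (f n) z = of_real (1 / rep_const) * (LINT w|lborel. Gn n w * repker z w)" for n
      unfolding f_def fwd_cmult fwd_adj[OF Gn1] ..
    ultimately have 1: "(\<lambda>n. fwd (f n) z) \<longlonglongrightarrow> G z"
      using rep_const_pos by simp
    have "(\<lambda>n. fwd (f n) z) \<longlonglongrightarrow> fwd h z"
    proof (rule LIMSEQ_I)
      fix e :: real assume e: "e > 0"
      define k where "k = sqrt (pi / (2 * (c * s)))"
      have k: "k > 0" using c s by (simp add: k_def)
      \<comment> \<open>This choice makes both terms of the bound on the transform at most \<open>e / 2\<close>.\<close>
      define t where "t = 2 * k / e"
      have t: "t > 0" using k e by (simp add: t_def)
      have "e / (2 * t) > 0" using e t by simp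
      from LIMSEQ_D[OF h(2) this] obtain N where N: "\<And>n. n \<ge> N \<Longrightarrow> norm ((LINT u|lborel. (cmod (f n u - h u))\<^sup>2) - 0) < e / (2 * t)" by blast
      have "norm (fwd (f n) z - fwd h z) < e" if "n \<ge> N" for n
      proof -
        have "norm (fwd (f n) z - fwd h z) \<le> t * (LINT u|lborel. (cmod (f n u - h u))\<^sup>2) + k / t"
          using cmod_fwd_le[OF sq_int_diff[OF f2 h(1)] t, of n z] fwd_diff[OF f2 h(1), of n z] by (simp add: k_def)
        also have "\<dots> < t * (e / (2 * t)) + k / t"
          using N[OF that] t by (intro add_strict_right_mono mult_strict_left_mono) auto
        also have "\<dots> = e" using t k e by (simp add: t_def)
        finally show ?thesis .
      qed
      then show "\<exists>no. \<forall>n\<ge>no. norm (fwd (f n) z - fwd h z) < e" by blast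
    qed
    then show ?thesis using 1 by (rule LIMSEQ_unique)
  qed
  with h(1) show thesis by (rule that)
qed

end

section \<open>Unique continuation\<close>

lemma upper_half_plane_curve:
  fixes w :: complex
  assumes "Im w > 0"
  shows "((\<lambda>w. (x, y, Re w, sqrt (Im w))) has_derivative (\<lambda>k. (0, 0, Re k, Im k / (2 * sqrt (Im w))))) (at w)"
  using assms by (auto intro!: derivative_eq_intros simp: zero_prod_def field_simps)

lemma fourth_root_derivative:
  fixes w :: complex
  assumes "Im w > 0"
  shows "((\<lambda>w. 1 / sqrt (sqrt (Im w))) has_derivative (\<lambda>k. - (Im k / (4 * Im w * sqrt (sqrt (Im w)))))) (at w)"
proof -
  have "((\<lambda>v. 1 / sqrt (sqrt v)) has_real_derivative - (1 / (4 * Im w * sqrt (sqrt (Im w))))) (at (Im w))"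
  proof -
    define q where "q = sqrt (sqrt (Im w))"
    have q: "q > 0" "sqrt (Im w) = q\<^sup>2" "Im w = q ^ 4"
    proof -
      show "q > 0" using assms by (simp add: q_def)
      show "sqrt (Im w) = q\<^sup>2" using assms by (simp add: q_def)
      then have "Im w = (q\<^sup>2)\<^sup>2" using assms real_sqrt_pow2[of "Im w"] by simp
      then show "Im w = q ^ 4" by (simp flip: power_mult)
    qed
    have "((\<lambda>v. 1 / sqrt (sqrt v)) has_real_derivative - (inverse (sqrt (Im w)) / 2 * (inverse (sqrt (sqrt (Im w))) / 2) / (sqrt (sqrt (Im w)) * sqrt (sqrt (Im w))))) (at (Im w))"
      using assms by (auto intro!: derivative_eq_intros)
    moreover have "inverse (sqrt (Im w)) / 2 * (inverse (sqrt (sqrt (Im w))) / 2) / (sqrt (sqrt (Im w)) * sqrt (sqrt (Im w))) = 1 / (4 * Im w * sqrt (sqrt (Im w)))"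
      unfolding q_def[symmetric] q(2,3) using q(1) by (simp add: field_simps power_numeral_reduce)
    ultimately show ?thesis by simp
  qed
  then have "((\<lambda>v. 1 / sqrt (sqrt v)) has_derivative (\<lambda>k. - (k / (4 * Im w * sqrt (sqrt (Im w)))))) (at (Im w))"
    by (rule has_derivative_eq_rhs[OF has_field_derivative_imp_has_derivative]) auto
  moreover have "(Im has_derivative Im) (at w)"
    by (rule bounded_linear_imp_has_derivative[OF bounded_linear_Im])
  ultimately show ?thesis
    using has_derivative_compose[of Im Im w UNIV "\<lambda>v. 1 / sqrt (sqrt v)"] by blast
qed

text \<open>With \<open>r = \<surd>(Im w)\<close>, dividing by \<open>\<surd>r\<close> cancels the zeroth-order term of \<open>\<C>\<^sub>2\<close>; what is left is the
  Cauchy-Riemann equation in \<open>w = b + \<i> r\<^sup>2\<close>.\<close>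

lemma normalised_solution_holomorphic:
  assumes D: "grad4 D Dx Dy Db Dr" and P: "pde c D Dx Dy Db Dr Dxx" and w: "Im w > 0"
  shows "((\<lambda>w. of_real (1 / sqrt (sqrt (Im w))) * D (x, y, Re w, sqrt (Im w))) has_field_derivative
    of_real (1 / sqrt (sqrt (Im w))) * Db (x, y, Re w, sqrt (Im w))) (at w)"
proof -
  define r k p where "r = sqrt (Im w)" and "k = 1 / sqrt (sqrt (Im w))" and "p = (x, y, Re w, sqrt (Im w))"
  have r: "r > 0" "r\<^sup>2 = Im w" using w by (auto simp: r_def)
  have gD: "(D has_derivative (\<lambda>h. fst h *\<^sub>R Dx p + fst (snd h) *\<^sub>R Dy p + fst (snd (snd h)) *\<^sub>R Db p + snd (snd (snd h)) *\<^sub>R Dr p)) (at p)"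
    using D r(1) unfolding grad4_def by (simp add: p_def r_def)
  have 1: "((\<lambda>w. D (x, y, Re w, sqrt (Im w))) has_derivative (\<lambda>h. Re h *\<^sub>R Db p + (Im h / (2 * r)) *\<^sub>R Dr p)) (at w)"
    using has_derivative_compose[OF upper_half_plane_curve[OF w, of x y] gD[unfolded p_def]] by (simp add: r_def p_def)
  have 2: "((\<lambda>w. complex_of_real (1 / sqrt (sqrt (Im w)))) has_derivative (\<lambda>h. of_real (- (Im h * k / (4 * r\<^sup>2))))) (at w)"
    by (rule has_derivative_eq_rhs[OF has_derivative_of_real[OF fourth_root_derivative[OF w]]]) (simp add: r(2) k_def mult.commute)
  have C2: "2 * of_real r * Db p + \<i> * Dr p = (\<i> / (2 * of_real r)) * D p"
    using P r(1) unfolding pde_def p_def r_def by blast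
  then have Dr: "Dr p = D p / (2 * of_real r) + 2 * \<i> * of_real r * Db p"
  proof -
    have "\<i> * (2 * of_real r * Db p + \<i> * Dr p) = \<i> * ((\<i> / (2 * of_real r)) * D p)"
      using C2 by simp
    then show ?thesis by (simp add: algebra_simps)
  qed
  have "((\<lambda>w. of_real (1 / sqrt (sqrt (Im w))) * D (x, y, Re w, sqrt (Im w))) has_derivative (\<lambda>h. (of_real k * Db p) * h)) (at w)"
  proof (rule has_derivative_eq_rhs[OF has_derivative_mult[OF 2 1]], rule ext, fold p_def k_def)
    fix h :: complex
    define R I where "R = Re h" and "I = Im h"
    have h: "h = of_real R + \<i> * of_real I" by (simp add: R_def I_def complex_eq_iff)
    have "complex_of_real r \<noteq> 0" using r by simp
    then show "of_real k * (Re h *\<^sub>R Db p + (Im h / (2 * r)) *\<^sub>R Dr p) + of_real (- (Im h * k / (4 * r\<^sup>2))) * D p = of_real k * Db p * h"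
      unfolding R_def[symmetric] I_def[symmetric] Dr scaleR_conv_of_real h
      by (simp add: field_simps power2_eq_square)
  qed
  then show ?thesis by (simp only: has_field_derivative_def k_def p_def)
qed

text \<open>Induction on \<open>n\<close>: the \<open>n\<close>-th derivative at \<open>w\<^sub>0\<close> is a Cauchy integral over a fixed circle, which may be
  differentiated twice in \<open>x\<close>.  If it vanishes for all \<open>x\<close>, so does its second derivative, which by
  \<open>\<S>\<^sub>1\<close> is a multiple of the derivative of order \<open>n + 1\<close>.\<close>

lemma solution_unique:
  assumes sol: "pde_solution c D Dx Dy Db Dr Dxx" and c: "c > 0" and r0: "r0 > 0"
    and zero: "\<And>x y. D (x, y, b0, r0) = 0" and p: "p \<in> R4plus"
  shows "D p = 0"
proof -
  obtain x1 y b1 r1 where p1: "p = (x1, y, b1, r1)" by (cases p)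
  have r1: "r1 > 0" using p p1 by simp
  obtain Dxy Dxb Dxr where D: "grad4 D Dx Dy Db Dr" and DD: "grad4 Dx Dxx Dxy Dxb Dxr" and P: "pde c D Dx Dy Db Dr Dxx"
    and cont: "continuous_on R4plus Dx" "continuous_on R4plus Dxx"
    using sol Ck_continuous unfolding pde_solution_def by blast
  have contD: "continuous_on R4plus D" using D by (rule grad4_continuous)
  \<comment> \<open>\<open>D\<close>, or one of its derivatives, divided by \<open>\<surd>r\<close> and read as a function on the upper half-plane, \<open>y\<close> being fixed.\<close>
  define N where "N = (\<lambda>(F :: fun4) x w. of_real (1 / sqrt (sqrt (Im w))) * F (x, y, Re w, sqrt (Im w)))"
  let ?U = "{w. Im w > 0}"
  have N_hol: "(N D x has_field_derivative N Db x w) (at w)" if "Im w > 0" for x w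
    using normalised_solution_holomorphic[OF D P that, of x y] unfolding N_def .
  have hol: "N D x holomorphic_on ?U" for x
    unfolding holomorphic_on_def field_differentiable_def using N_hol has_field_derivative_at_within by blast
  have N_x: "((\<lambda>x. N D x w) has_vector_derivative N Dx x w) (at x)" "((\<lambda>x. N Dx x w) has_vector_derivative N Dxx x w) (at x)"
    if "Im w > 0" for x w
    unfolding N_def
    by (rule has_vector_derivative_mult_right[OF grad4_partial(1)[OF D]] has_vector_derivative_mult_right[OF grad4_partial(1)[OF DD]], use that in simp)+
  have N_xx: "N Dxx x w = 4 * \<i> * of_real c * deriv (N D x) w" if "Im w > 0" for x w
  proof -
    have "Dxx (x, y, Re w, sqrt (Im w)) = 4 * \<i> * of_real c * Db (x, y, Re w, sqrt (Im w))"
      using P that unfolding pde_def by simp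
    then have "N Dxx x w = 4 * \<i> * of_real c * N Db x w" by (simp add: N_def)
    then show ?thesis using DERIV_imp_deriv[OF N_hol[OF that, of x]] by simp
  qed
  have contN: "continuous_on (UNIV \<times> ?U) (\<lambda>(x, w). N F x w)" if "continuous_on R4plus F" for F
  proof -
    have "continuous_on (UNIV \<times> ?U) (\<lambda>q. F (fst q, y, Re (snd q), sqrt (Im (snd q))))"
      by (rule continuous_on_compose2[OF that]) (auto intro!: continuous_intros)
    then show ?thesis
      unfolding N_def case_prod_beta by (intro continuous_intros) auto
  qed
  define w0 where "w0 = Complex b0 (r0\<^sup>2)"
  \<comment> \<open>Half the distance from \<open>w0\<close> to the real axis.\<close>
  define \<rho> where "\<rho> = r0\<^sup>2 / 2"
  have \<rho>: "\<rho> > 0" using r0 by (simp add: \<rho>_def)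
  have w0: "Im w0 > 0" using r0 by (simp add: w0_def)
  have ball: "cball w0 \<rho> \<subseteq> ?U"
  proof
    fix w assume "w \<in> cball w0 \<rho>"
    then have "\<bar>Im (w0 - w)\<bar> \<le> \<rho>" using abs_Im_le_cmod[of "w0 - w"] by (simp add: dist_norm)
    moreover have "Im (w0 - w) = 2 * \<rho> - Im w" by (simp add: w0_def \<rho>_def)
    ultimately have "0 < Im w" using \<rho> by linarith
    then show "w \<in> ?U" by simp
  qed
  define e where "e = (\<lambda>t. circlepath w0 \<rho> t)"
  have e: "e t \<in> cball w0 \<rho>" for t
    using \<rho> by (simp add: e_def circlepath dist_norm norm_mult)
  have eU: "Im (e t) > 0" for t using subsetD[OF ball e[of t]] by simp
  have conte: "continuous_on UNIV e" unfolding e_def circlepath by (intro continuous_intros)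
  \<comment> \<open>The weight \<open>e' / (e - w0)\<^bsup>n+1\<^esup>\<close> in the Cauchy integral for the \<open>n\<close>-th derivative.\<close>
  define g where "g = (\<lambda>n t. 2 * of_real pi * \<i> * (of_real \<rho> * exp (2 * of_real pi * \<i> * of_real t)) / (of_real \<rho> * exp (2 * of_real pi * \<i> * of_real t)) ^ Suc n)"
  have contg: "continuous_on UNIV (g n)" for n
    unfolding g_def using \<rho> by (intro continuous_intros) auto
  have cauchy: "((\<lambda>t. \<phi> (e t) * g n t) has_integral ((2 * of_real pi * \<i>) / fact n * (deriv ^^ n) \<phi> w0)) (cbox 0 1)"
    if "\<phi> holomorphic_on ?U" for \<phi> n
  proof -
    have "((\<lambda>u. \<phi> u / (u - w0) ^ Suc n) has_contour_integral ((of_real (2 * pi) * \<i>) / fact n * (deriv ^^ n) \<phi> w0)) (circlepath w0 \<rho>)"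
    proof (rule Cauchy_has_contour_integral_higher_derivative_circlepath)
      show "continuous_on (cball w0 \<rho>) \<phi>"
        using that ball by (meson continuous_on_subset holomorphic_on_imp_continuous_on)
      show "\<phi> holomorphic_on ball w0 \<rho>"
        using that ball by (meson ball_subset_cball holomorphic_on_subset subset_trans)
    qed (use \<rho> in simp)
    then have "((\<lambda>t. \<phi> (e t) / (e t - w0) ^ Suc n * vector_derivative (circlepath w0 \<rho>) (at t)) has_integral ((2 * of_real pi * \<i>) / fact n * (deriv ^^ n) \<phi> w0)) {0..1}"
      unfolding has_contour_integral e_def by (simp only: of_real_mult of_real_numeral)
    then have "((\<lambda>t. \<phi> (e t) * g n t) has_integral ((2 * of_real pi * \<i>) / fact n * (deriv ^^ n) \<phi> w0)) {0..1}"
      by (rule has_integral_eq[rotated]) (simp only: vector_derivative_circlepath, simp add: e_def circlepath g_def)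
    then show ?thesis by (simp only: cbox_interval)
  qed
  have leibniz: "((\<lambda>x. integral (cbox 0 1) (\<lambda>t. N F x (e t) * g n t)) has_vector_derivative integral (cbox 0 1) (\<lambda>t. N Fx x (e t) * g n t)) (at x)"
    if F: "\<And>x w. Im w > 0 \<Longrightarrow> ((\<lambda>x. N F x w) has_vector_derivative N Fx x w) (at x)" and c1: "continuous_on R4plus F" and c2: "continuous_on R4plus Fx" for F Fx n x
  proof -
    have comp: "continuous_on UNIV (\<lambda>(x, t). N F x (e t))" if "continuous_on R4plus F" for F
    proof -
      have "continuous_on UNIV (\<lambda>q. (fst q, e (snd q)))"
        by (intro continuous_intros continuous_on_compose2[OF conte]) auto
      from continuous_on_compose2[OF contN[OF that] this] show ?thesis
        using eU by (simp add: case_prod_beta image_subset_iff)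
    qed
    have 1: "((\<lambda>x. N F x (e t) * g n t) has_vector_derivative N Fx x (e t) * g n t) (at x within UNIV)" for x t
      by (intro has_vector_derivative_mult_left F eU)
    have gg: "continuous_on UNIV (\<lambda>(x :: real, t). g n t)"
      unfolding case_prod_beta by (rule continuous_on_compose2[OF contg]) (auto intro: continuous_intros)
    have "continuous_on UNIV (\<lambda>(x, t). N Fx x (e t) * g n t)"
      using continuous_on_mult[OF comp[OF c2] gg] by (simp add: case_prod_beta)
    then have 2: "continuous_on (UNIV \<times> cbox 0 1) (\<lambda>(x, t). N Fx x (e t) * g n t)"
      by (rule continuous_on_subset) simp
    have 3: "(\<lambda>t. N F x (e t) * g n t) integrable_on cbox 0 1" for x
    proof -
      have "continuous_on UNIV (\<lambda>(x, t). N F x (e t) * g n t)"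
        using continuous_on_mult[OF comp[OF c1] gg] by (simp add: case_prod_beta)
      then have "continuous_on (cbox 0 1) (\<lambda>t. case (x, t) of (x, t) \<Rightarrow> N F x (e t) * g n t)"
        by (rule continuous_on_compose2) (auto intro!: continuous_intros)
      then show ?thesis
        by (intro integrable_continuous) simp
    qed
    have "((\<lambda>x. integral (cbox 0 1) (\<lambda>t. N F x (e t) * g n t)) has_vector_derivative integral (cbox 0 1) (\<lambda>t. N Fx x (e t) * g n t)) (at x within UNIV)"
      by (rule leibniz_rule_vector_derivative[OF 1 3 2]) simp_all
    then show ?thesis by simp
  qed
  have all0: "\<forall>x. (deriv ^^ n) (N D x) w0 = 0" for n
  proof (induction n)
    case 0
    show ?case using zero r0 by (simp add: N_def w0_def)
  next
    case (Suc n)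
    have "integral (cbox 0 1) (\<lambda>t. N D x (e t) * g n t) = 0" for x
      using integral_unique[OF cauchy[OF hol[of x], of n]] Suc by simp
    then have "((\<lambda>x :: real. 0 :: complex) has_vector_derivative integral (cbox 0 1) (\<lambda>t. N Dx x (e t) * g n t)) (at x)" for x
      using leibniz[OF N_x(1) contD cont(1), of n x] by simp
    then have "integral (cbox 0 1) (\<lambda>t. N Dx x (e t) * g n t) = 0" for x
      using vector_derivative_unique_at[OF _ has_vector_derivative_const] by blast
    then have "((\<lambda>x :: real. 0 :: complex) has_vector_derivative integral (cbox 0 1) (\<lambda>t. N Dxx x (e t) * g n t)) (at x)" for x
      using leibniz[OF N_x(2) cont(1,2), of n x] by simp
    then have z: "integral (cbox 0 1) (\<lambda>t. N Dxx x (e t) * g n t) = 0" for x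
      using vector_derivative_unique_at[OF _ has_vector_derivative_const] by blast
    show ?case
    proof
      fix x
      have "deriv (N D x) holomorphic_on ?U"
        by (rule holomorphic_deriv[OF hol]) (rule open_halfspace_Im_gt)
      from has_integral_mult_right[OF cauchy[OF this, of n], of "4 * \<i> * of_real c"]
      have "((\<lambda>t. N Dxx x (e t) * g n t) has_integral 4 * \<i> * of_real c * ((2 * of_real pi * \<i>) / fact n * (deriv ^^ n) (deriv (N D x)) w0)) (cbox 0 1)"
        unfolding N_xx[OF eU] by (simp only: mult.assoc)
      then have "4 * \<i> * of_real c * ((2 * of_real pi * \<i>) / fact n * (deriv ^^ n) (deriv (N D x)) w0) = 0"
        using z[of x] integral_unique by metis
      then have "(deriv ^^ n) (deriv (N D x)) w0 = 0" using c by simp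
      then show "(deriv ^^ Suc n) (N D x) w0 = 0" by (simp add: funpow_Suc_right del: funpow.simps)
    qed
  qed
  have "N D x1 (Complex b1 (r1\<^sup>2)) = 0"
  proof (rule holomorphic_fun_eq_0_on_connected[OF hol[of x1]])
    show "open ?U" by (rule open_halfspace_Im_gt)
    show "connected ?U" by (rule convex_connected[OF convex_halfspace_Im_gt])
  qed (use all0 w0 r1 in auto)
  then show ?thesis using r1 by (simp add: N_def p1)
qed

section \<open>Characterisation of the image of the metamorphism\<close>

lemma metamorphism_fwd:
  assumes f: "sq_int lborel f" and h: "hbar > 0" and r: "r > 0"
  shows "metamorphism hbar f (x, y, b, r) = of_real (root 4 (2 * r\<^sup>2)) * gauss_kernel.fwd (pi * hbar) (r\<^sup>2) b f (x, y)"
proof -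
  interpret gauss_kernel "pi * hbar" "r\<^sup>2" b
    by standard (use h r in auto)
  have [measurable]: "f \<in> borel_measurable borel" using f by (simp add: sq_int_def)
  have "(\<lambda>u. f u * ker (x, y) u) \<in> borel_measurable lborel" by measurable
  then have "(LINT u|lebesgue. f u * ker (x, y) u) = fwd f (x, y)"
    unfolding fwd_def by (rule integral_completion)
  then show ?thesis
    unfolding metamorphism_def ker_def a_def by simp
qed

lemma sq_int_imp_L2_real: "sq_int lborel f \<Longrightarrow> f \<in> L2_real"
  unfolding sq_int_def L2_real_def
  by (auto simp: integrable_completion intro: measurable_completion)

lemma metamorphism_slice_integrable:
  assumes f: "sq_int lborel f" and h: "hbar > 0" and r: "r > 0"
  shows "integrable lebesgue (\<lambda>(x, y). (cmod (metamorphism hbar f (x, y, b, r)))\<^sup>2 * k)"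
proof -
  interpret gauss_kernel "pi * hbar" "r\<^sup>2" b
    by standard (use h r in auto)
  have eq: "(\<lambda>(x, y). (cmod (metamorphism hbar f (x, y, b, r)))\<^sup>2 * k) = (\<lambda>w. (cmod (of_real (root 4 (2 * r\<^sup>2)) * fwd f w))\<^sup>2 * k)"
    by (auto simp: fun_eq_iff metamorphism_fwd[OF f h r])
  have "sq_int lborel (\<lambda>w. of_real (root 4 (2 * r\<^sup>2)) * fwd f w)"
    by (intro sq_int_cmult fwd_sq_int f)
  then have "integrable lborel (\<lambda>w. (cmod (of_real (root 4 (2 * r\<^sup>2)) * fwd f w))\<^sup>2 * k)"
    unfolding sq_int_def by simp
  then show ?thesis
    unfolding eq by (subst integrable_completion) (auto dest: borel_measurable_integrable)
qed

lemma solution_slice_sq_int: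
  assumes F: "grad4 F Fx Fy Fb Fr" and r: "r > 0" and k: "k \<noteq> 0"
    and int: "integrable lebesgue (\<lambda>(x, y). (cmod (F (x, y, b, r)))\<^sup>2 * k)"
  shows "sq_int lborel (\<lambda>w. F (fst w, snd w, b, r))"
proof -
  have "continuous_on UNIV (\<lambda>w. F (fst w, snd w, b, r))"
    by (rule continuous_on_compose2[OF grad4_continuous[OF F]]) (use r in \<open>auto intro!: continuous_intros\<close>)
  then have m [measurable]: "(\<lambda>w. F (fst w, snd w, b, r)) \<in> borel_measurable borel"
    by (rule borel_measurable_continuous_onI)
  have "(\<lambda>(x, y). (cmod (F (x, y, b, r)))\<^sup>2 * k) = (\<lambda>w. (cmod (F (fst w, snd w, b, r)))\<^sup>2 * k)"
    by auto
  with int have "integrable lborel (\<lambda>w. (cmod (F (fst w, snd w, b, r)))\<^sup>2 * k)"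
    by (simp add: integrable_completion)
  then have "integrable lborel (\<lambda>w. (cmod (F (fst w, snd w, b, r)))\<^sup>2)"
    using k by simp
  then show ?thesis using m by (simp add: sq_int_def)
qed

text \<open>The first equation of the system restricts to each slice and is there the hypothesis of \<open>fwd_onto\<close>.\<close>

lemma solution_slice_in_image:
  assumes h: "hbar > 0" and F: "pde_solution (pi * hbar) F Fx Fy Fb Fr Fxx" and r: "r > 0"
    and G2: "sq_int lborel (\<lambda>w. F (fst w, snd w, b, r))"
  obtains f where "sq_int lborel f" "\<And>x y. metamorphism hbar f (x, y, b, r) = F (x, y, b, r)"
proof -
  interpret gauss_kernel "pi * hbar" "r\<^sup>2" b
    by standard (use h r in auto)
  have gF: "grad4 F Fx Fy Fb Fr" and P: "pde (pi * hbar) F Fx Fy Fb Fr Fxx"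
    using F by (auto simp: pde_solution_def)
  define G where "G = (\<lambda>w. F (fst w, snd w, b, r))"
  have "(G has_derivative (\<lambda>h. fst h *\<^sub>R Fx (fst w, snd w, b, r) + snd h *\<^sub>R Fy (fst w, snd w, b, r))) (at w)" for w
  proof -
    have 1: "((\<lambda>w. (fst w, snd w, b, r)) has_derivative (\<lambda>h. (fst h, snd h, 0, 0))) (at w)"
      by (auto intro!: derivative_eq_intros simp: zero_prod_def)
    have 2: "(F has_derivative (\<lambda>h. fst h *\<^sub>R Fx (fst w, snd w, b, r) + fst (snd h) *\<^sub>R Fy (fst w, snd w, b, r)
        + fst (snd (snd h)) *\<^sub>R Fb (fst w, snd w, b, r) + snd (snd (snd h)) *\<^sub>R Fr (fst w, snd w, b, r))) (at (fst w, snd w, b, r))"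
      using gF r unfolding grad4_def by simp
    show ?thesis using has_derivative_compose[OF 1 2] by (simp add: G_def)
  qed
  moreover have "a * Fx (fst w, snd w, b, r) + \<i> * Fy (fst w, snd w, b, r) + of_real (2 * (pi * hbar) * fst w) * G w = 0" for w
    using P r unfolding pde_def a_def G_def by blast
  moreover have "sq_int lborel G" using G2 by (simp add: G_def)
  ultimately obtain f where f: "sq_int lborel f" "\<And>z. fwd f z = G z"
    by (rule fwd_onto) (rule that; assumption)
  define k where "k = complex_of_real (root 4 (2 * r\<^sup>2))"
  have k: "k \<noteq> 0" using r by (simp add: k_def)
  have k2: "sq_int lborel (\<lambda>u. (1 / k) * f u)" by (rule sq_int_cmult[OF f(1)])
  have "metamorphism hbar (\<lambda>u. (1 / k) * f u) (x, y, b, r) = F (x, y, b, r)" for x y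
    unfolding metamorphism_fwd[OF k2 h r] fwd_cmult f(2) k_def[symmetric] using k by (simp add: G_def)
  with k2 show thesis by (rule that)
qed

theorem theorem5p5:
  fixes hbar :: real and F :: "real \<times> real \<times> real \<times> real \<Rightarrow> complex"
  assumes "hbar > 0"
  shows "(\<exists>f\<in>L2_real. \<forall>p\<in>R4plus. F p = metamorphism hbar f p) \<longleftrightarrow>
    (annihilated_by_C1_C2_S1 hbar F \<and>
     (\<exists>b0 r0. r0 > 0 \<and>
        integrable lebesgue
          (\<lambda>(x, y). (cmod (F (x, y, b0, r0)))\<^sup>2 * (hbar / sqrt (2 * r0)))))"
proof
  assume "\<exists>f\<in>L2_real. \<forall>p\<in>R4plus. F p = metamorphism hbar f p"
  then obtain f0 where f0: "f0 \<in> L2_real" "\<And>p. p \<in> R4plus \<Longrightarrow> F p = metamorphism hbar f0 p" by blast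
  obtain f where f: "sq_int lborel f" "metamorphism hbar f = metamorphism hbar f0"
    by (rule L2_real_representative[OF f0(1)])
  have F: "F p = metamorphism hbar f p" if "p \<in> R4plus" for p
    using f0(2)[OF that] f(2) by simp
  have "annihilated_by_C1_C2_S1 hbar F"
    by (rule annihilated_cong[OF metamorphism_annihilated[OF f(1) assms]]) (simp add: F)
  moreover have "integrable lebesgue (\<lambda>(x, y). (cmod (F (x, y, 0, 1)))\<^sup>2 * (hbar / sqrt (2 * 1)))"
    using metamorphism_slice_integrable[OF f(1) assms, of 1 0 "hbar / sqrt (2 * 1)"] by (simp add: F)
  ultimately show "annihilated_by_C1_C2_S1 hbar F \<and> (\<exists>b0 r0. r0 > 0 \<and>
        integrable lebesgue (\<lambda>(x, y). (cmod (F (x, y, b0, r0)))\<^sup>2 * (hbar / sqrt (2 * r0))))"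
    by (intro conjI exI[of _ 0] exI[of _ 1]) simp_all
next
  assume "annihilated_by_C1_C2_S1 hbar F \<and> (\<exists>b0 r0. r0 > 0 \<and>
        integrable lebesgue (\<lambda>(x, y). (cmod (F (x, y, b0, r0)))\<^sup>2 * (hbar / sqrt (2 * r0))))"
  then obtain b0 r0 where A: "annihilated_by_C1_C2_S1 hbar F" and r0: "r0 > 0"
    and int: "integrable lebesgue (\<lambda>(x, y). (cmod (F (x, y, b0, r0)))\<^sup>2 * (hbar / sqrt (2 * r0)))" by blast
  obtain Fx Fy Fb Fr Fxx where F: "pde_solution (pi * hbar) F Fx Fy Fb Fr Fxx"
    using A unfolding annihilated_iff by blast
  then have gF: "grad4 F Fx Fy Fb Fr" by (simp add: pde_solution_def)
  have "hbar / sqrt (2 * r0) \<noteq> 0" using assms r0 by simp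
  note G2 = solution_slice_sq_int[OF gF r0 this int]
  obtain f where f: "sq_int lborel f" "\<And>x y. metamorphism hbar f (x, y, b0, r0) = F (x, y, b0, r0)"
    by (rule solution_slice_in_image[OF assms F r0 G2]) (rule that; assumption)
  obtain Dx Dy Db Dr Dxx where D: "pde_solution (pi * hbar) (\<lambda>p. F p - metamorphism hbar f p) Dx Dy Db Dr Dxx"
    using annihilated_diff[OF A metamorphism_annihilated[OF f(1) assms]] unfolding annihilated_iff by blast
  have "F p - metamorphism hbar f p = 0" if "p \<in> R4plus" for p
    by (rule solution_unique[OF D _ r0 _ that, of b0]) (use assms f(2) in auto)
  then show "\<exists>f\<in>L2_real. \<forall>p\<in>R4plus. F p = metamorphism hbar f p"
    using sq_int_imp_L2_real[OF f(1)] by auto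
qed

end
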